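(* Let $F$ be a free group of finite rank $k\ge 3$. Then there is no $Out(F)$-equivariant (or $Out(F)$-anti-equivariant) topological embedding from $\partial CV(F)$ to $\mathbb{P}Curr(F)$.
   Context: Currents. $\partial F$ is the hyperbolic (Gromov) boundary of $F$, and $\partial^2F=\{(\zeta,\xi): \zeta,\xi\in\partial F,\ \zeta\neq\xi\}$, with flip map $\sigma(\zeta,\xi)=(\xi,\zeta)$. A geodesic current on $F$ is a positive Radon measure on $\partial^2F$ that is $F$-invariant and $\sigma$-invariant. $Curr(F)$ is the space of all geodesic currents with the weak topology: $\nu_n\to\nu$ iff $\nu_n(S\times S')\to\nu(S\times S')$ for all disjoint closed-open $S,S'\subseteq\partial F$. $\mathbb{P}Curr(F)$ is the set of non-zero currents modulo multiplication by non-zero (necessarily positive) scalars, with the quotient topology; the class of $\nu$ is $[\nu]$. An automorphism $\phi\in Aut(F)$ induces a homeomorphism $\hat\phi$ of $\partial^2F$, and $(\phi\nu)(S)=\nu(\hat\phi^{-1}(S))$; this induces a continuous left action of $Out(F)$ on $\mathbb{P}Curr(F)$. Outer space. $cv(F)$ is the space of $\mathbb{R}$-trees $T$ with a minimal, free and discrete isometric action of $F$, up to $F$-equivariant isometry, identified with the set of their translation length functions $\|\cdot\|_T\in\mathbb{R}^F$ (topology of pointwise convergence). $CV(F)=\mathbb{P}cv(F)\subset\mathbb{P}\mathbb{R}^F=(\mathbb{R}^F\setminus\{0\})/\text{scaling}$ is its projectivization, $\overline{CV(F)}$ is its (compact) closure in $\mathbb{P}\mathbb{R}^F$, and $\partial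 CV(F)=\overline{CV(F)}\setminus CV(F)$. $Out(F)$ acts on the left by homeomorphisms via $\|w\|_{\phi T}=\|\phi^{-1}(w)\|_T$. A map $\tau:X\to Z$ between spaces with left $Out(F)$-actions is equivariant if $\tau(\phi x)=\phi\,\tau(x)$, and anti-equivariant if $\tau(\phi x)=\phi^{-1}\tau(x)$, for all $\phi\in Out(F)$ and $x\in X$. A topological embedding is a homeomorphism onto its image. *)

theory Defs
  imports "HOL-Analysis.Analysis" "HOL-Algebra.Group_Action"
begin

section \<open>Quotient topologies\<close>

definition quotient_topology :: "'a topology \<Rightarrow> ('a \<Rightarrow> 'b) \<Rightarrow> 'b topology" where
  "quotient_topology T q =
     topology (\<lambda>U. U \<subseteq> q ` topspace T \<and> openin T {x \<in> topspace T. q x \<in> U})"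

lemma openin_quotient_topology:
  "openin (quotient_topology T q) U \<longleftrightarrow>
     U \<subseteq> q ` topspace T \<and> openin T {x \<in> topspace T. q x \<in> U}"
proof -
  have "istopology (\<lambda>U. U \<subseteq> q ` topspace T \<and> openin T {x \<in> topspace T. q x \<in> U})"
    unfolding istopology_def
  proof (intro conjI allI impI)
    fix S U
    assume "S \<subseteq> q ` topspace T \<and> openin T {x \<in> topspace T. q x \<in> S}"
      and "U \<subseteq> q ` topspace T \<and> openin T {x \<in> topspace T. q x \<in> U}"
    moreover have "{x \<in> topspace T. q x \<in> S \<inter> U} =
        {x \<in> topspace T. q x \<in> S} \<inter> {x \<in> topspace T. q x \<in> U}"
      by auto
    ultimately show "S \<inter> U \<subseteq> q ` topspace T" "openin T {x \<in> topspace T. q x \<in> S \<inter> U}"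
      by (auto simp: openin_Int)
  next
    fix K
    assume K: "\<forall>U\<in>K. U \<subseteq> q ` topspace T \<and> openin T {x \<in> topspace T. q x \<in> U}"
    then show "\<Union>K \<subseteq> q ` topspace T" by blast
    have "{x \<in> topspace T. q x \<in> \<Union>K} = (\<Union>U\<in>K. {x \<in> topspace T. q x \<in> U})"
      by auto
    then show "openin T {x \<in> topspace T. q x \<in> \<Union>K}"
      using K by auto
  qed
  then show ?thesis
    unfolding quotient_topology_def by (simp add: topology_inverse')
qed

lemma topspace_quotient_topology [simp]: "topspace (quotient_topology T q) = q ` topspace T"
proof
  show "topspace (quotient_topology T q) \<subseteq> q ` topspace T"
    using openin_topspace[of "quotient_topology T q"] by (simp only: openin_quotient_topology)
  have "{x \<in> topspace T. q x \<in> q ` topspace T} = topspace T" by auto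
  then have "openin (quotient_topology T q) (q ` topspace T)"
    by (simp add: openin_quotient_topology)
  then show "q ` topspace T \<subseteq> topspace (quotient_topology T q)"
    by (rule openin_subset)
qed

lemma quotient_map_quotient_topology: "quotient_map T (quotient_topology T q) q"
  by (auto simp: quotient_map_def openin_quotient_topology)


section \<open>Free groups and outer automorphisms\<close>

text \<open>A word over \<open>X\<close> is a list of letters; \<open>(x, True)\<close> stands for \<open>x\<close> and \<open>(x, False)\<close> for
  its inverse.\<close>

definition words :: "'a set \<Rightarrow> ('a \<times> bool) list set" where
  "words X = {w. fst ` set w \<subseteq> X}"

definition word_value :: "('a, 'm) monoid_scheme \<Rightarrow> ('a \<times> bool) list \<Rightarrow> 'a" where
  "word_value F w =
     foldr (\<lambda>(x, e) g. (if e then x else inv\<^bsub>F\<^esub> x) \<otimes>\<^bsub>F\<^esub> g) w \<one>\<^bsub>F\<^esub>"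

definition reduced_words :: "'a set \<Rightarrow> ('a \<times> bool) list set" where
  "reduced_words X = {w \<in> words X.
     \<forall>i. Suc i < length w \<longrightarrow> \<not> (fst (w ! i) = fst (w ! Suc i) \<and> snd (w ! i) \<noteq> snd (w ! Suc i))}"

definition free_group_on :: "('a, 'm) monoid_scheme \<Rightarrow> 'a set \<Rightarrow> bool" where
  "free_group_on F X \<longleftrightarrow> group F \<and> X \<subseteq> carrier F \<and>
     bij_betw (word_value F) (reduced_words X) (carrier F)"

definition Inn :: "('a, 'm) monoid_scheme \<Rightarrow> ('a \<Rightarrow> 'a) set" where
  "Inn F = (\<lambda>g. \<lambda>h\<in>carrier F. g \<otimes>\<^bsub>F\<^esub> h \<otimes>\<^bsub>F\<^esub> inv\<^bsub>F\<^esub> g) ` carrier F"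

definition Out :: "('a, 'm) monoid_scheme \<Rightarrow> ('a \<Rightarrow> 'a) set monoid" where
  "Out F = AutoGroup F Mod Inn F"

text \<open>An action of \<open>Aut(F)\<close> for which inner automorphisms act trivially on \<open>x\<close> gives an action
  of \<open>Out(F)\<close>: every representative of the coset \<open>\<Phi>\<close> sends \<open>x\<close> to the same point.\<close>

definition out_action :: "(('a \<Rightarrow> 'a) \<Rightarrow> 'x \<Rightarrow> 'x) \<Rightarrow> ('a \<Rightarrow> 'a) set \<Rightarrow> 'x \<Rightarrow> 'x" where
  "out_action act \<Phi> x = (THE y. \<forall>\<phi>\<in>\<Phi>. act \<phi> x = y)"


section \<open>The Gromov boundary\<close>

definition word_length :: "('a, 'm) monoid_scheme \<Rightarrow> 'a set \<Rightarrow> 'a \<Rightarrow> nat" where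
  "word_length F X g = (LEAST n. \<exists>w\<in>words X. length w = n \<and> word_value F w = g)"

definition word_dist :: "('a, 'm) monoid_scheme \<Rightarrow> 'a set \<Rightarrow> 'a \<Rightarrow> 'a \<Rightarrow> real" where
  "word_dist F X g h = real (word_length F X (inv\<^bsub>F\<^esub> g \<otimes>\<^bsub>F\<^esub> h))"

definition gromov_product :: "('a, 'm) monoid_scheme \<Rightarrow> 'a set \<Rightarrow> 'a \<Rightarrow> 'a \<Rightarrow> real" where
  "gromov_product F X g h =
     (word_dist F X \<one>\<^bsub>F\<^esub> g + word_dist F X \<one>\<^bsub>F\<^esub> h - word_dist F X g h) / 2"

definition gromov_equiv :: "('a, 'm) monoid_scheme \<Rightarrow> 'a set \<Rightarrow> (nat \<Rightarrow> 'a) \<Rightarrow> (nat \<Rightarrow> 'a) \<Rightarrow> bool" where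
  "gromov_equiv F X u v \<longleftrightarrow>
     filterlim (\<lambda>(i, j). gromov_product F X (u i) (v j)) at_top (sequentially \<times>\<^sub>F sequentially)"

definition gromov_sequences :: "('a, 'm) monoid_scheme \<Rightarrow> 'a set \<Rightarrow> (nat \<Rightarrow> 'a) set" where
  "gromov_sequences F X = {u. range u \<subseteq> carrier F \<and> gromov_equiv F X u u}"

text \<open>Points of the boundary are classes of sequences of group elements converging to infinity.
  For a hyperbolic group, the set of classes and its topology are the same for all finite
  generating sets \<open>X\<close>.\<close>

type_synonym 'a bpoint = "(nat \<Rightarrow> 'a) set"

definition boundary :: "('a, 'm) monoid_scheme \<Rightarrow> 'a set \<Rightarrow> 'a bpoint set" where
  "boundary F X = gromov_sequences F X //
     {(u, v). u \<in> gromov_sequences F X \<and> v \<in> gromov_sequences F X \<and> gromov_equiv F X u v}"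

text \<open>The set of all \<open>q\<close> whose extended Gromov product with \<open>p\<close>, the supremum over
  representatives of \<open>liminf\<close> of the Gromov products, is at least \<open>r\<close>. (Gromov products are
  half-integers, so the \<open>liminf\<close> is at least \<open>r\<close> iff the products eventually are, and the
  supremum is at least \<open>r\<close> iff this happens for some representatives.)\<close>

definition boundary_nbhd ::
    "('a, 'm) monoid_scheme \<Rightarrow> 'a set \<Rightarrow> 'a bpoint \<Rightarrow> real \<Rightarrow> 'a bpoint set" where
  "boundary_nbhd F X p r = {q \<in> boundary F X. \<exists>u\<in>p. \<exists>v\<in>q.
     eventually (\<lambda>(i, j). r \<le> gromov_product F X (u i) (v j)) (sequentially \<times>\<^sub>F sequentially)}"

definition boundary_topology :: "('a, 'm) monoid_scheme \<Rightarrow> 'a set \<Rightarrow> 'a bpoint topology" where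
  "boundary_topology F X =
     topology (\<lambda>U. U \<subseteq> boundary F X \<and> (\<forall>p\<in>U. \<exists>r. boundary_nbhd F X p r \<subseteq> U))"

lemma boundary_nbhd_antimono:
  assumes "r \<le> s" shows "boundary_nbhd F X p s \<subseteq> boundary_nbhd F X p r"
  unfolding boundary_nbhd_def
  using assms by (force elim!: eventually_mono)

lemma openin_boundary_topology:
  "openin (boundary_topology F X) U \<longleftrightarrow>
     U \<subseteq> boundary F X \<and> (\<forall>p\<in>U. \<exists>r. boundary_nbhd F X p r \<subseteq> U)"
proof -
  have "istopology (\<lambda>U. U \<subseteq> boundary F X \<and> (\<forall>p\<in>U. \<exists>r. boundary_nbhd F X p r \<subseteq> U))"
    unfolding istopology_def
  proof (intro conjI allI impI ballI)
    fix S U p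
    assume S: "S \<subseteq> boundary F X \<and> (\<forall>p\<in>S. \<exists>r. boundary_nbhd F X p r \<subseteq> S)"
      and U: "U \<subseteq> boundary F X \<and> (\<forall>p\<in>U. \<exists>r. boundary_nbhd F X p r \<subseteq> U)"
    then show "S \<inter> U \<subseteq> boundary F X" by blast
    assume "p \<in> S \<inter> U"
    then obtain r s where "boundary_nbhd F X p r \<subseteq> S" "boundary_nbhd F X p s \<subseteq> U"
      using S U by blast
    then have "boundary_nbhd F X p (max r s) \<subseteq> S \<inter> U"
      using boundary_nbhd_antimono[of r "max r s"] boundary_nbhd_antimono[of s "max r s"]
      by fastforce
    then show "\<exists>r. boundary_nbhd F X p r \<subseteq> S \<inter> U" by blast
  next
    fix K p
    assume K: "\<forall>U\<in>K. U \<subseteq> boundary F X \<and> (\<forall>p\<in>U. \<exists>r. boundary_nbhd F X p r \<subseteq> U)"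
    then show "\<Union>K \<subseteq> boundary F X" by blast
    assume "p \<in> \<Union>K"
    then show "\<exists>r. boundary_nbhd F X p r \<subseteq> \<Union>K"
      using K by (meson Union_iff Union_upper subset_trans)
  qed
  then show ?thesis
    unfolding boundary_topology_def by (simp add: topology_inverse')
qed

lemma topspace_boundary_topology [simp]: "topspace (boundary_topology F X) = boundary F X"
proof
  show "topspace (boundary_topology F X) \<subseteq> boundary F X"
    using openin_topspace[of "boundary_topology F X"] by (simp only: openin_boundary_topology)
  have "openin (boundary_topology F X) (boundary F X)"
    by (auto simp: openin_boundary_topology boundary_nbhd_def)
  then show "boundary F X \<subseteq> topspace (boundary_topology F X)"
    by (rule openin_subset)
qed

definition boundary2_topology ::
    "('a, 'm) monoid_scheme \<Rightarrow> 'a set \<Rightarrow> ('a bpoint \<times> 'a bpoint) topology" where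
  "boundary2_topology F X =
     subtopology (prod_topology (boundary_topology F X) (boundary_topology F X)) {(p, q). p \<noteq> q}"

text \<open>The map of the boundary induced by a self-bijection \<open>f\<close> of \<open>F\<close> that is a quasi-isometry,
  such as a left translation or an automorphism; for such \<open>f\<close> the image of a class is a class.\<close>

definition boundary_map :: "('a \<Rightarrow> 'a) \<Rightarrow> 'a bpoint \<Rightarrow> 'a bpoint" where
  "boundary_map f p = (\<lambda>u. f \<circ> u) ` p"

definition boundary2_map :: "('a \<Rightarrow> 'a) \<Rightarrow> 'a bpoint \<times> 'a bpoint \<Rightarrow> 'a bpoint \<times> 'a bpoint" where
  "boundary2_map f = map_prod (boundary_map f) (boundary_map f)"


section \<open>Geodesic currents\<close>

definition radon_measure :: "'x topology \<Rightarrow> 'x measure \<Rightarrow> bool" where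
  "radon_measure T \<nu> \<longleftrightarrow>
     sets \<nu> = sigma_sets (topspace T) {U. openin T U} \<and>
     (\<forall>K. compactin T K \<longrightarrow> emeasure \<nu> K < \<infinity>) \<and>
     (\<forall>A\<in>sets \<nu>. emeasure \<nu> A = (INF U\<in>{U. openin T U \<and> A \<subseteq> U}. emeasure \<nu> U)) \<and>
     (\<forall>U. openin T U \<longrightarrow>
        emeasure \<nu> U = (SUP K\<in>{K. compactin T K \<and> K \<subseteq> U}. emeasure \<nu> K))"

type_synonym 'a current = "('a bpoint \<times> 'a bpoint) measure"

definition Curr :: "('a, 'm) monoid_scheme \<Rightarrow> 'a set \<Rightarrow> 'a current set" where
  "Curr F X = {\<nu>. radon_measure (boundary2_topology F X) \<nu> \<and>
     (\<forall>g\<in>carrier F. \<forall>A\<in>sets \<nu>.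
        emeasure \<nu> (boundary2_map (\<lambda>h. g \<otimes>\<^bsub>F\<^esub> h) ` A) = emeasure \<nu> A) \<and>
     (\<forall>A\<in>sets \<nu>. emeasure \<nu> (prod.swap ` A) = emeasure \<nu> A)}"

definition clopen_pairs ::
    "('a, 'm) monoid_scheme \<Rightarrow> 'a set \<Rightarrow> ('a bpoint set \<times> 'a bpoint set) set" where
  "clopen_pairs F X = {(S, S'). S \<inter> S' = {} \<and>
     openin (boundary_topology F X) S \<and> closedin (boundary_topology F X) S \<and>
     openin (boundary_topology F X) S' \<and> closedin (boundary_topology F X) S'}"

text \<open>The coarsest topology for which all evaluations on \<open>S \<times> S'\<close> are continuous. These values
  are finite because \<open>S \<times> S'\<close> is a compact subset of \<open>\<partial>\<^sup>2F\<close>.\<close>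

definition Curr_topology :: "('a, 'm) monoid_scheme \<Rightarrow> 'a set \<Rightarrow> 'a current topology" where
  "Curr_topology F X = pullback_topology (Curr F X)
     (\<lambda>\<nu>. \<lambda>(S, S')\<in>clopen_pairs F X. measure \<nu> (S \<times> S'))
     (product_topology (\<lambda>_. euclideanreal) (clopen_pairs F X))"

definition current_class :: "'a current \<Rightarrow> 'a current set" where
  "current_class \<nu> = {scale_measure (ennreal c) \<nu> |c. 0 < c}"

definition PCurr_topology :: "('a, 'm) monoid_scheme \<Rightarrow> 'a set \<Rightarrow> 'a current set topology" where
  "PCurr_topology F X = quotient_topology
     (subtopology (Curr_topology F X) {\<nu>. emeasure \<nu> (space \<nu>) \<noteq> 0}) current_class"

definition aut_current :: "('a \<Rightarrow> 'a) \<Rightarrow> 'a current \<Rightarrow> 'a current" where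
  "aut_current \<phi> \<nu> = distr \<nu> \<nu> (boundary2_map \<phi>)"

definition aut_PCurr :: "('a \<Rightarrow> 'a) \<Rightarrow> 'a current set \<Rightarrow> 'a current set" where
  "aut_PCurr \<phi> c = aut_current \<phi> ` c"


section \<open>Outer space\<close>

definition arc_in :: "'b topology \<Rightarrow> (real \<Rightarrow> 'b) \<Rightarrow> bool" where
  "arc_in T a \<longleftrightarrow> pathin T a \<and> inj_on a {0..1}"

definition real_tree :: "'b set \<Rightarrow> ('b \<Rightarrow> 'b \<Rightarrow> real) \<Rightarrow> bool" where
  "real_tree M d \<longleftrightarrow> Metric_space M d \<and> M \<noteq> {} \<and>
     (\<forall>x\<in>M. \<forall>y\<in>M. \<exists>\<gamma>. \<gamma> \<in> {0..d x y} \<rightarrow> M \<and> \<gamma> 0 = x \<and> \<gamma> (d x y) = y \<and>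
        (\<forall>s\<in>{0..d x y}. \<forall>t\<in>{0..d x y}. d (\<gamma> s) (\<gamma> t) = \<bar>s - t\<bar>)) \<and>
     (\<forall>a b. arc_in (Metric_space.mtopology M d) a \<and> arc_in (Metric_space.mtopology M d) b \<and>
        a 0 = b 0 \<and> a 1 = b 1 \<longrightarrow> a ` {0..1} = b ` {0..1})"

definition isometric_action ::
    "('a, 'm) monoid_scheme \<Rightarrow> 'b set \<Rightarrow> ('b \<Rightarrow> 'b \<Rightarrow> real) \<Rightarrow> ('a \<Rightarrow> 'b \<Rightarrow> 'b) \<Rightarrow> bool" where
  "isometric_action F M d \<alpha> \<longleftrightarrow> group_action F M \<alpha> \<and>
     (\<forall>g\<in>carrier F. \<forall>x\<in>M. \<forall>y\<in>M. d (\<alpha> g x) (\<alpha> g y) = d x y)"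

definition free_action :: "('a, 'm) monoid_scheme \<Rightarrow> 'b set \<Rightarrow> ('a \<Rightarrow> 'b \<Rightarrow> 'b) \<Rightarrow> bool" where
  "free_action F M \<alpha> \<longleftrightarrow> (\<forall>x\<in>M. stabilizer F \<alpha> x = {\<one>\<^bsub>F\<^esub>})"

definition discrete_action ::
    "('a, 'm) monoid_scheme \<Rightarrow> 'b set \<Rightarrow> ('b \<Rightarrow> 'b \<Rightarrow> real) \<Rightarrow> ('a \<Rightarrow> 'b \<Rightarrow> 'b) \<Rightarrow> bool" where
  "discrete_action F M d \<alpha> \<longleftrightarrow> (\<forall>x\<in>M.
     subtopology (Metric_space.mtopology M d) (orbit F \<alpha> x) = discrete_topology (orbit F \<alpha> x))"

text \<open>Subtrees are the non-empty connected subsets.\<close>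

definition minimal_action ::
    "('a, 'm) monoid_scheme \<Rightarrow> 'b set \<Rightarrow> ('b \<Rightarrow> 'b \<Rightarrow> real) \<Rightarrow> ('a \<Rightarrow> 'b \<Rightarrow> 'b) \<Rightarrow> bool" where
  "minimal_action F M d \<alpha> \<longleftrightarrow> (\<forall>S. S \<noteq> {} \<and> connectedin (Metric_space.mtopology M d) S \<and>
     (\<forall>g\<in>carrier F. \<alpha> g ` S \<subseteq> S) \<longrightarrow> S = M)"

definition outer_space_tree ::
    "('a, 'm) monoid_scheme \<Rightarrow> 'b set \<Rightarrow> ('b \<Rightarrow> 'b \<Rightarrow> real) \<Rightarrow> ('a \<Rightarrow> 'b \<Rightarrow> 'b) \<Rightarrow> bool" where
  "outer_space_tree F M d \<alpha> \<longleftrightarrow> real_tree M d \<and> isometric_action F M d \<alpha> \<and>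
     minimal_action F M d \<alpha> \<and> free_action F M \<alpha> \<and> discrete_action F M d \<alpha>"

definition length_function ::
    "('a, 'm) monoid_scheme \<Rightarrow> 'b set \<Rightarrow> ('b \<Rightarrow> 'b \<Rightarrow> real) \<Rightarrow> ('a \<Rightarrow> 'b \<Rightarrow> 'b) \<Rightarrow> 'a \<Rightarrow> real" where
  "length_function F M d \<alpha> = (\<lambda>g\<in>carrier F. INF x\<in>M. d x (\<alpha> g x))"

text \<open>It is enough to consider trees whose points are real numbers (with an arbitrary metric):
  a non-trivial real tree with a minimal action of a countable group is a countable union of
  segments, so it has the cardinality of the continuum.\<close>

definition cv :: "('a, 'm) monoid_scheme \<Rightarrow> ('a \<Rightarrow> real) set" where
  "cv F = {length_function F M d \<alpha> |(M :: real set) d \<alpha>. outer_space_tree F M d \<alpha>}"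

definition proj_class :: "('a, 'm) monoid_scheme \<Rightarrow> ('a \<Rightarrow> real) \<Rightarrow> ('a \<Rightarrow> real) set" where
  "proj_class F l = {\<lambda>g\<in>carrier F. c * l g |c. c \<noteq> 0}"

definition PR_topology :: "('a, 'm) monoid_scheme \<Rightarrow> ('a \<Rightarrow> real) set topology" where
  "PR_topology F = quotient_topology
     (subtopology (product_topology (\<lambda>_. euclideanreal) (carrier F)) (- {\<lambda>g\<in>carrier F. 0}))
     (proj_class F)"

definition CV :: "('a, 'm) monoid_scheme \<Rightarrow> ('a \<Rightarrow> real) set set" where
  "CV F = proj_class F ` cv F"

definition boundary_CV :: "('a, 'm) monoid_scheme \<Rightarrow> ('a \<Rightarrow> real) set set" where
  "boundary_CV F = (PR_topology F closure_of CV F) - CV F"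

definition boundary_CV_topology :: "('a, 'm) monoid_scheme \<Rightarrow> ('a \<Rightarrow> real) set topology" where
  "boundary_CV_topology F = subtopology (PR_topology F) (boundary_CV F)"

definition aut_length :: "('a, 'm) monoid_scheme \<Rightarrow> ('a \<Rightarrow> 'a) \<Rightarrow> ('a \<Rightarrow> real) \<Rightarrow> 'a \<Rightarrow> real" where
  "aut_length F \<phi> l = (\<lambda>w\<in>carrier F. l (inv_into (carrier F) \<phi> w))"

definition aut_PR ::
    "('a, 'm) monoid_scheme \<Rightarrow> ('a \<Rightarrow> 'a) \<Rightarrow> ('a \<Rightarrow> real) set \<Rightarrow> ('a \<Rightarrow> real) set" where
  "aut_PR F \<phi> c = aut_length F \<phi> ` c"


section \<open>Equivariance\<close>

definition equivariant ::
    "('g, 'm) monoid_scheme \<Rightarrow> 'x set \<Rightarrow> ('g \<Rightarrow> 'x \<Rightarrow> 'x) \<Rightarrow> ('g \<Rightarrow> 'z \<Rightarrow> 'z) \<Rightarrow> ('x \<Rightarrow> 'z) \<Rightarrow> bool" where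
  "equivariant G A \<alpha> \<beta> \<tau> \<longleftrightarrow> (\<forall>g\<in>carrier G. \<forall>x\<in>A. \<tau> (\<alpha> g x) = \<beta> g (\<tau> x))"

definition anti_equivariant ::
    "('g, 'm) monoid_scheme \<Rightarrow> 'x set \<Rightarrow> ('g \<Rightarrow> 'x \<Rightarrow> 'x) \<Rightarrow> ('g \<Rightarrow> 'z \<Rightarrow> 'z) \<Rightarrow> ('x \<Rightarrow> 'z) \<Rightarrow> bool" where
  "anti_equivariant G A \<alpha> \<beta> \<tau> \<longleftrightarrow>
     (\<forall>g\<in>carrier G. \<forall>x\<in>A. \<tau> (\<alpha> g x) = \<beta> (inv\<^bsub>G\<^esub> g) (\<tau> x))"

end

theory Submission
  imports Defs "HOL-Algebra.Generated_Groups"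
begin

text \<open>Let \<open>a, b, c\<close> be distinct basis elements. The HNN decomposition of \<open>F\<close> with vertex group
  generated by the basis without \<open>c\<close> together with \<open>c a c\<^sup>-\<^sup>1\<close>, and stable letter \<open>c\<close>, gives a
  tree \<open>T\<^sub>a\<^sub>c\<close>, a boundary point of outer space. Its projective class is fixed by the automorphisms
  \<open>c \<mapsto> y\<^sup>n c\<close> for the other basis elements \<open>y\<close> and by \<open>d \<mapsto> d c a\<^sup>n c\<^sup>-\<^sup>1\<close> for \<open>d \<noteq> a, c\<close>. A current
  whose class these fix gives measure zero to the lines with an edge \<open>z\<close> not labelled \<open>a\<close>: such an
  automorphism moves the set of lines through a suitable path starting with \<open>z\<close> to infinitely many
  disjoint translates in a fixed compact set, scaling its measure by a constant factor. So the current is supported on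
  the countable orbit of the axis of \<open>a\<close>, which determines its class. Hence an equivariant
  or anti-equivariant map sends \<open>T\<^sub>a\<^sub>b\<close> and \<open>T\<^sub>a\<^sub>c\<close> to the same class, although
  \<open>c\<close> has length zero only in the former, and is not injective. Continuity plays no role.\<close>

section \<open>Real trees\<close>

text \<open>The Bass--Serre tree of the splitting is never built; only its length function is
  needed. It is the limit, after division by n, of the length functions of the Cayley tree twisted
  by c \<mapsto> c a^n: this Dehn twist inserts n letters for each edge of the splitting that a
  reduced path crosses. The limit is not in \<open>CV F\<close> because \<open>a\<close> gets length
  zero, while in a real tree a zero translation length is attained, which freeness forbids for a
  \<noteq> 1. This is why both implications between real trees and the four-point condition appear:
  one to recognise the Cayley tree, one to treat an unknown tree of outer space. A fixed projective
  class only makes a current proportional to its image, and the factor may differ from 1; iterating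
  in the direction in which masses do not shrink removes this difficulty. The edges c^-1 are treated
  before all others. There the letter following the edge must not be the multiplier of the
  automorphism, so two multipliers \<open>a\<close> and \<open>b\<close> are used; rank three also
  provides two trees with the same \<open>a\<close>.\<close>

definition four_point :: "'b set \<Rightarrow> ('b \<Rightarrow> 'b \<Rightarrow> real) \<Rightarrow> bool" where
  "four_point M d \<longleftrightarrow> (\<forall>x\<in>M. \<forall>y\<in>M. \<forall>z\<in>M. \<forall>w\<in>M.
     d x y + d z w \<le> max (d x z + d y w) (d x w + d y z))"

definition geodesic :: "'b set \<Rightarrow> ('b \<Rightarrow> 'b \<Rightarrow> real) \<Rightarrow> (real \<Rightarrow> 'b) \<Rightarrow> 'b \<Rightarrow> 'b \<Rightarrow> bool" where
  "geodesic M d \<gamma> x y \<longleftrightarrow> \<gamma> \<in> {0..d x y} \<rightarrow> M \<and> \<gamma> 0 = x \<and> \<gamma> (d x y) = y \<and>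
     (\<forall>s\<in>{0..d x y}. \<forall>t\<in>{0..d x y}. d (\<gamma> s) (\<gamma> t) = \<bar>s - t\<bar>)"

lemma four_pointD:
  assumes "four_point M d" "x \<in> M" "y \<in> M" "z \<in> M" "w \<in> M"
  shows "d x y + d z w \<le> max (d x z + d y w) (d x w + d y z)"
  using assms unfolding four_point_def by blast

context Metric_space
begin

lemma geodesicD:
  assumes "geodesic M d \<gamma> x y" "0 \<le> t" "t \<le> d x y"
  shows "\<gamma> t \<in> M" "d x (\<gamma> t) = t" "d (\<gamma> t) y = d x y - t"
proof -
  have a: "\<gamma> \<in> {0..d x y} \<rightarrow> M" "\<gamma> 0 = x" "\<gamma> (d x y) = y"
    and b: "\<And>s t. s \<in> {0..d x y} \<Longrightarrow> t \<in> {0..d x y} \<Longrightarrow> d (\<gamma> s) (\<gamma> t) = \<bar>s - t\<bar>"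
    using assms(1) unfolding geodesic_def by auto
  show "\<gamma> t \<in> M" using a assms by auto
  show "d x (\<gamma> t) = t" using b[of 0 t] a assms by auto
  show "d (\<gamma> t) y = d x y - t" using b[of t "d x y"] a assms by auto
qed

text \<open>The points \<open>z\<close> whose geodesic from \<open>p\<close> starts in the direction of \<open>x\<close> form an open set,
  and so do the remaining points other than \<open>p\<close>.\<close>

lemma between_in_connected:
  assumes 4: "four_point M d" and S: "connectedin mtopology S" and xy: "x \<in> S" "y \<in> S"
    and p: "p \<in> M" "d x p + d p y = d x y"
  shows "p \<in> S"
proof (rule ccontr)
  assume pS: "p \<notin> S"
  have SM: "S \<subseteq> M" using S connectedin_subset_topspace topspace_mtopology by blast
  have M: "x \<in> M" "y \<in> M" using SM xy by auto
  define A where "A = {z \<in> M. d z x < d z p + d p x}"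
  define B where "B = {z \<in> M. z \<noteq> p \<and> d z x = d z p + d p x}"
  have "openin mtopology A"
    unfolding openin_mtopology
  proof (intro conjI allI impI)
    show "A \<subseteq> M" by (auto simp: A_def)
    fix z assume z: "z \<in> A"
    \<comment> \<open>Moving \<open>z\<close> by less than \<open>r\<close> changes each of the two
      distances by less than \<open>r\<close>, which keeps the strict inequality.\<close>
    define r where "r = (d z p + d p x - d z x) / 2"
    have r: "r > 0" using z by (auto simp: A_def r_def)
    have "mball z r \<subseteq> A"
    proof
      fix w assume "w \<in> mball z r"
      then have w: "w \<in> M" "z \<in> M" "d z w < r" by auto
      have "d w x \<le> d z w + d z x" using triangle[of w z x] w M commute by metis
      moreover have "d z p \<le> d z w + d w p" using triangle[of z w p] w p by simp
      ultimately show "w \<in> A" using w unfolding A_def r_def by simp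
    qed
    then show "\<exists>r>0. mball z r \<subseteq> A" using r by blast
  qed
  moreover have "openin mtopology B"
    unfolding openin_mtopology
  proof (intro conjI allI impI)
    show "B \<subseteq> M" by (auto simp: B_def)
    fix z assume z: "z \<in> B"
    have r: "d z p > 0" using z p by (auto simp: B_def)
    have "mball z (d z p) \<subseteq> B"
    proof
      fix w assume "w \<in> mball z (d z p)"
      then have w: "w \<in> M" "z \<in> M" "d z w < d z p" by auto
      \<comment> \<open>The second term of the maximum cannot dominate, because
        \<open>d z w < d z p\<close> would make \<open>d w p\<close> negative; the first term gives
        the inequality opposite to the triangle inequality.\<close>
      have "d x z + d w p \<le> max (d x w + d z p) (d x p + d z w)"
        using four_pointD[OF 4 M(1) w(2,1) p(1)] by simp
      moreover have "d x z = d z p + d p x" using z commute[of x z] by (auto simp: B_def)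
      moreover have "d w x \<le> d w p + d p x" using triangle w p M by simp
      ultimately have "d w x = d w p + d p x"
        using w(3) nonneg[of w p] commute[of x w] commute[of x p] unfolding le_max_iff_disj by linarith
      moreover have "w \<noteq> p" using w by auto
      ultimately show "w \<in> B" using w unfolding B_def by simp
    qed
    then show "\<exists>r>0. mball z r \<subseteq> B" using r by blast
  qed
  moreover have "S \<subseteq> A \<union> B"
  proof
    fix z assume "z \<in> S"
    then have "z \<in> M" "z \<noteq> p" using pS SM by auto
    then show "z \<in> A \<union> B" using triangle[of z p x] p M by (auto simp: A_def B_def)
  qed
  moreover have "A \<inter> B \<inter> S = {}" by (auto simp: A_def B_def)
  moreover have "x \<in> A"
    using xy pS M p mdist_pos_less[of x p] commute[of x p] by (auto simp: A_def)
  moreover have "y \<in> B"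
    using xy pS M p commute[of y] commute[of x p] by (auto simp: B_def)
  ultimately show False
    using S xy unfolding connectedin by blast
qed

text \<open>Connectedness forces an arc through every point between its endpoints. Conversely, the
  projection of an arc point \<open>q\<close> to the geodesic lies between \<open>x\<close> and
  \<open>q\<close> and between \<open>q\<close> and \<open>y\<close>, so both subarcs contain it,
  and injectivity leaves only \<open>q\<close> itself.\<close>

lemma arc_image_subset_geodesic:
  assumes 4: "four_point M d" and \<gamma>: "geodesic M d \<gamma> x y" and xy: "x \<in> M" "y \<in> M"
    and a: "arc_in mtopology a" "a 0 = x" "a 1 = y"
  shows "a ` {0..1} = \<gamma> ` {0..d x y}"
proof
  have pa: "pathin mtopology a" and inj: "inj_on a {0..1}" using a unfolding arc_in_def by auto
  have con: "connectedin mtopology (a ` {s..t})" if "0 \<le> s" "t \<le> 1" for s t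
  proof -
    have "connectedin (top_of_set {0..1}) {s..t}"
      using that by (auto simp: connectedin_subtopology)
    then show ?thesis
      using pa connectedin_continuous_map_image unfolding pathin_def by blast
  qed
  show "\<gamma> ` {0..d x y} \<subseteq> a ` {0..1}"
  proof
    fix p assume "p \<in> \<gamma> ` {0..d x y}"
    then obtain t where t: "0 \<le> t" "t \<le> d x y" "p = \<gamma> t" by auto
    show "p \<in> a ` {0..1}"
    proof (rule between_in_connected[OF 4 con])
      show "x \<in> a ` {0..1}" "y \<in> a ` {0..1}" using a by force+
      show "p \<in> M" "d x p + d p y = d x y" using geodesicD[OF \<gamma> t(1,2)] t by auto
    qed auto
  qed
  show "a ` {0..1} \<subseteq> \<gamma> ` {0..d x y}"
  proof
    fix q assume "q \<in> a ` {0..1}"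
    then obtain s where s: "s \<in> {0..1}" "q = a s" by auto
    have q: "q \<in> M"
      using con[of 0 1] connectedin_subset_topspace s by fastforce
    \<comment> \<open>The Gromov product of \<open>y\<close> and \<open>q\<close> at
      \<open>x\<close>, which is the distance from \<open>x\<close> to the projection of
      \<open>q\<close>.\<close>
    define t where "t = (d x y + d x q - d y q) / 2"
    have t: "0 \<le> t" "t \<le> d x y"
      using triangle[of y x q] triangle[of x y q] xy q commute[of x y] commute[of q] unfolding t_def by auto
    define r where "r = \<gamma> t"
    note r = geodesicD[OF \<gamma> t, folded r_def]
    have "d x y + d r q \<le> max (d x r + d y q) (d x q + d y r)"
      using four_pointD[OF 4 xy r(1) q] .
    then have rq: "d r q \<le> (d x q + d y q - d x y) / 2"
      using r commute[of y r] unfolding t_def by (auto simp: max_def field_simps split: if_splits)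
    have 1: "d x r + d r q = d x q" "d q r + d r y = d q y"
      using rq r triangle[of x r q] triangle[of q r y] xy q commute[of q r] commute[of q y] commute[of y r]
      unfolding t_def by (auto simp: field_simps)
    have "r \<in> a ` {0..s}"
      by (rule between_in_connected[OF 4 con _ _ r(1) 1(1)]) (use s a in force)+
    moreover have "r \<in> a ` {s..1}"
      by (rule between_in_connected[OF 4 con _ _ r(1) 1(2)]) (use s a in force)+
    ultimately obtain u v where "u \<in> {0..s}" "v \<in> {s..1}" "r = a u" "r = a v" by auto
    moreover from this have "u = v" using inj s by (auto simp: inj_on_def)
    ultimately have "q = \<gamma> t" using s r_def by auto
    then show "q \<in> \<gamma> ` {0..d x y}" using t by auto
  qed
qed

lemma real_treeI:
  assumes "M \<noteq> {}" "four_point M d" "\<And>x y. x \<in> M \<Longrightarrow> y \<in> M \<Longrightarrow> \<exists>\<gamma>. geodesic M d \<gamma> x y"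
  shows "real_tree M d"
  unfolding real_tree_def
proof (intro conjI allI impI)
  show "Metric_space M d" ..
  show "\<forall>x\<in>M. \<forall>y\<in>M. \<exists>\<gamma>. \<gamma> \<in> {0..d x y} \<rightarrow> M \<and> \<gamma> 0 = x \<and> \<gamma> (d x y) = y \<and>
        (\<forall>s\<in>{0..d x y}. \<forall>t\<in>{0..d x y}. d (\<gamma> s) (\<gamma> t) = \<bar>s - t\<bar>)"
    using assms(3) unfolding geodesic_def by blast
  fix a b assume ab: "arc_in mtopology a \<and> arc_in mtopology b \<and> a 0 = b 0 \<and> a 1 = b 1"
  have "a 0 \<in> M" "a 1 \<in> M"
    using ab path_start_in_topspace path_finish_in_topspace unfolding arc_in_def by fastforce+
  moreover from this obtain \<gamma> where "geodesic M d \<gamma> (a 0) (a 1)" using assms(3) by blast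
  ultimately show "a ` {0..1} = b ` {0..1}"
    using arc_image_subset_geodesic[OF assms(2)] ab by metis
qed (use assms in auto)

section \<open>From uniqueness of arcs to the four-point condition\<close>

lemma arc_in_lipschitz:
  assumes f: "\<And>s. s \<in> {0..1} \<Longrightarrow> f s \<in> M" "inj_on f {0..1}" and "0 \<le> K"
    and lip: "\<And>s t. s \<in> {0..1} \<Longrightarrow> t \<in> {0..1} \<Longrightarrow> s \<le> t \<Longrightarrow> d (f s) (f t) \<le> K * (t - s)"
  shows "arc_in mtopology f"
  unfolding arc_in_def pathin_def
proof (intro conjI f(2))
  show "continuous_map (top_of_set {0..1}) mtopology f"
    unfolding continuous_map_to_metric
  proof (intro ballI allI impI)
    fix s \<epsilon> :: real assume s: "s \<in> topspace (top_of_set {0..1})" and e: "\<epsilon> > 0"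
    define \<delta> where "\<delta> = \<epsilon> / (K + 1)"
    have \<delta>: "\<delta> > 0" "K * \<delta> < \<epsilon>"
      using e assms(3) unfolding \<delta>_def by (auto simp: field_simps)
    let ?U = "{0..1} \<inter> ball s \<delta>"
    have "f t \<in> mball (f s) \<epsilon>" if "t \<in> ?U" for t
    proof -
      have "d (f s) (f t) \<le> K * \<bar>t - s\<bar>"
        using lip[of s t] lip[of t s] that s commute[of "f s" "f t"] by (cases "s \<le> t") auto
      also have "\<dots> \<le> K * \<delta>" using that assms(3) by (intro mult_left_mono) (auto simp: dist_real_def)
      finally show ?thesis using f s that \<delta> by auto
    qed
    moreover have "openin (top_of_set {0..1}) ?U" by (simp add: openin_open_Int)
    ultimately show "\<exists>U. openin (top_of_set {0..1}) U \<and> s \<in> U \<and> (\<forall>y\<in>U. f y \<in> mball (f s) \<epsilon>)"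
      using s \<delta> by (intro exI[of _ ?U]) auto
  qed
qed

lemma arc_in_geodesic:
  assumes "geodesic M d \<gamma> x y" "x \<in> M" "y \<in> M" "x \<noteq> y"
  shows "arc_in mtopology (\<lambda>u. \<gamma> (d x y * u))"
proof (rule arc_in_lipschitz[where K = "d x y"])
  have D: "d x y > 0" using assms by simp
  have in': "d x y * u \<in> {0..d x y}" if "u \<in> {0..1}" for u
    using that D by (auto simp: mult_left_le)
  have g: "d (\<gamma> s) (\<gamma> t) = \<bar>s - t\<bar>" if "s \<in> {0..d x y}" "t \<in> {0..d x y}" for s t
    using assms(1) that unfolding geodesic_def by auto
  show "\<gamma> (d x y * u) \<in> M" if "u \<in> {0..1}" for u
    using in'[OF that] assms(1) unfolding geodesic_def by auto
  show "inj_on (\<lambda>u. \<gamma> (d x y * u)) {0..1}"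
  proof (rule inj_onI)
    fix u v :: real assume uv: "u \<in> {0..1}" "v \<in> {0..1}" "\<gamma> (d x y * u) = \<gamma> (d x y * v)"
    have "\<gamma> (d x y * u) \<in> M" using in'[OF uv(1)] assms(1) unfolding geodesic_def by auto
    then have "\<bar>d x y * u - d x y * v\<bar> = 0" using g[OF in' in'] uv by force
    then show "u = v" using D by simp
  qed
  show "d (\<gamma> (d x y * s)) (\<gamma> (d x y * t)) \<le> d x y * (t - s)"
    if "s \<in> {0..1}" "t \<in> {0..1}" "s \<le> t" for s t
  proof -
    have "d x y * s \<le> d x y * t" using that D by simp
    then show ?thesis using g[OF in' in'] that by (simp add: algebra_simps)
  qed
qed simp

lemma image_scale: "0 < D \<Longrightarrow> (\<lambda>u. \<gamma> (D * u)) ` {0..1::real} = \<gamma> ` {0..D::real}"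
proof -
  assume D: "0 < D"
  have "(\<lambda>u. D * u) ` {0..1} = {0..D}"
    using D image_mult_atLeastAtMost[of D 0 1] by simp
  then show ?thesis by (metis image_image)
qed

lemma real_tree_arcs:
  assumes "real_tree M d" "arc_in mtopology a" "arc_in mtopology b" "a 0 = b 0" "a 1 = b 1"
  shows "a ` {0..1} = b ` {0..1}"
  using assms unfolding real_tree_def by blast

text \<open>Both images agree by uniqueness of arcs, and on a geodesic the parameter is the distance
  from \<open>x\<close>.\<close>

lemma geodesic_unique:
  assumes T: "real_tree M d" and g: "geodesic M d \<alpha> x y" "geodesic M d \<beta> x y"
    and xy: "x \<in> M" "y \<in> M" and t: "0 \<le> t" "t \<le> d x y"
  shows "\<alpha> t = \<beta> t"
proof (cases "x = y")
  case True
  then have "t = 0" using t xy by simp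
  then show ?thesis using g unfolding geodesic_def by simp
next
  case False
  then have D: "d x y > 0" using xy by simp
  have "(\<lambda>u. \<alpha> (d x y * u)) ` {0..1} = (\<lambda>u. \<beta> (d x y * u)) ` {0..1}"
    using g by (intro real_tree_arcs[OF T arc_in_geodesic[OF g(1) xy False] arc_in_geodesic[OF g(2) xy False]])
      (auto simp: geodesic_def)
  then have "\<alpha> ` {0..d x y} = \<beta> ` {0..d x y}" using image_scale[OF D] by metis
  moreover have "\<alpha> t \<in> \<alpha> ` {0..d x y}" using t by auto
  ultimately obtain s where s: "0 \<le> s" "s \<le> d x y" "\<alpha> t = \<beta> s" by auto
  then have "t = s" using geodesicD(2)[OF g(1) t] geodesicD(2)[OF g(2) s(1,2)] by simp
  then show ?thesis using s by simp
qed

text \<open>Running back along one geodesic and out along the other is an injective Lipschitz path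
  when they meet only at \<open>m\<close>. By uniqueness of arcs it has the same image as a geodesic
  from \<open>a\<close> to \<open>b\<close>, so \<open>m\<close> lies on that geodesic.\<close>

lemma geodesic_concat:
  assumes T: "real_tree M d" and g: "geodesic M d \<alpha> m a" "geodesic M d \<beta> m b"
    and M: "m \<in> M" "a \<in> M" "b \<in> M"
    and dis: "\<And>s t. s \<in> {0..d m a} \<Longrightarrow> t \<in> {0..d m b} \<Longrightarrow> \<alpha> s = \<beta> t \<Longrightarrow> s = 0 \<and> t = 0"
  shows "d a b = d m a + d m b"
proof (cases "a = b")
  case True
  have "\<alpha> (d m a) = \<beta> (d m b)" using g True unfolding geodesic_def by simp
  then show ?thesis using dis[of "d m a" "d m b"] M True by simp
next
  case False
  define A B where "A = d m a" and "B = d m b"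
  have AB: "A \<ge> 0" "B \<ge> 0" by (auto simp: A_def B_def)
  have "d a b > 0" using False M by simp
  then have pos: "A + B > 0" using triangle[of a m b] M commute[of a m] unfolding A_def B_def by linarith
  define \<delta> where "\<delta> s = (if s \<le> A then \<alpha> (A - s) else \<beta> (s - A))" for s
  have a: "d (\<alpha> s) (\<alpha> t) = \<bar>s - t\<bar>" "\<alpha> s \<in> M" if "s \<in> {0..A}" "t \<in> {0..A}" for s t
    using g(1) that unfolding geodesic_def A_def by auto
  have b: "d (\<beta> s) (\<beta> t) = \<bar>s - t\<bar>" "\<beta> s \<in> M" if "s \<in> {0..B}" "t \<in> {0..B}" for s t
    using g(2) that unfolding geodesic_def B_def by auto
  have m: "\<alpha> 0 = m" "\<beta> 0 = m" using g unfolding geodesic_def by auto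
  have \<delta>M: "\<delta> s \<in> M" if "s \<in> {0..A+B}" for s
    using that a(2)[of "A - s" "A - s"] b(2)[of "s - A" "s - A"] unfolding \<delta>_def by auto
  have lip: "d (\<delta> s) (\<delta> t) \<le> t - s" if "s \<in> {0..A+B}" "t \<in> {0..A+B}" "s \<le> t" for s t
  proof -
    consider "t \<le> A" | "s > A" | "s \<le> A" "t > A" by linarith
    then show ?thesis
    proof cases
      case 1 then show ?thesis using that a(1)[of "A - s" "A - t"] unfolding \<delta>_def by auto
    next
      case 2 then show ?thesis using that b(1)[of "s - A" "t - A"] unfolding \<delta>_def by auto
    next
      case 3
      have "d (\<alpha> (A - s)) (\<beta> (t - A)) \<le> d (\<alpha> (A - s)) m + d m (\<beta> (t - A))"
        using 3 that a(2)[of "A - s" "A - s"] b(2)[of "t - A" "t - A"] M by (intro triangle) auto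
      also have "\<dots> = (A - s) + (t - A)"
        using a(1)[of "A - s" 0] b(1)[of 0 "t - A"] 3 that AB m by auto
      finally show ?thesis using 3 unfolding \<delta>_def by auto
    qed
  qed
  have inj: "inj_on \<delta> {0..A+B}"
  proof (rule linorder_inj_onI)
    fix s t assume st: "s < t" "s \<in> {0..A+B}" "t \<in> {0..A+B}"
    consider "t \<le> A" | "s > A" | "s \<le> A" "t > A" by linarith
    then show "\<delta> s \<noteq> \<delta> t"
    proof cases
      case 1 then show ?thesis using st a(1)[of "A - s" "A - t"] a(2)[of "A - s" "A - s"] unfolding \<delta>_def by auto
    next
      case 2 then show ?thesis using st b(1)[of "s - A" "t - A"] b(2)[of "s-A" "s-A"] unfolding \<delta>_def by auto
    next
      case 3 then show ?thesis using st dis[of "A - s" "t - A"] unfolding \<delta>_def A_def B_def by auto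
    qed
  qed auto
  have sc: "(A+B) * u \<in> {0..A+B}" if "u \<in> {0..1}" for u
    using that pos by (auto simp: mult_left_le)
  have arc: "arc_in mtopology (\<lambda>u. \<delta> ((A+B) * u))"
  proof (rule arc_in_lipschitz[where K = "A+B"])
    show "inj_on (\<lambda>u. \<delta> ((A+B) * u)) {0..1}"
    proof (rule inj_onI)
      fix u v :: real assume uv: "u \<in> {0..1}" "v \<in> {0..1}" "\<delta> ((A+B) * u) = \<delta> ((A+B) * v)"
      then have "(A+B) * u = (A+B) * v" using inj_onD[OF inj uv(3) sc sc] by blast
      then show "u = v" using pos by simp
    qed
    show "d (\<delta> ((A+B) * s)) (\<delta> ((A+B) * t)) \<le> (A+B) * (t - s)"
      if "s \<in> {0..1}" "t \<in> {0..1}" "s \<le> t" for s t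
      using lip[OF sc[OF that(1)] sc[OF that(2)]] that pos by (simp add: right_diff_distrib)
  qed (use pos \<delta>M sc in auto)
  obtain \<gamma> where \<gamma>: "geodesic M d \<gamma> a b"
    using T M unfolding real_tree_def geodesic_def by blast
  have "\<delta> ` {0..A+B} = \<gamma> ` {0..d a b}"
    unfolding image_scale[OF pos, symmetric] image_scale[OF \<open>d a b > 0\<close>, symmetric]
  proof (rule real_tree_arcs[OF T arc arc_in_geodesic[OF \<gamma> M(2,3) False]])
    have ends: "\<alpha> A = a" "\<beta> B = b" "\<gamma> 0 = a" "\<gamma> (d a b) = b"
      using g \<gamma> unfolding geodesic_def A_def B_def by auto
    show "\<delta> ((A+B) * 0) = \<gamma> (d a b * 0)" using ends AB by (simp add: \<delta>_def)
    have "\<delta> (A + B) = b"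
    proof (cases "B = 0")
      case True
      then show ?thesis using ends m by (simp add: \<delta>_def)
    next
      case False
      then show ?thesis using ends AB by (simp add: \<delta>_def)
    qed
    then show "\<delta> ((A+B) * 1) = \<gamma> (d a b * 1)" using ends by simp
  qed
  moreover have "m \<in> \<delta> ` {0..A+B}" using m AB by (auto simp: \<delta>_def intro!: image_eqI[of _ _ A])
  ultimately obtain s where "0 \<le> s" "s \<le> d a b" "m = \<gamma> s" by (metis atLeastAtMost_iff imageE)
  then show ?thesis using geodesicD[OF \<gamma>, of s] commute[of a m] by simp
qed

lemma geodesic_sub:
  assumes g: "geodesic M d \<alpha> p a" and p: "p \<in> M" and s: "0 \<le> s" "s \<le> t" "t \<le> d p a"
  shows "geodesic M d (\<lambda>u. \<alpha> (s + u)) (\<alpha> s) (\<alpha> t)"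
proof -
  have *: "d (\<alpha> u) (\<alpha> v) = \<bar>u - v\<bar>" if "u \<in> {0..d p a}" "v \<in> {0..d p a}" for u v
    using g that unfolding geodesic_def by auto
  have **: "\<alpha> u \<in> M" if "u \<in> {0..d p a}" for u
    using g that unfolding geodesic_def by auto
  have "d (\<alpha> s) (\<alpha> t) = t - s" using *[of s t] s by auto
  then show ?thesis using * ** s unfolding geodesic_def by auto
qed

text \<open>Let \<open>s\<close> be the last parameter at which the two geodesics meet. They agree
  up to \<open>s\<close> and their remainders meet only at the branch point, so
  \<open>geodesic_concat\<close> shows that \<open>s\<close> is the Gromov product of
  \<open>a\<close> and \<open>b\<close> at \<open>p\<close>.\<close>

lemma geodesics_agree:
  assumes T: "real_tree M d" and g: "geodesic M d \<alpha> p a" "geodesic M d \<beta> p b"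
    and M: "p \<in> M" "a \<in> M" "b \<in> M" and t: "0 \<le> t" "t \<le> (d p a + d p b - d a b) / 2"
  shows "\<alpha> t = \<beta> t"
proof -
  define A B where "A = d p a" and "B = d p b"
  define S where "S = {t \<in> {0..min A B}. \<alpha> t = \<beta> t}"
  define s where "s = Sup S"
  have a: "d (\<alpha> s) (\<alpha> t) = \<bar>s - t\<bar>" "\<alpha> s \<in> M" if "s \<in> {0..A}" "t \<in> {0..A}" for s t
    using g(1) that unfolding geodesic_def A_def by auto
  have b: "d (\<beta> s) (\<beta> t) = \<bar>s - t\<bar>" "\<beta> s \<in> M" if "s \<in> {0..B}" "t \<in> {0..B}" for s t
    using g(2) that unfolding geodesic_def B_def by auto
  have p0: "\<alpha> 0 = p" "\<beta> 0 = p" and ends: "\<alpha> A = a" "\<beta> B = b"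
    using g unfolding geodesic_def A_def B_def by auto
  have S0: "0 \<in> S" using p0 unfolding S_def A_def B_def by auto
  have bdd: "bdd_above S" unfolding S_def by (rule bdd_aboveI[of _ "min A B"]) auto
  have s0: "0 \<le> s" using cSup_upper[OF S0 bdd] s_def by simp
  have s1: "s \<le> A" "s \<le> B"
    using S0 cSup_least[of S "min A B"] unfolding S_def s_def by force+
  have "d (\<alpha> s) (\<beta> s) \<le> 2 * e" if "e > 0" for e
  proof -
    obtain t where t: "t \<in> S" "s - e < t" proof -
      have "S \<noteq> {}" using S0 by auto
      then show thesis using less_cSup_iff[of S "s - e"] bdd \<open>e > 0\<close> that unfolding s_def by auto
    qed
    have "t \<le> s" using cSup_upper[OF t(1) bdd] s_def by simp
    have t': "\<alpha> t = \<beta> t" "0 \<le> t" "t \<le> A" "t \<le> B" using t unfolding S_def by auto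
    have "d (\<alpha> s) (\<beta> s) \<le> d (\<alpha> s) (\<alpha> t) + d (\<alpha> t) (\<beta> s)"
      using s0 s1 t' a(2)[of s s] a(2)[of t t] b(2)[of s s] by (intro triangle) auto
    also have "\<dots> = 2 * (s - t)" using a(1)[of s t] b(1)[of t s] s0 s1 t' \<open>t \<le> s\<close> by auto
    finally show ?thesis using t by auto
  qed
  \<comment> \<open>A bound by half of the distance itself forces the distance to vanish, so the
    supremum of the meeting parameters is attained.\<close>
  from this[of "d (\<alpha> s) (\<beta> s) / 4"] have "d (\<alpha> s) (\<beta> s) = 0"
    using nonneg[of "\<alpha> s" "\<beta> s"] by (cases "d (\<alpha> s) (\<beta> s) = 0") auto
  then have eq: "\<alpha> s = \<beta> s" using a(2)[of s s] b(2)[of s s] s0 s1 by auto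
  have agree: "\<alpha> t = \<beta> t" if "0 \<le> t" "t \<le> s" for t
  proof -
    have 1: "geodesic M d (\<lambda>u. \<alpha> (0 + u)) (\<alpha> 0) (\<alpha> s)" "geodesic M d (\<lambda>u. \<beta> (0 + u)) (\<beta> 0) (\<beta> s)"
      using geodesic_sub[OF g(1) M(1), of 0 s] geodesic_sub[OF g(2) M(1), of 0 s] s0 s1 A_def B_def by auto
    have 2: "geodesic M d (\<lambda>u. \<beta> (0 + u)) (\<alpha> 0) (\<alpha> s)"
      using 1(2) eq p0 by simp
    have "\<alpha> (0 + t) = \<beta> (0 + t)"
      by (rule geodesic_unique[OF T 1(1) 2]) (use p0 M(1) a(1)[of 0 s] a(2)[of s s] s0 s1 that in auto)
    then show ?thesis by simp
  qed
  have 1: "geodesic M d (\<lambda>u. \<alpha> (s + u)) (\<alpha> s) a" "geodesic M d (\<lambda>u. \<beta> (s + u)) (\<alpha> s) b"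
    using geodesic_sub[OF g(1) M(1) s0 _ order_refl] geodesic_sub[OF g(2) M(1) s0 _ order_refl] s1 ends eq
    unfolding A_def B_def by auto
  have 2: "d (\<alpha> s) a = A - s" "d (\<alpha> s) b = B - s"
    using a(1)[of s A] b(1)[of s B] s0 s1 ends eq by auto
  have "d a b = d (\<alpha> s) a + d (\<alpha> s) b"
  proof (rule geodesic_concat[OF T 1 _ M(2,3)])
    show "\<alpha> s \<in> M" using a(2)[of s s] s0 s1 by auto
    fix u v assume uv: "u \<in> {0..d (\<alpha> s) a}" "v \<in> {0..d (\<alpha> s) b}" "\<alpha> (s + u) = \<beta> (s + v)"
    have "s + u = s + v"
      using a(1)[of 0 "s+u"] b(1)[of 0 "s+v"] uv 2 s0 s1 p0 by auto
    then have su: "s + u \<in> S" using uv 2 s0 unfolding S_def by auto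
    have "s + u \<le> s" using cSup_upper[OF su bdd] unfolding s_def .
    then show "u = 0 \<and> v = 0" using uv \<open>s + u = s + v\<close> by auto
  qed
  then have "t \<le> s" using t 2 unfolding A_def B_def by auto
  then show ?thesis using agree t by auto
qed

text \<open>Three geodesics from \<open>p\<close> agree up to the smaller of the Gromov products of
  \<open>a, b\<close> and \<open>b, c\<close>. Hence the product of \<open>a, c\<close> is at least
  that minimum, an ultrametric inequality which is the four-point condition rewritten.\<close>

lemma real_tree_four_point:
  assumes T: "real_tree M d"
  shows "four_point M d"
  unfolding four_point_def
proof (intro ballI)
  fix a c b p assume M: "a \<in> M" "c \<in> M" "b \<in> M" "p \<in> M"
  have "\<exists>\<gamma>. geodesic M d \<gamma> p x" if "x \<in> M" for x
    using T M(4) that unfolding real_tree_def geodesic_def by blast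
  then obtain \<alpha> \<beta> \<gamma> where g: "geodesic M d \<alpha> p a" "geodesic M d \<beta> p b" "geodesic M d \<gamma> p c"
    using M(1,2,3) by meson
  define t where "t = min ((d p a + d p b - d a b) / 2) ((d p b + d p c - d b c) / 2)"
  have t12: "t \<le> (d p a + d p b - d a b) / 2" "t \<le> (d p b + d p c - d b c) / 2"
    unfolding t_def by (rule min.cobounded1 min.cobounded2)+
  have t: "0 \<le> t" "t \<le> d p a" "t \<le> d p c"
    using t12 triangle[of a p b] triangle[of b p c] triangle[of p a b] triangle[of p c b] M
      commute[of a p] commute[of b p] commute[of b c] commute[of p c] t_def
    by (simp_all add: min_le_iff_disj)
  have "\<alpha> t = \<beta> t" "\<beta> t = \<gamma> t"
    using geodesics_agree[OF T g(1,2) M(4,1,3) t(1) t12(1)] geodesics_agree[OF T g(2,3) M(4,3,2) t(1) t12(2)] .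
  then have "\<alpha> t = \<gamma> t" by simp
  then have "d a c \<le> (d p a - t) + (d p c - t)"
    using triangle[of a "\<alpha> t" c] geodesicD[OF g(1) t(1,2)] geodesicD[OF g(3) t(1,3)] M
      commute[of a "\<alpha> t"] by simp
  then show "d a c + d b p \<le> max (d a b + d c p) (d a p + d c b)"
    using commute[of b p] commute[of c p] commute[of b c] commute[of a p] t_def
    unfolding le_max_iff_disj by (auto simp: min_def field_simps split: if_splits)
qed

section \<open>Translation lengths of isometries of trees\<close>

context
  fixes f
  assumes four: "four_point M d" and fM: "\<And>x. x \<in> M \<Longrightarrow> f x \<in> M"
    and iso: "\<And>x y. x \<in> M \<Longrightarrow> y \<in> M \<Longrightarrow> d (f x) (f y) = d x y"
begin

text \<open>In a tree the midpoint of the segment from \<open>x\<close> to \<open>f x\<close> lies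
  on the axis of \<open>f\<close> or is fixed by \<open>f\<close>, so it realises the translation
  length. Two instances of the four-point condition prove the bound.\<close>

lemma displacement_midpoint:
  assumes x: "x \<in> M" and \<gamma>: "geodesic M d \<gamma> x (f x)"
  defines "m \<equiv> \<gamma> (d x (f x) / 2)"
  shows "m \<in> M" "d m (f m) \<le> max 0 (d x (f (f x)) - d x (f x))"
proof -
  note m = geodesicD[OF \<gamma>, of "d x (f x) / 2", folded m_def, simplified]
  show "m \<in> M" using m by simp
  have M: "f m \<in> M" "f x \<in> M" "f (f x) \<in> M" using m x fM by auto
  have e: "d (f x) (f m) = d x (f x) / 2" "d (f m) (f (f x)) = d x (f x) / 2" "d (f x) (f (f x)) = d x (f x)"
    using iso m x fM by auto
  have "d m (f m) + d x (f x) \<le> max (d m x + d (f m) (f x)) (d m (f x) + d (f m) x)"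
    using four_pointD[OF four] m M x by auto
  moreover have "d (f m) x + d (f x) (f (f x)) \<le> max (d (f m) (f x) + d x (f (f x))) (d (f m) (f (f x)) + d x (f x))"
    using four_pointD[OF four] m M x by auto
  ultimately show "d m (f m) \<le> max 0 (d x (f (f x)) - d x (f x))"
    using e m commute[of m x] commute[of "f m" "f x"] by (auto simp: max_def field_simps split: if_splits)
qed

text \<open>By the four-point condition the displacements \<open>a n\<close> of the powers at
  \<open>x\<close> are convex once they exceed \<open>a 1\<close>, so they grow at least linearly
  with slope \<open>l\<close>. At \<open>y\<close> the slope is at most \<open>d y (f y)\<close>,
  and changing the base point costs only a constant.\<close>

lemma displacement_ge:
  assumes x: "x \<in> M" and y: "y \<in> M" and pos: "d x (f x) < d x (f (f x))"
  shows "d x (f (f x)) - d x (f x) \<le> d y (f y)"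
proof -
  define a where "a n = d x ((f ^^ n) x)" for n
  have pow: "(f ^^ n) z \<in> M" if "z \<in> M" for n z using that fM by (induction n) auto
  have isop: "d ((f ^^ n) z) ((f ^^ n) w) = d z w" if "z \<in> M" "w \<in> M" for n z w
    using that iso pow by (induction n) auto
  have step: "2 * a (Suc n) \<le> max (2 * a 1) (a (Suc (Suc n)) + a n)" for n
  proof -
    have "d x ((f ^^ Suc n) x) + d (f x) (f ((f ^^ Suc n) x)) \<le>
      max (d x (f x) + d ((f ^^ Suc n) x) (f ((f ^^ Suc n) x)))
          (d x (f ((f ^^ Suc n) x)) + d ((f ^^ Suc n) x) (f x))"
      using x pow[of x "Suc n"] fM by (intro four_pointD[OF four]) auto
    moreover have "d ((f ^^ Suc n) x) (f x) = a n"
      using iso[OF pow[OF x, of n] x] commute[of x] by (simp add: a_def)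
    moreover have "d (f x) (f ((f ^^ Suc n) x)) = a (Suc n)"
      using iso[OF x pow[OF x, of "Suc n"]] by (simp add: a_def)
    moreover have "d ((f ^^ Suc n) x) (f ((f ^^ Suc n) x)) = a 1"
      using isop[OF x fM[OF x], of "Suc n"] by (simp add: a_def funpow_swap1)
    ultimately show ?thesis by (simp add: a_def)
  qed
  define l where "l = a 2 - a 1"
  have l: "l > 0" using pos by (simp add: l_def a_def numeral_2_eq_2)
  have grow: "a (Suc (Suc n)) - a (Suc n) \<ge> l \<and> a (Suc (Suc n)) > a 1" for n
  proof (induction n)
    case 0 then show ?case using l by (simp add: l_def numeral_2_eq_2)
  next
    case (Suc n)
    then show ?case using step[of "Suc n"] l by (auto simp: max_def split: if_splits)
  qed
  have lin: "a (Suc n) \<ge> real n * l" for n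
  proof (induction n)
    case 0 then show ?case by (simp add: a_def)
  next
    case (Suc n) then show ?case using grow[of n] by (simp add: algebra_simps)
  qed
  have up: "d y ((f ^^ n) y) \<le> real n * d y (f y)" for n
  proof (induction n)
    case (Suc n)
    have "d y ((f ^^ Suc n) y) \<le> d y ((f ^^ n) y) + d ((f ^^ n) y) ((f ^^ n) (f y))"
      using triangle[of y "(f ^^ n) y" "(f ^^ Suc n) y"] y pow fM by (simp add: funpow_swap1)
    also have "\<dots> \<le> real n * d y (f y) + d y (f y)" using Suc isop y fM by simp
    finally show ?case by (simp add: algebra_simps)
  qed (use y in simp)
  have "real n * (l - d y (f y)) \<le> 2 * d x y + d y (f y)" for n
  proof -
    have "a (Suc n) \<le> d x y + d y ((f ^^ Suc n) x)" using x y pow triangle by (simp add: a_def pow del: funpow.simps)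
    also have "d y ((f ^^ Suc n) x) \<le> d y ((f ^^ Suc n) y) + d ((f ^^ Suc n) y) ((f ^^ Suc n) x)"
      by (intro triangle y pow x)
    also have "d ((f ^^ Suc n) y) ((f ^^ Suc n) x) = d x y" using isop[OF y x, of "Suc n"] commute[of y x] by (simp del: funpow.simps)
    finally show ?thesis using lin[of n] up[of "Suc n"] by (simp add: algebra_simps)
  qed
  then have "l - d y (f y) \<le> 0"
    by (metis (no_types, opaque_lifting) ex_less_of_nat_mult linorder_not_le order_less_le_trans)
  then show ?thesis by (simp add: l_def a_def numeral_2_eq_2)
qed

text \<open>The midpoint attains the lower bound valid at all points. Thus the translation length
  can be read off at any base point from the displacements of \<open>f\<close> and of its square,
  which explains the shape of the length functions used for words and for the splitting.\<close>

lemma translation_length: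
  assumes x: "x \<in> M" and \<gamma>: "geodesic M d \<gamma> x (f x)"
  shows "(INF y\<in>M. d y (f y)) = max 0 (d x (f (f x)) - d x (f x))"
proof -
  note m = displacement_midpoint[OF x \<gamma>]
  have *: "max 0 (d x (f (f x)) - d x (f x)) \<le> d y (f y)" if "y \<in> M" for y
    using displacement_ge[OF x that] by (cases "d x (f x) < d x (f (f x))") auto
  show ?thesis
  proof (rule cInf_eq_minimum)
    show "max 0 (d x (f (f x)) - d x (f x)) \<in> (\<lambda>y. d y (f y)) ` M"
      using m *[OF m(1)] by (intro image_eqI[OF _ m(1)] antisym) auto
  qed (use * in auto)
qed

lemma translation_length_zero_fixpoint:
  assumes x: "x \<in> M" and \<gamma>: "geodesic M d \<gamma> x (f x)" and "(INF y\<in>M. d y (f y)) = 0"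
  shows "\<exists>y\<in>M. f y = y"
proof -
  note m = displacement_midpoint[OF x \<gamma>]
  have "d (\<gamma> (d x (f x) / 2)) (f (\<gamma> (d x (f x) / 2))) \<le> 0"
    using m assms(3) translation_length[OF x \<gamma>] by simp
  then show ?thesis using m fM zero nonneg by (metis order_antisym)
qed

end

end

section \<open>Free groups\<close>

fun linv :: "'a \<times> bool \<Rightarrow> 'a \<times> bool" where
  "linv (x, e) = (x, \<not> e)"

lemma linv_simps [simp]:
  "linv (linv l) = l" "linv l \<noteq> l" "l \<noteq> linv l" "fst (linv l) = fst l" "linv l = linv m \<longleftrightarrow> l = m"
  by (cases l; cases m; auto)+

lemma same_fst: "fst l = fst m \<Longrightarrow> m = l \<or> m = linv l"
  by (cases l; cases m) auto

abbreviation red :: "('a \<times> bool) list \<Rightarrow> bool" where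
  "red \<equiv> successively (\<lambda>l m. m \<noteq> linv l)"

lemma red_rev: "red w \<Longrightarrow> red (rev (map linv w))"
  by (induction w rule: induct_list012)
    (auto simp: successively_append_iff)

fun common_prefix :: "'b list \<Rightarrow> 'b list \<Rightarrow> nat" where
  "common_prefix (x # xs) (y # ys) = (if x = y then Suc (common_prefix xs ys) else 0)"
| "common_prefix _ _ = 0"

lemma le_common_prefix_iff:
  "n \<le> common_prefix u v \<longleftrightarrow> n \<le> length u \<and> n \<le> length v \<and> take n u = take n v"
proof (induction u v arbitrary: n rule: common_prefix.induct)
  case (1 x xs y ys)
  then show ?case by (cases n) auto
qed auto

lemma common_prefix_commute:
  fixes u v :: "'b list"
  shows "common_prefix u v = common_prefix v u"
proof -
  have *: "common_prefix u v \<le> common_prefix v u" for u v :: "'b list"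
    using le_common_prefix_iff[of "common_prefix u v" u v] le_common_prefix_iff[of "common_prefix u v" v u] by simp
  show ?thesis by (rule antisym[OF * *])
qed

lemma common_prefix_le: "common_prefix u v \<le> length u" "common_prefix u v \<le> length v"
  using le_common_prefix_iff[of "common_prefix u v" u v] by auto

lemma common_prefix_ultra: "min (common_prefix u v) (common_prefix v w) \<le> common_prefix u w"
proof -
  let ?n = "min (common_prefix u v) (common_prefix v w)"
  have "?n \<le> common_prefix u v" "?n \<le> common_prefix v w" by auto
  then show ?thesis unfolding le_common_prefix_iff by simp
qed

lemma common_prefix_same [simp]: "common_prefix u u = length u"
  by (induction u) auto

text \<open>The reduced form of a letter times a reduced word; at most one cancellation
  occurs.\<close>

definition rcons :: "'a \<times> bool \<Rightarrow> ('a \<times> bool) list \<Rightarrow> ('a \<times> bool) list" where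
  "rcons l w = (if w \<noteq> [] \<and> hd w = linv l then tl w else l # w)"

locale free_gp = group F for F :: "('a, 'm) monoid_scheme" (structure) +
  fixes X :: "'a set"
  assumes free: "free_group_on F X"
begin

definition letters :: "('a \<times> bool) set" where
  "letters = X \<times> UNIV"

definition lv :: "'a \<times> bool \<Rightarrow> 'a" where
  "lv l = (if snd l then fst l else inv fst l)"

definition ev :: "('a \<times> bool \<Rightarrow> 'a) \<Rightarrow> ('a \<times> bool) list \<Rightarrow> 'a" where
  "ev f w = foldr (\<lambda>l g. f l \<otimes> g) w \<one>"

abbreviation val :: "('a \<times> bool) list \<Rightarrow> 'a" where
  "val \<equiv> ev lv"

lemma ev_Nil [simp]: "ev f [] = \<one>" and ev_Cons [simp]: "ev f (l # w) = f l \<otimes> ev f w"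
  by (auto simp: ev_def)

lemma word_value_eq: "word_value F w = val w"
  by (induction w) (auto simp: word_value_def lv_def)

lemma X_carrier: "x \<in> X \<Longrightarrow> x \<in> carrier F"
  using free unfolding free_group_on_def by auto

lemma linv_letters [simp]: "linv l \<in> letters \<longleftrightarrow> l \<in> letters"
  by (cases l) (auto simp: letters_def)

lemma lv_closed [simp]: "l \<in> letters \<Longrightarrow> lv l \<in> carrier F"
  using X_carrier by (auto simp: letters_def lv_def)

lemma lv_linv: "l \<in> letters \<Longrightarrow> lv (linv l) = inv (lv l)"
  using X_carrier by (auto simp: letters_def lv_def)

lemma inv_cancel:
  assumes "a \<in> carrier F" "g \<in> carrier F"
  shows "inv a \<otimes> (a \<otimes> g) = g" "a \<otimes> (inv a \<otimes> g) = g"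
  using assms by (simp_all flip: m_assoc)

lemma lv_linv_cancel [simp]:
  assumes "l \<in> letters" "g \<in> carrier F"
  shows "lv (linv l) \<otimes> (lv l \<otimes> g) = g" "lv l \<otimes> (lv (linv l) \<otimes> g) = g"
  using inv_cancel[of "lv l" g] assms by (simp_all add: lv_linv)

lemma words_iff: "w \<in> words X \<longleftrightarrow> set w \<subseteq> letters"
  unfolding words_def letters_def by fastforce

lemma ev_closed: "(\<And>l. l \<in> set w \<Longrightarrow> f l \<in> carrier F) \<Longrightarrow> ev f w \<in> carrier F"
  by (induction w) auto

lemma val_closed [simp]: "set w \<subseteq> letters \<Longrightarrow> val w \<in> carrier F"
  by (auto intro!: ev_closed)

lemma val_append: "set u \<subseteq> letters \<Longrightarrow> set w \<subseteq> letters \<Longrightarrow> val (u @ w) = val u \<otimes> val w"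
  by (induction u) (auto simp: m_assoc)

definition rwords :: "('a \<times> bool) list set" where
  "rwords = {w. set w \<subseteq> letters \<and> red w}"

lemma reduced_words_eq: "reduced_words X = rwords"
proof -
  have "fst l = fst m \<and> snd l \<noteq> snd m \<longleftrightarrow> m = linv l" for l m :: "'a \<times> bool"
    by (cases l; cases m) auto
  then show ?thesis
    unfolding reduced_words_def rwords_def words_iff[symmetric]
    by (auto simp: successively_conv_nth)
qed

definition rw :: "'a \<Rightarrow> ('a \<times> bool) list" where
  "rw = inv_into rwords val"

lemma bij_val: "bij_betw val rwords (carrier F)"
proof -
  have "word_value F = val" using word_value_eq by auto
  then show ?thesis using free unfolding free_group_on_def reduced_words_eq by simp
qed

lemma rw_rwords [simp]: "g \<in> carrier F \<Longrightarrow> rw g \<in> rwords"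
  using bij_val unfolding rw_def by (metis bij_betw_def inv_into_into)

lemma rw_letters: "g \<in> carrier F \<Longrightarrow> set (rw g) \<subseteq> letters" and rw_red: "g \<in> carrier F \<Longrightarrow> red (rw g)"
  using rw_rwords unfolding rwords_def by auto

lemma val_rw [simp]: "g \<in> carrier F \<Longrightarrow> val (rw g) = g"
  using bij_val unfolding rw_def by (simp add: bij_betw_inv_into_right)

lemma rw_val: "w \<in> rwords \<Longrightarrow> rw (val w) = w"
  using bij_val unfolding rw_def by (simp add: bij_betw_inv_into_left)

lemma rw_eqI: "w \<in> rwords \<Longrightarrow> val w = g \<Longrightarrow> rw g = w"
  using rw_val by auto

lemma rwords_Cons: "l # w \<in> rwords \<longleftrightarrow> l \<in> letters \<and> w \<in> rwords \<and> (w = [] \<or> hd w \<noteq> linv l)"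
  by (cases w) (auto simp: rwords_def)

lemma Nil_rwords [simp]: "[] \<in> rwords" by (simp add: rwords_def)

lemma rw_one [simp]: "rw \<one> = []"
  by (rule rw_eqI) auto

lemma rcons_rwords: "l \<in> letters \<Longrightarrow> w \<in> rwords \<Longrightarrow> rcons l w \<in> rwords"
  by (cases w) (auto simp: rcons_def rwords_Cons)

lemma val_rcons: "l \<in> letters \<Longrightarrow> set w \<subseteq> letters \<Longrightarrow> val (rcons l w) = lv l \<otimes> val w"
  by (cases w) (auto simp: rcons_def)

lemma rw_mult: "l \<in> letters \<Longrightarrow> g \<in> carrier F \<Longrightarrow> rw (lv l \<otimes> g) = rcons l (rw g)"
  by (rule rw_eqI) (auto simp: rcons_rwords val_rcons rw_letters)

text \<open>Induction over reduced words rather than over products: no letter cancels in the step,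
  so length and first letters stay under control.\<close>

lemma carrier_induct [consumes 1, case_names one mult]:
  assumes "g \<in> carrier F" "P \<one>"
    and "\<And>l g. l \<in> letters \<Longrightarrow> g \<in> carrier F \<Longrightarrow> rw (lv l \<otimes> g) = l # rw g \<Longrightarrow> P g \<Longrightarrow> P (lv l \<otimes> g)"
  shows "P g"
proof -
  have "P (val w)" if "w \<in> rwords" for w
    using that
  proof (induction w)
    case (Cons l w)
    then have "rw (val (l # w)) = l # rw (val w)" using rw_val by (simp add: rwords_Cons del: ev_Cons)
    then show ?case using Cons assms(3)[of l "val w"] by (auto simp: rwords_Cons) (simp add: rwords_def)
  qed (use assms in simp)
  from this[OF rw_rwords[OF assms(1)]] show ?thesis using assms(1) by simp
qed

definition len :: "'a \<Rightarrow> nat" where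
  "len g = length (rw g)"

lemma len_one [simp]: "len \<one> = 0" by (simp add: len_def)

lemma len_zero: "g \<in> carrier F \<Longrightarrow> len g = 0 \<longleftrightarrow> g = \<one>"
  using val_rw[of g] by (auto simp: len_def simp del: val_rw)

lemma len_val_le: "set w \<subseteq> letters \<Longrightarrow> len (val w) \<le> length w"
proof (induction w)
  case (Cons l w)
  then have "rw (val (l # w)) = rcons l (rw (val w))" by (simp add: rw_mult)
  then show ?case using Cons by (auto simp: len_def rcons_def)
qed simp

lemma word_length_eq:
  assumes g: "g \<in> carrier F"
  shows "word_length F X g = len g"
  unfolding word_length_def
proof (rule Least_equality)
  show "\<exists>w\<in>words X. length w = len g \<and> word_value F w = g"
    using rw_letters[OF g] g by (intro bexI[of _ "rw g"]) (auto simp: words_iff word_value_eq len_def)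
next
  fix n assume "\<exists>w\<in>words X. length w = n \<and> word_value F w = g"
  then show "len g \<le> n" using len_val_le by (auto simp: words_iff word_value_eq)
qed

lemma len_mult_letter: "l \<in> letters \<Longrightarrow> g \<in> carrier F \<Longrightarrow> len (lv l \<otimes> g) \<le> Suc (len g)"
  by (auto simp: len_def rw_mult rcons_def)

lemma len_mult: "g \<in> carrier F \<Longrightarrow> h \<in> carrier F \<Longrightarrow> len (g \<otimes> h) \<le> len g + len h"
proof -
  assume "g \<in> carrier F" "h \<in> carrier F"
  then show ?thesis
    using len_val_le[of "rw g @ rw h"] rw_letters by (simp add: val_append len_def)
qed

lemma set_linv_letters: "set w \<subseteq> letters \<Longrightarrow> set (map linv w) \<subseteq> letters"
proof
  fix l assume "set w \<subseteq> letters" "l \<in> set (map linv w)"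
  then obtain m where "m \<in> letters" "l = linv m" by auto
  then show "l \<in> letters" by simp
qed

lemma val_rev: "set w \<subseteq> letters \<Longrightarrow> val (rev (map linv w)) = inv (val w)"
proof (induction w)
  case (Cons l w)
  then have "set (rev (map linv w)) \<subseteq> letters" using set_linv_letters[of w] by simp
  then show ?case using Cons by (simp add: val_append inv_mult_group lv_linv del: set_rev set_map)
qed simp

lemma rw_inv: "g \<in> carrier F \<Longrightarrow> rw (inv g) = rev (map linv (rw g))"
proof (rule rw_eqI)
  assume g: "g \<in> carrier F"
  then show "rev (map linv (rw g)) \<in> rwords"
    using red_rev[OF rw_red[OF g]] set_linv_letters[OF rw_letters[OF g]] by (simp add: rwords_def)
next
  assume g: "g \<in> carrier F"
  show "val (rev (map linv (rw g))) = inv g"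
    using val_rev[OF rw_letters[OF g]] val_rw[OF g] by argo
qed

lemma len_inv [simp]: "g \<in> carrier F \<Longrightarrow> len (inv g) = len g"
  by (simp add: len_def rw_inv)

section \<open>Gromov products as common prefixes\<close>

definition gp :: "'a \<Rightarrow> 'a \<Rightarrow> nat" where
  "gp g h = common_prefix (rw g) (rw h)"

text \<open>Exactly the common prefix of the two reduced words cancels in the product, so
  \<open>gp\<close> is the Gromov product at the identity. The induction moves the first letter of
  \<open>g\<close> over to \<open>h\<close>.\<close>

lemma len_inv_mult:
  assumes "g \<in> carrier F" "h \<in> carrier F"
  shows "len (inv g \<otimes> h) + 2 * gp g h = len g + len h"
  using assms
proof (induction arbitrary: h rule: carrier_induct)
  case one
  then show ?case by (simp add: gp_def)
next
  case (mult l g)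
  have "inv (lv l \<otimes> g) \<otimes> h = inv g \<otimes> (lv (linv l) \<otimes> h)"
    using mult by (simp add: inv_mult_group m_assoc lv_linv)
  moreover have IH: "len (inv g \<otimes> (lv (linv l) \<otimes> h)) + 2 * gp g (lv (linv l) \<otimes> h) = len g + len (lv (linv l) \<otimes> h)"
    using mult by simp
  moreover have r: "rw (lv (linv l) \<otimes> h) = rcons (linv l) (rw h)" using mult by (simp add: rw_mult)
  moreover have "l # rw g \<in> rwords" using mult rw_rwords[of "lv l \<otimes> g"] by simp
  ultimately show ?case
    using mult.hyps(3) unfolding gp_def len_def
    by (cases "rw h"; cases "rw g") (auto simp: rcons_def rwords_Cons)
qed

lemma word_dist_eq:
  assumes "g \<in> carrier F" "h \<in> carrier F"
  shows "word_dist F X g h = real (len g) + real (len h) - 2 * real (gp g h)"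
  using len_inv_mult[OF assms] assms unfolding word_dist_def by (simp add: word_length_eq)

lemma gromov_product_eq:
  assumes "g \<in> carrier F" "h \<in> carrier F"
  shows "gromov_product F X g h = real (gp g h)"
  using assms by (simp add: gromov_product_def word_dist_eq) (simp add: gp_def)

lemma gp_commute: "gp g h = gp h g"
  by (simp add: gp_def common_prefix_commute)

lemma gp_ultra: "min (gp g h) (gp h k) \<le> gp g k"
  by (simp add: gp_def common_prefix_ultra)

lemma gp_le: "gp g h \<le> len g" "gp g h \<le> len h"
  by (simp_all add: gp_def len_def common_prefix_le)

lemma gp_self [simp]: "gp g g = len g" by (simp add: gp_def len_def)

text \<open>Less than half of the word cancels in the square. Otherwise \<open>g\<close> and its
  inverse would agree on their first halves, and the middle of the reduced word would show two
  adjacent inverse letters or a letter equal to its own inverse.\<close>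

lemma len_square:
  assumes g: "g \<in> carrier F" "g \<noteq> \<one>"
  shows "len g < len (g \<otimes> g)"
proof -
  let ?w = "rw g" let ?n = "length (rw g)"
  define k where "k = gp (inv g) g"
  have "len (g \<otimes> g) + 2 * k = 2 * len g"
    using len_inv_mult[of "inv g" g] g by (simp add: k_def)
  moreover have "2 * k < len g"
  proof (rule ccontr)
    assume "\<not> 2 * k < len g"
    then have k: "?n \<le> 2 * k" by (simp add: len_def)
    have kn: "k \<le> ?n" using gp_le(2) by (simp add: k_def len_def)
    have n: "?n > 0" using g len_zero by (auto simp: len_def)
    have "take k (rev (map linv ?w)) = take k ?w"
      using le_common_prefix_iff[of k "rw (inv g)" ?w] g unfolding k_def gp_def by (simp add: rw_inv)
    then have sym: "linv (?w ! (?n - 1 - i)) = ?w ! i" if "i < k" for i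
      using that kn nth_take[OF that, of "rev (map linv ?w)"] nth_take[OF that, of ?w] by (simp add: rev_nth)
    show False
    proof (cases "even ?n")
      case True
      then obtain m where m: "?n = 2 * m" by auto
      then have "m > 0" using n by simp
      have "?n - 1 - (m - 1) = m" using m \<open>m > 0\<close> by simp
      then have "linv (?w ! m) = ?w ! (m - 1)" using sym[of "m - 1"] k m \<open>m > 0\<close> by simp
      moreover have "?w ! m \<noteq> linv (?w ! (m - 1))"
        using rw_red[OF g(1)] m \<open>m > 0\<close>
        by (auto simp: successively_conv_nth dest: spec[of _ "m - 1"])
      ultimately show False by (metis linv_simps(1))
    next
      case False
      then obtain m where m: "?n = 2 * m + 1" by (metis oddE)
      then have "linv (?w ! m) = ?w ! m" using sym[of m] k by simp
      then show False by simp
    qed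
  qed
  ultimately show ?thesis by simp
qed

section \<open>Endomorphisms given by the images of letters\<close>

definition ext :: "('a \<times> bool \<Rightarrow> 'a) \<Rightarrow> 'a \<Rightarrow> 'a" where
  "ext f = (\<lambda>g\<in>carrier F. ev f (rw g))"

definition lmap :: "('a \<times> bool \<Rightarrow> 'a) \<Rightarrow> bool" where
  "lmap f \<longleftrightarrow> (\<forall>l\<in>letters. f l \<in> carrier F \<and> f (linv l) = inv (f l))"

lemma ext_closed: "lmap f \<Longrightarrow> g \<in> carrier F \<Longrightarrow> ext f g \<in> carrier F"
  unfolding ext_def using rw_letters by (auto simp: lmap_def intro!: ev_closed)

lemma ext_one [simp]: "ext f \<one> = \<one>"
  by (simp add: ext_def)

lemma ext_mult_letter:
  assumes f: "lmap f" and lg: "l \<in> letters" "g \<in> carrier F"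
  shows "ext f (lv l \<otimes> g) = f l \<otimes> ext f g"
proof (cases "rw g \<noteq> [] \<and> hd (rw g) = linv l")
  case True
  then obtain w where w: "rw g = linv l # w" by (cases "rw g") auto
  have c: "ev f w \<in> carrier F" "f l \<in> carrier F" "f (linv l) = inv (f l)"
    using f lg rw_letters[OF lg(2)] w unfolding lmap_def by (auto intro!: ev_closed)
  show ?thesis using w lg c unfolding ext_def
    by (simp add: rw_mult rcons_def) (metis c inv_closed m_assoc r_inv l_one)
next
  case False
  then show ?thesis using lg unfolding ext_def by (auto simp: rw_mult rcons_def)
qed

lemma ext_lv: "lmap f \<Longrightarrow> l \<in> letters \<Longrightarrow> ext f (lv l) = f l"
  using ext_mult_letter[of f l \<one>] by (simp add: lmap_def)

lemma ext_mult:
  assumes f: "lmap f" and gh: "g \<in> carrier F" "h \<in> carrier F"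
  shows "ext f (g \<otimes> h) = ext f g \<otimes> ext f h"
  using gh
proof (induction rule: carrier_induct)
  case one
  then show ?case using ext_closed f by simp
next
  case (mult l g)
  have "f l \<in> carrier F" using f mult by (simp add: lmap_def)
  then show ?case using mult f by (simp add: m_assoc ext_mult_letter ext_closed)
qed

lemma ext_hom: "lmap f \<Longrightarrow> ext f \<in> hom F F"
  by (auto simp: hom_def ext_closed ext_mult)

lemma hom_eqI:
  assumes "f \<in> hom F F" "h \<in> hom F F" "\<And>x. x \<in> X \<Longrightarrow> f x = h x" "g \<in> carrier F"
  shows "f g = h g"
proof -
  interpret f: group_hom F F f using assms(1) by unfold_locales
  interpret h: group_hom F F h using assms(2) by unfold_locales
  have l: "f (lv l) = h (lv l)" if "l \<in> letters" for l
    using that assms(3) X_carrier by (auto simp: letters_def lv_def)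
  show ?thesis
    using assms(4) by (induction rule: carrier_induct) (auto simp: l)
qed

subsection \<open>Transvections\<close>

text \<open>With \<open>z = (c, True)\<close> this is c \<mapsto> c a^n; with
  \<open>z = (c, False)\<close> it is c \<mapsto> a^-n c. Letting \<open>z\<close> be a letter
  rather than a basis element covers multiplication on both sides.\<close>

definition trans_map :: "'a \<times> bool \<Rightarrow> 'a \<Rightarrow> int \<Rightarrow> 'a \<times> bool \<Rightarrow> 'a" where
  "trans_map z a n l = (if l = z then lv z \<otimes> a [^] n else if l = linv z then a [^] (- n) \<otimes> lv (linv z) else lv l)"

definition transvection :: "'a \<times> bool \<Rightarrow> 'a \<Rightarrow> int \<Rightarrow> 'a \<Rightarrow> 'a" where
  "transvection z a n = ext (trans_map z a n)"

definition apow :: "'a \<Rightarrow> int \<Rightarrow> ('a \<times> bool) list" where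
  "apow a n = replicate (nat \<bar>n\<bar>) (a, n \<ge> 0)"

lemma apow_0 [simp]: "apow a 0 = []" by (simp add: apow_def)

lemma set_apow: "set (apow a n) \<subseteq> {(a, n \<ge> 0)}" by (auto simp: apow_def)

lemma length_apow [simp]: "length (apow a n) = nat \<bar>n\<bar>" by (simp add: apow_def)

lemma apow_eq_Nil [simp]: "apow a n = [] \<longleftrightarrow> n = 0" by (simp add: apow_def)

lemma hd_apow: "n \<noteq> 0 \<Longrightarrow> hd (apow a n) = (a, n \<ge> 0)" "n \<noteq> 0 \<Longrightarrow> last (apow a n) = (a, n \<ge> 0)"
  by (simp_all add: apow_def)

lemma red_apow: "red (apow a n)"
  by (auto simp: apow_def successively_conv_nth)

lemma apow_letters: "a \<in> X \<Longrightarrow> set (apow a n) \<subseteq> letters"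
  by (auto simp: apow_def letters_def)

lemma val_apow: assumes "a \<in> X" shows "val (apow a n) = a [^] n"
proof -
  have a: "a \<in> carrier F" using assms X_carrier by simp
  have *: "val (replicate k (a, True)) = a [^] k" "val (replicate k (a, False)) = inv a [^] k" for k :: nat
    using a by (induction k) (auto simp: lv_def nat_pow_Suc2[symmetric] simp del: nat_pow_Suc)
  show ?thesis
  proof (cases "n \<ge> 0")
    case True
    then have "apow a n = replicate (nat n) (a, True)" by (simp add: apow_def)
    then show ?thesis using *(1)[of "nat n"] True unfolding int_pow_def2[of F a n] by simp
  next
    case False
    then have "apow a n = replicate (nat (- n)) (a, False)" by (simp add: apow_def)
    then show ?thesis using *(2)[of "nat (- n)"] False a unfolding int_pow_def2[of F a n] by (simp add: nat_pow_inv int_pow_inv)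
  qed
qed

lemma apow_rwords: "a \<in> X \<Longrightarrow> apow a n \<in> rwords"
  using red_apow apow_letters by (auto simp: rwords_def)

lemma apow_append_rwords:
  assumes "a \<in> X" "s # t \<in> rwords" "fst s \<noteq> a"
  shows "apow a n @ s # t \<in> rwords"
proof -
  have "s \<noteq> linv (a, n \<ge> 0)" using assms(3) by (metis fst_conv linv_simps(4))
  then show ?thesis
    using assms red_apow[of a n] apow_letters[of a n] hd_apow(2)[of n a]
    by (auto simp: rwords_def successively_append_iff)
qed

lemma decompose_apow:
  assumes "w \<in> rwords" "a \<in> X"
  obtains n w' where "w = apow a n @ w'" "w' \<in> rwords" "w' = [] \<or> fst (hd w') \<noteq> a"
proof -
  have "\<exists>n w'. w = apow a n @ w' \<and> w' \<in> rwords \<and> (w' = [] \<or> fst (hd w') \<noteq> a)"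
    using assms(1)
  proof (induction w)
    case Nil
    then show ?case by (intro exI[of _ 0] exI[of _ "[]"]) auto
  next
    case (Cons l w)
    then obtain n w' where *: "w = apow a n @ w'" "w' \<in> rwords" "w' = [] \<or> fst (hd w') \<noteq> a"
      by (auto simp: rwords_Cons)
    show ?case
    proof (cases "fst l = a")
      case False
      then show ?thesis using Cons by (intro exI[of _ 0] exI[of _ "l # w"]) auto
    next
      case True
      then obtain e where l: "l = (a, e)" by (cases l) auto
      have "n \<noteq> 0 \<Longrightarrow> (n \<ge> 0) = e" using Cons(2) * l by (auto simp: rwords_Cons hd_append hd_apow)
      then have "nat \<bar>if e then n + 1 else n - 1\<bar> = Suc (nat \<bar>n\<bar>)" "(if e then n + 1 else n - 1) \<ge> 0 \<longleftrightarrow> e"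
        "replicate (nat \<bar>n\<bar>) (a, n \<ge> 0) = replicate (nat \<bar>n\<bar>) (a, e)"
        by (cases "n = 0"; cases e; auto)+
      then have "l # apow a n = apow a (if e then n + 1 else n - 1)"
        using l unfolding apow_def by (simp only: replicate.simps)
      then show ?thesis using * by (intro exI[of _ "if e then n + 1 else n - 1"] exI[of _ w']) auto
    qed
  qed
  then show thesis using that by blast
qed

context
  fixes z :: "'a \<times> bool" and a :: 'a
  assumes z: "z \<in> letters" and a: "a \<in> X" "fst z \<noteq> a"
begin

lemma a_pow_closed [simp]: "a [^] (n::int) \<in> carrier F"
  using a X_carrier by simp

lemma lmap_trans: "lmap (trans_map z a n)"
  unfolding lmap_def
proof (intro ballI conjI)
  fix l assume l: "l \<in> letters"
  show "trans_map z a n l \<in> carrier F" using l z by (simp add: trans_map_def)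
  have inv: "inv (a [^] n) = a [^] (- n)" "inv (a [^] (- n)) = a [^] n"
    using X_carrier[OF a(1)] by (simp_all add: int_pow_neg)
  consider "l = z" | "l = linv z" | "l \<noteq> z" "l \<noteq> linv z" by blast
  then show "trans_map z a n (linv l) = inv (trans_map z a n l)"
  proof cases
    case 3
    then have "linv l \<noteq> z" by auto
    then show ?thesis using 3 l by (simp add: trans_map_def lv_linv)
  qed (use z in \<open>simp_all add: trans_map_def lv_linv inv_mult_group inv\<close>)
qed

lemma transvection_hom: "transvection z a n \<in> hom F F"
  unfolding transvection_def by (rule ext_hom[OF lmap_trans])

lemma transvection_closed [simp]: "g \<in> carrier F \<Longrightarrow> transvection z a n g \<in> carrier F"
  using transvection_hom by (auto simp: hom_def)

lemma transvection_mult: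
  "g \<in> carrier F \<Longrightarrow> h \<in> carrier F \<Longrightarrow> transvection z a n (g \<otimes> h) = transvection z a n g \<otimes> transvection z a n h"
  using transvection_hom by (auto simp: hom_def)

lemma transvection_lv:
  "l \<in> letters \<Longrightarrow> transvection z a n (lv l) = trans_map z a n l"
  unfolding transvection_def by (rule ext_lv[OF lmap_trans])

lemma transvection_fixes: "x \<in> X \<Longrightarrow> x \<noteq> fst z \<Longrightarrow> transvection z a n x = x"
  using transvection_lv[of "(x, True)" n] z
  by (cases z) (auto simp: letters_def lv_def trans_map_def)

lemma transvection_apow [simp]: "transvection z a n (a [^] (m::int)) = a [^] m"
  using hom_int_pow[OF transvection_hom X_carrier[OF a(1)] is_group is_group] transvection_fixes[OF a(1)] a(2) by simp

lemma transvection_add: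
  assumes "g \<in> carrier F"
  shows "transvection z a m (transvection z a n g) = transvection z a (m + n) g"
proof -
  have aF: "a \<in> carrier F" using a X_carrier by simp
  have "compose (carrier F) (transvection z a m) (transvection z a n) g = transvection z a (m + n) g"
  proof (rule hom_eqI[OF _ transvection_hom _ assms])
    show "compose (carrier F) (transvection z a m) (transvection z a n) \<in> hom F F"
      by (auto simp: compose_def hom_def transvection_mult)
    have e: "transvection z a n (lv z) = lv z \<otimes> a [^] n" for n
      using transvection_lv[OF z] by (simp add: trans_map_def)
    have "transvection z a n (lv (linv z)) = a [^] (- n) \<otimes> lv (linv z)" for n
      using transvection_lv[of "linv z"] z by (simp add: trans_map_def)
    note e = e this
    have *: "transvection z a m (transvection z a n (lv l)) = transvection z a (m + n) (lv l)" if "l = z \<or> l = linv z" for l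
      using that z aF by (auto simp: e transvection_mult m_assoc int_pow_mult[symmetric] add.commute)
        (simp add: m_assoc[symmetric] int_pow_mult[symmetric] add.commute)
    fix x assume x: "x \<in> X"
    show "compose (carrier F) (transvection z a m) (transvection z a n) x = transvection z a (m + n) x"
    proof (cases "x = fst z")
      case True
      then have "(x, True) = z \<or> (x, True) = linv z" by (cases z) auto
      then show ?thesis using *[of "(x, True)"] x X_carrier by (simp add: compose_def lv_def)
    qed (use x X_carrier transvection_fixes in \<open>simp add: compose_def\<close>)
  qed
  then show ?thesis using assms by (simp add: compose_def)
qed

lemma transvection_0: "g \<in> carrier F \<Longrightarrow> transvection z a 0 g = g"
proof -
  assume g: "g \<in> carrier F"
  have "transvection z a 0 g = id g"
  proof (rule hom_eqI[OF transvection_hom _ _ g])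
    fix x assume x: "x \<in> X"
    then have "transvection z a 0 (lv (x, True)) = lv (x, True)"
      using z transvection_lv[of "(x, True)" 0] by (auto simp: letters_def trans_map_def)
    then show "transvection z a 0 x = id x" by (simp add: lv_def)
  qed (auto simp: hom_def)
  then show ?thesis by simp
qed

lemma transvection_cancel:
  "g \<in> carrier F \<Longrightarrow> transvection z a (- n) (transvection z a n g) = g"
  "g \<in> carrier F \<Longrightarrow> transvection z a n (transvection z a (- n) g) = g"
  by (simp_all add: transvection_add transvection_0)

lemma transvection_auto: "transvection z a n \<in> auto F"
proof -
  have "bij_betw (transvection z a n) (carrier F) (carrier F)"
    by (rule bij_betw_byWitness[where f' = "transvection z a (- n)"]) (auto simp: transvection_cancel)
  then show ?thesis
    using transvection_hom unfolding auto_def Bij_def by (auto simp: transvection_def ext_def)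
qed

text \<open>Writing every image as power, letter, power, with most exponents zero, spares the normal
  form arguments a case distinction on the letter.\<close>

lemma transvection_lv_split:
  assumes "s \<in> letters"
  shows "transvection z a n (lv s) =
    a [^] (if s = linv z then - n else 0) \<otimes> (lv s \<otimes> a [^] (if s = z then n else 0))"
  unfolding transvection_lv[OF assms] trans_map_def
  using assms X_carrier[OF a(1)] by (cases "s = z"; cases "s = linv z") simp_all

lemma transvection_normal_form_end:
  assumes s: "s \<in> letters" "fst s \<noteq> a"
  shows "s # apow a q \<in> rwords"
    and "transvection z a n (val (s # apow a p)) =
      a [^] (if s = linv z then - n else 0) \<otimes> val (s # apow a ((if s = z then n else 0) + p))"
proof -
  have aF: "a \<in> carrier F" using a X_carrier by simp
  have sl: "(a, b) \<noteq> linv s" for b using s by (metis fst_conv linv_simps(4))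
  show "s # apow a q \<in> rwords"
    using s apow_rwords[OF a(1)] sl by (cases "q = 0") (auto simp: rwords_Cons hd_apow)
  show "transvection z a n (val (s # apow a p)) =
      a [^] (if s = linv z then - n else 0) \<otimes> val (s # apow a ((if s = z then n else 0) + p))"
    using s aF by (simp add: transvection_mult transvection_lv_split val_apow[OF a(1)] int_pow_mult m_assoc)
qed

text \<open>The block of \<open>a\<close> between \<open>s\<close> and \<open>s1\<close> collects
  \<open>n\<close> from \<open>s = z\<close> and \<open>- n\<close> from \<open>s1 = linv z\<close>.
  If it vanishes while \<open>s1 = linv s\<close>, the two contributions are both present or both
  absent, so the old block was empty too and the old word was not reduced.\<close>

lemma transvection_normal_form_step:
  fixes n p :: int
  defines "q s s' \<equiv> (if s = z then n else 0) + p + (if s' = linv z then - n else 0)"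
  assumes r: "s # apow a p @ s1 # t1 \<in> rwords" "fst s \<noteq> a" "fst s1 \<noteq> a" and t1': "s1 # t1' \<in> rwords"
    and eq: "transvection z a n (val (s1 # t1)) = a [^] (if s1 = linv z then - n else 0) \<otimes> val (s1 # t1')"
  shows "s # apow a (q s s1) @ s1 # t1' \<in> rwords"
    and "transvection z a n (val (s # apow a p @ s1 # t1)) =
      a [^] (if s = linv z then - n else 0) \<otimes> val (s # apow a (q s s1) @ s1 # t1')"
proof -
  have aF: "a \<in> carrier F" using a X_carrier by simp
  have s: "s \<in> letters" "set (s1 # t1) \<subseteq> letters" using r by (auto simp: rwords_def)
  have sl: "(a, b) \<noteq> linv s" for b using r by (metis fst_conv linv_simps(4))
  show "s # apow a (q s s1) @ s1 # t1' \<in> rwords"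
  proof (cases "q s s1 = 0")
    case True
    have "s1 \<noteq> linv s"
    proof
      assume e: "s1 = linv s"
      then have "p = 0" using True unfolding q_def by (auto split: if_splits)
      then show False using r e by (simp add: rwords_Cons)
    qed
    then show ?thesis using True t1' s by (simp add: rwords_Cons)
  next
    case False
    then show ?thesis using s apow_append_rwords[OF a(1) t1' r(3), of "q s s1"] sl
      by (auto simp: rwords_Cons hd_append hd_apow)
  qed
  have tail: "val (apow a m @ s1 # u) = a [^] m \<otimes> val (s1 # u)" if "set (s1 # u) \<subseteq> letters" for m u
    using that apow_letters[OF a(1), of m] by (subst val_append) (auto simp: val_apow[OF a(1)])
  have c: "val (s1 # t1') \<in> carrier F" "set (s1 # t1') \<subseteq> letters" "val (s1 # t1) \<in> carrier F"
    using t1' s by (auto simp: rwords_def simp del: ev_Cons)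
  have "transvection z a n (val (s # apow a p @ s1 # t1)) = a [^] (if s = linv z then - n else 0) \<otimes>
      (lv s \<otimes> a [^] (if s = z then n else 0) \<otimes> (a [^] p \<otimes> transvection z a n (val (s1 # t1))))"
    unfolding ev_Cons[of _ s] tail[OF s(2)]
    using s c aF by (simp add: transvection_mult transvection_lv_split m_assoc del: ev_Cons)
  also have "\<dots> = a [^] (if s = linv z then - n else 0) \<otimes> (lv s \<otimes> (a [^] (q s s1) \<otimes> val (s1 # t1')))"
    unfolding q_def eq using s c aF by (simp add: int_pow_mult m_assoc del: ev_Cons)
  finally show "transvection z a n (val (s # apow a p @ s1 # t1)) =
      a [^] (if s = linv z then - n else 0) \<otimes> val (s # apow a (q s s1) @ s1 # t1')"
    unfolding ev_Cons[of _ s] tail[OF c(2)] .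
qed

text \<open>Only powers of \<open>a\<close> change, so the first letter \<open>s\<close> survives.
  The power of \<open>a\<close> in front is kept outside the word because the preceding block
  absorbs it, in the induction and in the applications.\<close>

lemma transvection_normal_form:
  assumes "s # t \<in> rwords" "fst s \<noteq> a"
  shows "\<exists>t'. s # t' \<in> rwords \<and>
    transvection z a n (val (s # t)) = a [^] (if s = linv z then - n else 0) \<otimes> val (s # t')"
  using assms
proof (induction t arbitrary: s rule: length_induct)
  case (1 t)
  have s: "s \<in> letters" "t \<in> rwords" using 1 by (auto simp: rwords_Cons)
  obtain p r where p: "t = apow a p @ r" "r \<in> rwords" "r = [] \<or> fst (hd r) \<noteq> a"
    using decompose_apow[OF s(2) a(1)] .
  show ?case
  proof (cases r)
    case Nil
    then show ?thesis using transvection_normal_form_end[OF s(1) 1(3)] p(1) by auto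
  next
    case (Cons s1 t1)
    then have s1: "s1 # t1 \<in> rwords" "fst s1 \<noteq> a" "length t1 < length t" using p by auto
    then obtain t1' where t1': "s1 # t1' \<in> rwords"
      "transvection z a n (val (s1 # t1)) = a [^] (if s1 = linv z then - n else 0) \<otimes> val (s1 # t1')"
      using 1(1) by blast
    have "s # apow a p @ s1 # t1 \<in> rwords" using 1(2) p Cons by simp
    from transvection_normal_form_step[OF this 1(3) s1(2) t1'] show ?thesis
      unfolding p(1) Cons by blast
  qed
qed

end

end

section \<open>The Cayley tree in outer space\<close>

text \<open>A point closer to \<open>U\<close> than \<open>r\<close> is lies on the side of
  \<open>r\<close> that contains \<open>U\<close>, so \<open>r\<close> still lies between it and
  \<open>V\<close>.\<close>

lemma (in Metric_space) between_shift:
  assumes four: "four_point M d" and M: "U \<in> M" "V \<in> M" "A \<in> M" "r \<in> M"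
    and "d U r + d r V = d U V" "d U A < d U r"
  shows "d A r + d r V = d A V"
proof -
  have "d U V + d A r \<le> max (d U A + d V r) (d U r + d V A)"
    using four_pointD[OF four] M by auto
  then have "d A r + d r V \<le> d A V"
    using assms(6,7) nonneg[of A r] commute[of V r] commute[of V A] unfolding le_max_iff_disj by linarith
  then show ?thesis using triangle[of A r V] M by linarith
qed

text \<open>Pure arithmetic: the ultrametric inequality for Gromov products at one fixed root
  implies the four-point condition for all quadruples.\<close>

lemma four_point_from_root:
  fixes xy zw xz yw xw yz :: real
  assumes "min xz yz \<le> xy" "min xw yw \<le> xy" "min xz xw \<le> zw" "min yz yw \<le> zw"
    "min xy yz \<le> xz" "min xw zw \<le> xz" "min xy xz \<le> yz" "min yw zw \<le> yz"
    "min xy yw \<le> xw" "min xz zw \<le> xw" "min xy xw \<le> yw" "min yz zw \<le> yw"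
  shows "min (xz + yw) (xw + yz) \<le> xy + zw"
  using assms unfolding min_def by (smt (verit))

lemma common_prefix_take:
  "common_prefix (take m u) (take n v) = min (min m n) (common_prefix u v)"
proof (induction u v arbitrary: m n rule: common_prefix.induct)
  case (1 x xs y ys)
  then show ?case by (cases m; cases n) auto
qed auto

text \<open>An automorphism permutes the group, so the twisted action has the same orbits and the
  same invariant subsets, and stabilisers stay trivial.\<close>

lemma (in group) outer_space_tree_twist:
  assumes T: "outer_space_tree G M d \<alpha>" and \<phi>: "\<phi> \<in> auto G"
  shows "outer_space_tree G M d (\<lambda>g. \<alpha> (\<phi> g))"
proof -
  have hom: "\<phi> \<in> hom G G" and bij: "bij_betw \<phi> (carrier G) (carrier G)"
    using \<phi> by (auto simp: auto_def Bij_def)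
  interpret \<phi>: group_hom G G \<phi> using hom by unfold_locales
  have im: "\<phi> ` carrier G = carrier G" using bij by (simp add: bij_betw_def)
  have act: "group_action G M \<alpha>" using T unfolding outer_space_tree_def isometric_action_def by simp
  have "(\<lambda>g. \<alpha> (\<phi> g)) \<in> hom G (BijGroup M)"
    using act \<phi>.hom_closed \<phi>.hom_mult
    unfolding group_action_def group_hom_def group_hom_axioms_def hom_def by auto
  then have "group_action G M (\<lambda>g. \<alpha> (\<phi> g))"
    using act unfolding group_action_def group_hom_def group_hom_axioms_def by simp
  moreover have "orbit G (\<lambda>g. \<alpha> (\<phi> g)) x = orbit G \<alpha> x" for x
  proof -
    have "orbit G \<alpha> x = (\<lambda>g. \<alpha> g x) ` (\<phi> ` carrier G)"
      unfolding im by (auto simp: orbit_def)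
    then show ?thesis by (auto simp: orbit_def)
  qed
  moreover have "stabilizer G (\<lambda>g. \<alpha> (\<phi> g)) x = {\<one>}" if "x \<in> M" for x
  proof -
    have "stabilizer G \<alpha> x = {\<one>}" using T that unfolding outer_space_tree_def free_action_def by simp
    then have "g \<in> stabilizer G (\<lambda>g. \<alpha> (\<phi> g)) x \<longleftrightarrow> g \<in> carrier G \<and> \<phi> g = \<one>" for g
      unfolding stabilizer_def using \<phi>.hom_closed by blast
    moreover have "g \<in> carrier G \<and> \<phi> g = \<one> \<longleftrightarrow> g = \<one>" for g
      using bij \<phi>.hom_one unfolding bij_betw_def inj_on_def by (metis one_closed)
    ultimately show ?thesis by auto
  qed
  moreover have "(\<forall>g\<in>carrier G. \<alpha> (\<phi> g) ` S \<subseteq> S) \<longleftrightarrow> (\<forall>g\<in>carrier G. \<alpha> g ` S \<subseteq> S)" for S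
    using im by (metis (no_types, lifting) image_iff)
  moreover have "\<forall>g\<in>carrier G. \<forall>x\<in>M. \<forall>y\<in>M. d (\<alpha> (\<phi> g) x) (\<alpha> (\<phi> g) y) = d x y"
    using T unfolding outer_space_tree_def isometric_action_def by simp
  ultimately show ?thesis
    using T unfolding outer_space_tree_def isometric_action_def minimal_action_def free_action_def discrete_action_def
    by simp
qed

text \<open>A zero infimum of displacements is attained in a real tree, so it would give a fixed
  point of \<open>g\<close>, against freeness. Vanishing lengths therefore separate the limit tree
  from \<open>CV G\<close>.\<close>

lemma (in group) cv_nonzero:
  assumes "l \<in> cv G" and g: "g \<in> carrier G" "g \<noteq> \<one>"
  shows "l g \<noteq> 0"
proof
  assume "l g = 0"
  from assms(1) obtain M :: "real set" and d \<alpha>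
    where T: "outer_space_tree G M d \<alpha>" and l: "l = length_function G M d \<alpha>"
    unfolding cv_def by auto
  have tree: "real_tree M d" and iso: "isometric_action G M d \<alpha>" and fr: "free_action G M \<alpha>"
    using T unfolding outer_space_tree_def by auto
  interpret Metric_space M d using tree unfolding real_tree_def by simp
  interpret act: group_action G M \<alpha> using iso unfolding isometric_action_def by simp
  have M: "\<alpha> g x \<in> M" if "x \<in> M" for x using act.element_image[OF g(1) that] by simp
  obtain x where x: "x \<in> M" using tree unfolding real_tree_def by auto
  obtain \<gamma> where \<gamma>: "geodesic M d \<gamma> x (\<alpha> g x)"
    using tree x M[OF x] unfolding real_tree_def geodesic_def by blast
  have "\<exists>y\<in>M. \<alpha> g y = y"
  proof (rule translation_length_zero_fixpoint[where f = "\<alpha> g", OF real_tree_four_point[OF tree] M _ x \<gamma>])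
    show "d (\<alpha> g x) (\<alpha> g y) = d x y" if "x \<in> M" "y \<in> M" for x y
      using iso g that unfolding isometric_action_def by auto
    show "(INF y\<in>M. d y (\<alpha> g y)) = 0"
      using \<open>l g = 0\<close> g unfolding l length_function_def by simp
  qed
  then show False
    using fr g unfolding free_action_def stabilizer_def by blast
qed

locale free_gp_fin = free_gp +
  assumes fin: "finite X" and nonempty: "X \<noteq> {}"
begin

lemma countable_carrier: "countable (carrier F)"
proof -
  have "finite letters" using fin by (simp add: letters_def)
  then have "countable (lists letters)" by (simp add: countable_finite)
  moreover have "rwords \<subseteq> lists letters" by (auto simp: rwords_def)
  ultimately have "countable rwords" by (rule countable_subset[rotated])
  then show ?thesis using bij_val by (metis bij_betw_imp_surj_on countable_image)
qed

text \<open>Points of the Cayley tree are encoded as real numbers: \<open>idx g + t\<close> with \<open>0 \<le> t < 1\<close> stands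
  for the point at distance \<open>t\<close> from the vertex \<open>g\<close> on the edge from \<open>g\<close> towards the root.\<close>

definition idx :: "'a \<Rightarrow> nat" where "idx = to_nat_on (carrier F)"

definition vx :: "real \<Rightarrow> 'a" where "vx r = from_nat_into (carrier F) (nat \<lfloor>r\<rfloor>)"

definition ht :: "real \<Rightarrow> real" where "ht r = real (len (vx r)) - frac r"

text \<open>The condition \<open>t \<le> len g\<close> matters only for \<open>g = \<one>\<close>,
  where no edge leads towards the root.\<close>

definition pts :: "real set" where
  "pts = {real (idx g) + t |g t. g \<in> carrier F \<and> 0 \<le> t \<and> t < 1 \<and> t \<le> len g}"

text \<open>The height at which the paths from the root to the two points part, that is, their
  Gromov product at the root.\<close>

definition mq :: "real \<Rightarrow> real \<Rightarrow> real" where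
  "mq r s = min (real (gp (vx r) (vx s))) (min (ht r) (ht s))"

definition td :: "real \<Rightarrow> real \<Rightarrow> real" where
  "td r s = ht r + ht s - 2 * mq r s"

lemma encode:
  fixes t :: real
  assumes "g \<in> carrier F" "0 \<le> t" "t < 1" "t \<le> len g"
  shows "real (idx g) + t \<in> pts" "vx (real (idx g) + t) = g" "ht (real (idx g) + t) = real (len g) - t"
proof -
  show "real (idx g) + t \<in> pts" using assms unfolding pts_def by blast
  have "\<lfloor>real (idx g) + t\<rfloor> = int (idx g)" using assms by linarith
  then show *: "vx (real (idx g) + t) = g"
    using from_nat_into_to_nat_on[OF countable_carrier assms(1)] unfolding vx_def idx_def by simp
  have "frac (real (idx g) + t) = t"
    using \<open>\<lfloor>real (idx g) + t\<rfloor> = int (idx g)\<close> unfolding frac_def by simp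
  then show "ht (real (idx g) + t) = real (len g) - t" unfolding ht_def * by simp
qed

lemma pts_cases:
  assumes "r \<in> pts"
  shows "vx r \<in> carrier F" "0 \<le> ht r" "ht r \<le> len (vx r)" "len (vx r) < ht r + 1"
    "r = real (idx (vx r)) + (real (len (vx r)) - ht r)"
proof -
  obtain g and t :: real where r: "r = real (idx g) + t" "g \<in> carrier F" "0 \<le> t" "t < 1" "t \<le> len g"
    using assms unfolding pts_def by auto
  note e = encode[OF r(2-), folded r(1)]
  show "vx r \<in> carrier F" "0 \<le> ht r" "ht r \<le> len (vx r)" "len (vx r) < ht r + 1"
    "r = real (idx (vx r)) + (real (len (vx r)) - ht r)"
    using e r by auto
qed

lemma pts_eqI: "r \<in> pts \<Longrightarrow> s \<in> pts \<Longrightarrow> vx r = vx s \<Longrightarrow> ht r = ht s \<Longrightarrow> r = s"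
  using pts_cases(5) by metis

lemma pts_ex:
  fixes h :: real
  assumes "g \<in> carrier F" "0 \<le> h" "h \<le> len g" "len g < h + 1"
  shows "\<exists>r\<in>pts. vx r = g \<and> ht r = h"
  using encode[of g "real (len g) - h"] assms by (intro bexI[of _ "real (idx g) + (real (len g) - h)"]) auto

lemma mq_commute: "mq r s = mq s r"
  by (simp add: mq_def gp_commute min.commute)

lemma mq_le: "mq r s \<le> ht r" "mq r s \<le> ht s"
  by (auto simp: mq_def)

lemma mq_ultra: "min (mq r s) (mq s t) \<le> mq r t"
proof -
  have "min (real (gp (vx r) (vx s))) (real (gp (vx s) (vx t))) \<le> real (gp (vx r) (vx t))"
    using gp_ultra[of "vx r" "vx s" "vx t"] by linarith
  then show ?thesis unfolding mq_def by linarith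
qed

lemma td_zero_iff:
  assumes "r \<in> pts" "s \<in> pts"
  shows "td r s = 0 \<longleftrightarrow> r = s"
proof
  assume "td r s = 0"
  then have *: "mq r s = ht r" "mq r s = ht s" using mq_le[of r s] unfolding td_def by linarith+
  note r = pts_cases[OF assms(1)] and s = pts_cases[OF assms(2)]
  have "ht r \<le> gp (vx r) (vx s)" using * unfolding mq_def by linarith
  then have g: "len (vx r) \<le> gp (vx r) (vx s)" "len (vx s) \<le> gp (vx r) (vx s)"
    using r s * by linarith+
  then have "len (vx r) = length (rw (vx s))" "take (len (vx r)) (rw (vx r)) = take (len (vx r)) (rw (vx s))"
    using gp_le[of "vx r" "vx s"] le_common_prefix_iff[of "len (vx r)" "rw (vx r)" "rw (vx s)"]
    unfolding gp_def len_def by auto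
  then have "rw (vx r) = rw (vx s)" unfolding len_def by simp
  then have "vx r = vx s" using r s val_rw by metis
  then show "r = s" using pts_eqI[OF assms] * by simp
next
  assume "r = s"
  then show "td r s = 0" using pts_cases[OF assms(1)] unfolding td_def mq_def by (simp add: min_def)
qed

sublocale tree: Metric_space pts td
proof
  show "0 \<le> td x y" "td x y = td y x" for x y
    using mq_le[of x y] mq_commute[of x y] unfolding td_def by linarith+
  show "(td x y = 0) = (x = y)" if "x \<in> pts" "y \<in> pts" for x y using td_zero_iff that .
  show "td x z \<le> td x y + td y z" for x y z
    using mq_ultra[of x y z] mq_le[of x y] mq_le[of y z] unfolding td_def by linarith
qed

lemma td_four_point: "four_point pts td"
  unfolding four_point_def
proof (intro ballI)
  fix x y z w
  have "min (mq x z + mq y w) (mq x w + mq y z) \<le> mq x y + mq z w"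
    by (rule four_point_from_root) (metis mq_commute mq_ultra min.commute)+
  then show "td x y + td z w \<le> max (td x z + td y w) (td x w + td y z)"
    unfolding td_def by linarith
qed

text \<open>The point at height \<open>h\<close> on the path from the root to \<open>r\<close>.
  Rounding up appears because a point on an edge is named after the end farther from the
  root.\<close>

definition below :: "real \<Rightarrow> real \<Rightarrow> real" where
  "below r h = (SOME s. s \<in> pts \<and> vx s = val (take (nat \<lceil>h\<rceil>) (rw (vx r))) \<and> ht s = h)"

lemma below:
  assumes "r \<in> pts" "0 \<le> h" "h \<le> ht r"
  shows "below r h \<in> pts" "rw (vx (below r h)) = take (nat \<lceil>h\<rceil>) (rw (vx r))" "ht (below r h) = h"
proof -
  note r = pts_cases[OF assms(1)]
  let ?w = "take (nat \<lceil>h\<rceil>) (rw (vx r))"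
  have w: "?w \<in> rwords"
    using rw_rwords[OF r(1)] append_take_drop_id[of "nat \<lceil>h\<rceil>" "rw (vx r)"]
    unfolding rwords_def mem_Collect_eq by (metis le_sup_iff set_append successively_append_iff)
  then have rw: "rw (val ?w) = ?w" by (rule rw_val)
  have l: "len (val ?w) = nat \<lceil>h\<rceil>"
    using r assms unfolding len_def rw by (simp add: len_def)
  have "\<exists>s. s \<in> pts \<and> vx s = val ?w \<and> ht s = h"
  proof -
    have "real (nat \<lceil>h\<rceil>) < h + 1" "h \<le> real (nat \<lceil>h\<rceil>)" using assms by linarith+
    then show ?thesis using pts_ex[of "val ?w" h] w l assms by (auto simp: rwords_def)
  qed
  from someI_ex[OF this, folded below_def]
  show "below r h \<in> pts" "rw (vx (below r h)) = ?w" "ht (below r h) = h" using rw by auto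
qed

lemma mq_below:
  assumes "r \<in> pts" "0 \<le> h" "h \<le> ht r" "s \<in> pts" "0 \<le> k" "k \<le> ht s"
  shows "mq (below r h) (below s k) = min (real (gp (vx r) (vx s))) (min h k)"
proof -
  have "h \<le> real (nat \<lceil>h\<rceil>)" "k \<le> real (nat \<lceil>k\<rceil>)" using assms by linarith+
  then have "min (real (min (min (nat \<lceil>h\<rceil>) (nat \<lceil>k\<rceil>)) n)) (min h k) = min (real n) (min h k)" for n
    unfolding of_nat_min by linarith
  then show ?thesis
    unfolding mq_def gp_def below[OF assms(1-3)] below[OF assms(4-6)] common_prefix_take .
qed

lemma below_top: "r \<in> pts \<Longrightarrow> below r (ht r) = r"
proof -
  assume r: "r \<in> pts"
  note c = pts_cases[OF r]
  have "nat \<lceil>ht r\<rceil> = len (vx r)" using c by linarith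
  then have "rw (vx (below r (ht r))) = rw (vx r)" using below[OF r c(2) order_refl] by (simp add: len_def)
  then have "vx (below r (ht r)) = vx r"
    using val_rw pts_cases(1) below[OF r c(2) order_refl] c(1) by metis
  then show ?thesis using pts_eqI below[OF r c(2) order_refl] r by blast
qed

lemma td_geodesic:
  assumes r: "r \<in> pts" and s: "s \<in> pts"
  shows "\<exists>\<gamma>. geodesic pts td \<gamma> r s"
proof -
  define q where "q = mq r s"
  note c = pts_cases[OF r] pts_cases[OF s]
  have q: "0 \<le> q" "q \<le> ht r" "q \<le> ht s" "q = min (real (gp (vx r) (vx s))) (min (ht r) (ht s))"
    using c unfolding q_def mq_def by auto
  have D: "td r s = ht r + ht s - 2 * q" by (simp add: td_def q_def)
  \<comment> \<open>Down from \<open>r\<close> to the branching height \<open>q\<close>, then up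
    towards \<open>s\<close>.\<close>
  define \<gamma> where "\<gamma> u = (if u \<le> ht r - q then below r (ht r - u) else below s (2 * q - ht r + u))" for u
  have rr: "gp (vx r) (vx r) \<ge> ht r" "gp (vx s) (vx s) \<ge> ht s" using c by auto
  have le: "td (\<gamma> u) (\<gamma> v) = v - u" if "0 \<le> u" "u \<le> v" "v \<le> td r s" for u v
  proof -
    consider "v \<le> ht r - q" | "u > ht r - q" | "u \<le> ht r - q" "v > ht r - q" by linarith
    then show ?thesis
    proof cases
      case 1
      have b: "0 \<le> ht r - u" "ht r - u \<le> ht r" "0 \<le> ht r - v" "ht r - v \<le> ht r" using 1 that q by linarith+
      show ?thesis
        using mq_below[OF r b(1,2) r b(3,4)] below(3)[OF r b(1,2)] below(3)[OF r b(3,4)] 1 that rr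
        unfolding \<gamma>_def td_def by (simp add: min_def)
    next
      case 2
      have b: "0 \<le> 2 * q - ht r + u" "2 * q - ht r + u \<le> ht s" "0 \<le> 2 * q - ht r + v" "2 * q - ht r + v \<le> ht s"
        using 2 that q D by linarith+
      show ?thesis
        using mq_below[OF s b(1,2) s b(3,4)] below(3)[OF s b(1,2)] below(3)[OF s b(3,4)] 2 that rr b
        unfolding \<gamma>_def td_def by (simp add: min_def)
    next
      case 3
      have b: "0 \<le> ht r - u" "ht r - u \<le> ht r" "0 \<le> 2 * q - ht r + v" "2 * q - ht r + v \<le> ht s"
        using 3 that q D by linarith+
      have "min (real (gp (vx r) (vx s))) (min (ht r - u) (2 * q - ht r + v)) = q"
        using 3 that q D b by linarith
      then show ?thesis
        using mq_below[OF r b(1,2) s b(3,4)] below(3)[OF r b(1,2)] below(3)[OF s b(3,4)] 3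
        unfolding \<gamma>_def td_def by simp
    qed
  qed
  have M: "\<gamma> u \<in> pts" if "0 \<le> u" "u \<le> td r s" for u
    using that q(1-3) D below(1)[OF r, of "ht r - u"] below(1)[OF s, of "2 * q - ht r + u"] unfolding \<gamma>_def by auto
  have ends: "\<gamma> 0 = r" using q(2) below_top[OF r] unfolding \<gamma>_def by simp
  have "td r s \<ge> 0" by simp
  then have "td (\<gamma> (td r s)) s = 0"
  proof (cases "td r s \<le> ht r - q")
    case True
    then have "ht s = q" using D q by linarith
    then have b: "0 \<le> ht r - td r s" "ht r - td r s \<le> ht r" "ht r - td r s = q" using q D by linarith+
    have "mq (below r q) (below s (ht s)) = min (real (gp (vx r) (vx s))) (min q (ht s))"
      using mq_below[OF r _ _ s, of q "ht s"] b q by simp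
    also have "\<dots> = q" using q \<open>ht s = q\<close> by linarith
    finally have "mq (below r q) s = q" unfolding below_top[OF s] .
    moreover have "\<gamma> (td r s) = below r q" "ht (below r q) = q"
      using True b(3) below(3)[OF r q(1,2)] by (simp_all add: \<gamma>_def)
    ultimately show ?thesis using \<open>ht s = q\<close> by (simp add: td_def)
  next
    case False
    then show ?thesis using D below_top[OF s] s unfolding \<gamma>_def by (simp add: algebra_simps)
  qed
  then have "\<gamma> (td r s) = s" using td_zero_iff M[of "td r s"] s by simp
  moreover have "td (\<gamma> u) (\<gamma> v) = \<bar>u - v\<bar>" if "u \<in> {0..td r s}" "v \<in> {0..td r s}" for u v
    using le[of u v] le[of v u] that tree.commute[of "\<gamma> u" "\<gamma> v"] by (cases "u \<le> v") auto
  ultimately show ?thesis using M ends unfolding geodesic_def by (intro exI[of _ \<gamma>]) auto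
qed

lemma pts_real_tree: "real_tree pts td"
proof (rule tree.real_treeI[OF _ td_four_point td_geodesic])
  show "pts \<noteq> {}" using encode(1)[of \<one> 0] by auto
qed

section \<open>Points of the tree described by their distances to the vertices\<close>

definition vert :: "'a \<Rightarrow> real" where "vert g = real (idx g)"

lemma vert: "g \<in> carrier F \<Longrightarrow> vert g \<in> pts" "g \<in> carrier F \<Longrightarrow> vx (vert g) = g"
  "g \<in> carrier F \<Longrightarrow> ht (vert g) = len g"
  using encode[of g 0] by (auto simp: vert_def)

lemma td_vert: "v \<in> carrier F \<Longrightarrow> td r (vert v) = ht r + len v - 2 * min (real (gp (vx r) v)) (ht r)"
  using gp_le(2)[of "vx r" v] by (simp add: td_def mq_def vert)

lemma td_vert_vert:
  "g \<in> carrier F \<Longrightarrow> v \<in> carrier F \<Longrightarrow> td (vert g) (vert v) = real (len (inv g \<otimes> v))"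
  using len_inv_mult[of g v] gp_le(1)[of g v] by (simp add: td_vert vert)

text \<open>If \<open>r\<close> does not lie on the path from the root to \<open>s\<close>, the far
  end of the edge of \<open>r\<close> lies behind \<open>r\<close> as seen from \<open>s\<close>. So
  distances to vertices determine points and their distances, which the definition of the action
  uses.\<close>

lemma td_attained:
  assumes "r \<in> pts" "s \<in> pts"
  shows "\<exists>v\<in>carrier F. td r s = \<bar>td r (vert v) - td s (vert v)\<bar>"
proof -
  have *: "\<exists>v\<in>carrier F. td r s = \<bar>td r (vert v) - td s (vert v)\<bar>" if "r \<in> pts" "s \<in> pts" "mq r s < ht r" for r s
  proof (intro bexI)
    note c = pts_cases[OF that(1)]
    show "vx r \<in> carrier F" by (rule c)
    have "mq r s = min (real (gp (vx s) (vx r))) (ht s)"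
      using that(3) gp_commute[of "vx r" "vx s"] unfolding mq_def by linarith
    then show "td r s = \<bar>td r (vert (vx r)) - td s (vert (vx r))\<bar>"
      using c mq_le[of r s] unfolding td_vert[OF c(1)] by (simp add: td_def)
  qed
  consider "mq r s < ht r" | "mq s r < ht s" | "mq r s = ht r" "mq r s = ht s"
    using mq_le[of r s] mq_commute[of r s] by linarith
  then show ?thesis
  proof cases
    case 1 then show ?thesis using * assms by blast
  next
    case 2 then show ?thesis using *[of s r] assms tree.commute[of r s] by (metis abs_minus_commute)
  next
    case 3
    then have "r = s" using td_zero_iff[OF assms] by (simp add: td_def)
    then show ?thesis using assms(1) by auto
  qed
qed

lemma pts_eq_vert:
  assumes "r \<in> pts" "s \<in> pts" "\<And>v. v \<in> carrier F \<Longrightarrow> td r (vert v) = td s (vert v)"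
  shows "r = s"
proof -
  obtain v where v: "v \<in> carrier F" "td r s = \<bar>td r (vert v) - td s (vert v)\<bar>"
    using td_attained[OF assms(1,2)] by blast
  then have "td r s = 0" using assms(3)[OF v(1)] by linarith
  then show ?thesis using td_zero_iff[OF assms(1,2)] by blast
qed

text \<open>The formula with a minimum over both ends of an edge does not refer to the root, so it
  can be translated by the group. The case \<open>t = 0\<close> is separate because that point is a
  vertex encoded under its own index.\<close>

lemma edge_point_child:
  fixes t :: real
  assumes g: "g \<in> carrier F" "z \<in> letters" "rw (g \<otimes> lv z) = rw g @ [z]" and t: "0 \<le> t" "t \<le> 1"
  shows "\<exists>r\<in>pts. \<forall>v\<in>carrier F. td r (vert v) =
    min (t + len (inv g \<otimes> v)) (1 - t + len (inv (g \<otimes> lv z) \<otimes> v))"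
proof -
  define c where "c = g \<otimes> lv z"
  have c: "c \<in> carrier F" "len c = Suc (len g)" using g by (auto simp: c_def len_def)
  have gp: "gp g v = min (len g) (gp c v)" for v
  proof -
    have "rw g = take (len g) (rw c)" "length (rw v) \<ge> gp c v" using g gp_le(2) by (auto simp: c_def len_def)
    then show ?thesis
      using common_prefix_take[of "len g" "rw c" "length (rw v)" "rw v"] unfolding gp_def by (simp add: min_def)
  qed
  show ?thesis
  proof (cases "t = 0")
    case False
    then obtain r where r: "r \<in> pts" "vx r = c" "ht r = len g + t"
      using pts_ex[of c "len g + t"] c t by auto
    have "td r (vert v) = min (t + len (inv g \<otimes> v)) (1 - t + len (inv c \<otimes> v))" if v: "v \<in> carrier F" for v
    proof (cases "gp c v \<le> len g")
      case True
      then have "gp g v = gp c v" using gp by simp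
      then show ?thesis
        using True len_inv_mult[OF g(1) v] len_inv_mult[OF c(1) v] r t c unfolding td_vert[OF v] by simp
    next
      case False
      then have "gp g v = len g" "gp c v = len c" using gp gp_le(1)[of c v] c by auto
      then show ?thesis
        using len_inv_mult[OF g(1) v] len_inv_mult[OF c(1) v] r t c unfolding td_vert[OF v] by simp
    qed
    then show ?thesis using r unfolding c_def by blast
  next
    case True
    have "td (vert g) (vert v) = min (len (inv g \<otimes> v)) (1 + len (inv c \<otimes> v))" if v: "v \<in> carrier F" for v
      using len_inv_mult[OF g(1) v] len_inv_mult[OF c(1) v] gp[of v] gp_le(1)[of c v] c
      unfolding td_vert_vert[OF g(1) v] by (cases "gp c v \<le> len g") auto
    then show ?thesis using True vert(1)[OF g(1)] unfolding c_def by (intro bexI[of _ "vert g"]) auto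
  qed
qed

lemma rw_snoc:
  assumes g: "g \<in> carrier F" "z \<in> letters"
  shows "rw (g \<otimes> lv z) = rw g @ [z] \<or> rw g = rw (g \<otimes> lv z) @ [linv z]"
proof -
  have "rw (g \<otimes> lv z) = rev (map linv (rw (inv (g \<otimes> lv z))))"
    using g rw_inv[of "inv (g \<otimes> lv z)"] by simp
  also have "inv (g \<otimes> lv z) = lv (linv z) \<otimes> inv g" using g by (simp add: inv_mult_group lv_linv)
  also have "rw \<dots> = rcons (linv z) (rev (map linv (rw g)))" using g by (simp add: rw_mult rw_inv)
  finally have r: "rw (g \<otimes> lv z) = rev (map linv (rcons (linv z) (rev (map linv (rw g)))))" .
  have [simp]: "map (linv \<circ> linv) xs = xs" for xs :: "('a \<times> bool) list" by (induction xs) auto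
  show ?thesis
  proof (cases "rw g" rule: rev_cases)
    case Nil then show ?thesis using r by (simp add: rcons_def)
  next
    case (snoc w y)
    then show ?thesis using r by (auto simp: rcons_def rev_map)
  qed
qed

text \<open>An edge may also lead towards the root; reversing it exchanges its ends and replaces
  \<open>t\<close> by \<open>1 - t\<close>.\<close>

lemma edge_point:
  fixes t :: real
  assumes g: "g \<in> carrier F" "z \<in> letters" and t: "0 \<le> t" "t \<le> 1"
  shows "\<exists>r\<in>pts. \<forall>v\<in>carrier F. td r (vert v) =
    min (t + len (inv g \<otimes> v)) (1 - t + len (inv (g \<otimes> lv z) \<otimes> v))"
  using rw_snoc[OF g]
proof
  assume "rw (g \<otimes> lv z) = rw g @ [z]"
  then show ?thesis using edge_point_child assms by blast
next
  assume *: "rw g = rw (g \<otimes> lv z) @ [linv z]"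
  have e: "g \<otimes> lv z \<otimes> lv (linv z) = g" using g by (simp add: m_assoc lv_linv)
  then have "rw (g \<otimes> lv z \<otimes> lv (linv z)) = rw (g \<otimes> lv z) @ [linv z]" using * by simp
  from edge_point_child[OF _ _ this, of "1 - t"] show ?thesis
    using g t unfolding e by (simp add: min.commute)
qed

lemma point_on_edge:
  assumes r: "r \<in> pts"
  shows "\<exists>g\<in>carrier F. \<exists>z\<in>letters. \<exists>t::real. 0 \<le> t \<and> t \<le> 1 \<and> (\<forall>v\<in>carrier F. td r (vert v) =
    min (t + len (inv g \<otimes> v)) (1 - t + len (inv (g \<otimes> lv z) \<otimes> v)))"
proof -
  note c = pts_cases[OF r]
  show ?thesis
  proof (cases "rw (vx r)" rule: rev_cases)
    case Nil
    then have "vx r = \<one>" "ht r = 0" using c val_rw[OF c(1)] by (auto simp: len_def)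
    then have "r = vert \<one>" using pts_eqI[OF r vert(1)] by (simp add: vert)
    \<comment> \<open>The root has no edge below it, so a basis element provides one that starts
      there.\<close>
    obtain x where x: "x \<in> X" using nonempty by auto
    then have z: "(x, True) \<in> letters" by (simp add: letters_def)
    have "td r (vert v) = min (0 + len (inv \<one> \<otimes> v)) (1 - 0 + len (inv (\<one> \<otimes> lv (x, True)) \<otimes> v))" if "v \<in> carrier F" for v
    proof -
      have "len v \<le> Suc (len (inv (lv (x, True)) \<otimes> v))"
        using len_mult_letter[OF z, of "inv (lv (x, True)) \<otimes> v"] inv_cancel(2)[of "lv (x, True)" v] that z by simp
      then show ?thesis using td_vert_vert[of \<one> v] that z \<open>r = vert \<one>\<close> by simp
    qed
    then show ?thesis using z by (intro bexI[of _ \<one>] bexI[of _ "(x, True)"] exI[of _ 0]) auto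
  next
    case (snoc w z)
    have wz: "w @ [z] \<in> rwords" using rw_rwords[OF c(1)] snoc by simp
    then have w: "w \<in> rwords" "z \<in> letters" by (auto simp: rwords_def successively_append_iff)
    have g: "val w \<in> carrier F" "rw (val w) = w" using w rw_val by (auto simp: rwords_def)
    have "val w \<otimes> lv z = vx r"
      using val_append[of w "[z]"] w val_rw[OF c(1)] snoc by (simp add: rwords_def)
    then have e: "rw (val w \<otimes> lv z) = rw (val w) @ [z]" using snoc g by simp
    define t where "t = ht r - real (length w)"
    have t: "0 \<le> t" "t \<le> 1" "t > 0" using c snoc by (auto simp: t_def len_def)
    obtain s where s: "s \<in> pts" "\<forall>v\<in>carrier F. td s (vert v) =
        min (t + len (inv (val w) \<otimes> v)) (1 - t + len (inv (val w \<otimes> lv z) \<otimes> v))"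
      using edge_point_child[OF g(1) w(2) e t(1,2)] by blast
    have "td r (vert v) = td s (vert v)" if v: "v \<in> carrier F" for v
    proof -
      have gp: "gp (val w) v = min (length w) (gp (vx r) v)"
      proof -
        have "rw (val w) = take (length w) (rw (vx r))" "length (rw v) \<ge> gp (vx r) v"
          using snoc g gp_le(2)[of "vx r" v] by (auto simp: len_def)
        then show ?thesis
          using common_prefix_take[of "length w" "rw (vx r)" "length (rw v)" "rw v"] unfolding gp_def by (simp add: min_def)
      qed
      have l: "len (vx r) = Suc (length w)" "len (val w) = length w" using snoc g by (auto simp: len_def)
      show ?thesis
        using s(2)[rule_format, OF v] gp l len_inv_mult[OF g(1) v] len_inv_mult[OF c(1) v] t gp_le(1)[of "vx r" v]
        unfolding td_vert[OF v] \<open>val w \<otimes> lv z = vx r\<close> t_def by (cases "gp (vx r) v \<le> length w") (simp; linarith)+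
    qed
    then show ?thesis using s t g w by (intro bexI[of _ "val w"] bexI[of _ z] exI[of _ t]) simp_all
  qed
qed

end

section \<open>The action of the group on its Cayley tree\<close>

context free_gp_fin
begin

text \<open>The encoding of points refers to the root, which translations move. The image is
  therefore specified through its distances to all vertices, and these determine it
  uniquely.\<close>

definition tact :: "'a \<Rightarrow> real \<Rightarrow> real" where
  "tact f = (\<lambda>r\<in>pts. THE s. s \<in> pts \<and> (\<forall>v\<in>carrier F. td s (vert v) = td r (vert (inv f \<otimes> v))))"

lemma tact:
  assumes f: "f \<in> carrier F" and r: "r \<in> pts"
  shows "tact f r \<in> pts" "\<And>v. v \<in> carrier F \<Longrightarrow> td (tact f r) (vert v) = td r (vert (inv f \<otimes> v))"
proof -
  obtain g z and t :: real where g: "g \<in> carrier F" "z \<in> letters" "0 \<le> t" "t \<le> 1" and rr: "\<forall>v\<in>carrier F. td r (vert v) =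
    min (t + len (inv g \<otimes> v)) (1 - t + len (inv (g \<otimes> lv z) \<otimes> v))"
    using point_on_edge[OF r] by blast
  obtain s where s: "s \<in> pts" "\<forall>v\<in>carrier F. td s (vert v) =
    min (t + len (inv (f \<otimes> g) \<otimes> v)) (1 - t + len (inv (f \<otimes> g \<otimes> lv z) \<otimes> v))"
    using edge_point[of "f \<otimes> g" z t] f g by auto
  have "\<exists>!s. s \<in> pts \<and> (\<forall>v\<in>carrier F. td s (vert v) = td r (vert (inv f \<otimes> v)))"
  proof (rule ex1I[of _ s])
    show "s \<in> pts \<and> (\<forall>v\<in>carrier F. td s (vert v) = td r (vert (inv f \<otimes> v)))"
      using s rr f g by (simp add: inv_mult_group m_assoc)
    then show "s' = s" if "s' \<in> pts \<and> (\<forall>v\<in>carrier F. td s' (vert v) = td r (vert (inv f \<otimes> v)))" for s'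
      using that pts_eq_vert[of s' s] by simp
  qed
  from theI'[OF this] show "tact f r \<in> pts" "\<And>v. v \<in> carrier F \<Longrightarrow> td (tact f r) (vert v) = td r (vert (inv f \<otimes> v))"
    using r by (auto simp: tact_def)
qed

lemma tact_mult:
  assumes "f \<in> carrier F" "g \<in> carrier F" "r \<in> pts"
  shows "tact (f \<otimes> g) r = tact f (tact g r)"
  by (rule pts_eq_vert) (use assms in \<open>auto simp: tact inv_mult_group m_assoc\<close>)

lemma tact_one: "r \<in> pts \<Longrightarrow> tact \<one> r = r"
  by (rule pts_eq_vert) (auto simp: tact)

lemma tact_vert: "f \<in> carrier F \<Longrightarrow> g \<in> carrier F \<Longrightarrow> tact f (vert g) = vert (f \<otimes> g)"
  by (rule pts_eq_vert) (auto simp: tact vert td_vert_vert inv_mult_group m_assoc)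

text \<open>Distances are detected by vertices, and the action permutes the vertices; this gives one
  inequality, and the inverse element gives the other.\<close>

lemma tact_isometry:
  assumes f: "f \<in> carrier F" and r: "r \<in> pts" "s \<in> pts"
  shows "td (tact f r) (tact f s) = td r s"
proof -
  have le: "td (tact f r) (tact f s) \<le> td r s" if fr: "f \<in> carrier F" "r \<in> pts" "s \<in> pts" for f r s
  proof -
    obtain v where v: "v \<in> carrier F"
      "td (tact f r) (tact f s) = \<bar>td (tact f r) (vert v) - td (tact f s) (vert v)\<bar>"
      using td_attained[OF tact(1)[OF fr(1,2)] tact(1)[OF fr(1,3)]] by blast
    define u where "u = vert (inv f \<otimes> v)"
    have u: "u \<in> pts" using vert(1) fr v by (simp add: u_def)
    have "td (tact f r) (tact f s) = \<bar>td r u - td s u\<bar>" using v tact fr unfolding u_def by simp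
    then show ?thesis
      using tree.triangle[of r s u] tree.triangle[of s r u] u fr tree.commute[of r s] by linarith
  qed
  have "tact (inv f) (tact f r) = r" if "r \<in> pts" for r
    using tact_mult[of "inv f" f r] f that tact_one by simp
  then have "td r s \<le> td (tact f r) (tact f s)"
    using le[of "inv f" "tact f r" "tact f s"] f r tact by simp
  then show ?thesis using le[OF f r] by simp
qed

lemma tact_group_action: "group_action F pts tact"
proof -
  have cancel: "tact (inv f) (tact f r) = r" "tact f (tact (inv f) r) = r" if "f \<in> carrier F" "r \<in> pts" for f r
    using tact_mult[of "inv f" f r] tact_mult[of f "inv f" r] that tact_one by simp_all
  have B: "tact f \<in> Bij pts" if "f \<in> carrier F" for f
  proof -
    have "bij_betw (tact f) pts pts"
      by (rule bij_betw_byWitness[where f' = "tact (inv f)"]) (use that cancel tact in auto)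
    then show ?thesis by (simp add: Bij_def tact_def)
  qed
  have "tact \<in> hom F (BijGroup pts)"
  proof (rule homI)
    fix f g assume fg: "f \<in> carrier F" "g \<in> carrier F"
    have "tact (f \<otimes> g) = compose pts (tact f) (tact g)"
    proof
      fix r show "tact (f \<otimes> g) r = compose pts (tact f) (tact g) r"
        using tact_mult[OF fg] by (cases "r \<in> pts") (auto simp: compose_def tact_def)
    qed
    then show "tact (f \<otimes> g) = tact f \<otimes>\<^bsub>BijGroup pts\<^esub> tact g" using B fg by (simp add: BijGroup_def)
  qed (simp add: BijGroup_def B)
  then show ?thesis
    unfolding group_action_def group_hom_def group_hom_axioms_def using group_BijGroup is_group by blast
qed

text \<open>Reading the translation length at the vertex of the identity gives
  \<open>len (f \<otimes> f) - len f\<close>, a positive integer. The uniform bound yields freeness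
  and discreteness together.\<close>

lemma tact_displacement:
  assumes f: "f \<in> carrier F" "f \<noteq> \<one>" and r: "r \<in> pts"
  shows "1 \<le> td r (tact f r)"
proof -
  have 1: "tact f (vert \<one>) = vert f" "tact f (vert f) = vert (f \<otimes> f)" using tact_vert f by auto
  have 2: "td (vert \<one>) (vert f) = len f" "td (vert \<one>) (vert (f \<otimes> f)) = len (f \<otimes> f)"
    using td_vert_vert[of \<one>] f by auto
  have "td (vert \<one>) (tact f (tact f (vert \<one>))) - td (vert \<one>) (tact f (vert \<one>)) \<le> td r (tact f r)"
    by (rule tree.displacement_ge[where f = "tact f", OF td_four_point])
      (use f r len_square[OF f] in \<open>auto simp: tact vert tact_isometry 1 2\<close>)
  then show ?thesis using len_square[OF f] unfolding 1 2 by linarith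
qed

text \<open>Each point \<open>r\<close> lies on an edge labelled \<open>z\<close>, hence between two
  vertices far out on a translate of the axis of \<open>z\<close>. An invariant set contains points
  at bounded distance from every vertex, and those near the two ends still have \<open>r\<close>
  between them, so connectedness puts \<open>r\<close> in the set.\<close>

lemma tact_minimal: "minimal_action F pts td tact"
  unfolding minimal_action_def
proof (intro allI impI, elim conjE)
  fix S assume S: "S \<noteq> {}" "connectedin tree.mtopology S" "\<forall>g\<in>carrier F. tact g ` S \<subseteq> S"
  have SM: "S \<subseteq> pts" using S connectedin_subset_topspace by fastforce
  obtain x where x: "x \<in> S" using S by auto
  then have xM: "x \<in> pts" using SM by auto
  have "r \<in> S" if r: "r \<in> pts" for r
  proof -
    obtain g z and t :: real where g: "g \<in> carrier F" "z \<in> letters" "0 \<le> t" "t \<le> 1" and rr: "\<forall>v\<in>carrier F. td r (vert v) =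
      min (t + len (inv g \<otimes> v)) (1 - t + len (inv (g \<otimes> lv z) \<otimes> v))"
      using point_on_edge[OF r] by blast
    \<comment> \<open>\<open>N\<close> bounds the distance between each vertex and the corresponding
      translate of \<open>x\<close>.\<close>
    obtain N :: nat where N: "real N > td x (vert \<one>)" using reals_Archimedean2 by blast
    have len: "len (lv y [^] n) = n" if "y \<in> letters" for y and n :: nat
    proof -
      have "val (replicate n y) = lv y [^] n"
        using that by (induction n) (auto simp: nat_pow_Suc2[symmetric] simp del: nat_pow_Suc)
      moreover have "replicate n y \<in> rwords" using that by (auto simp: rwords_def successively_conv_nth)
      ultimately show ?thesis using rw_val[of "replicate n y"] by (simp add: len_def)
    qed
    \<comment> \<open>These vertices lie \<open>N\<close> steps beyond either end of the edge from
      \<open>g\<close> to \<open>g \<otimes> lv z\<close>.\<close>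
    define a b where "a = g \<otimes> lv z [^] Suc N" and "b = g \<otimes> lv (linv z) [^] N"
    have ab: "a \<in> carrier F" "b \<in> carrier F" using g by (auto simp: a_def b_def)
    have i: "inv g \<otimes> a = lv z [^] Suc N" "inv g \<otimes> b = lv (linv z) [^] N"
      using g by (simp_all add: a_def b_def inv_cancel del: nat_pow_Suc)
    have iz: "inv (g \<otimes> lv z) \<otimes> a = lv z [^] N" "inv (g \<otimes> lv z) \<otimes> b = lv (linv z) [^] Suc N"
    proof -
      have st: "inv (g \<otimes> lv z) \<otimes> h = lv (linv z) \<otimes> (inv g \<otimes> h)" if "h \<in> carrier F" for h
        using g that by (simp add: inv_mult_group m_assoc lv_linv)
      then show "inv (g \<otimes> lv z) \<otimes> a = lv z [^] N" "inv (g \<otimes> lv z) \<otimes> b = lv (linv z) [^] Suc N"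
        using st[OF ab(1)] st[OF ab(2)] g
        unfolding i nat_pow_Suc2[OF lv_closed[OF g(2)]] nat_pow_Suc2[OF lv_closed[of "linv z", unfolded linv_letters, OF g(2)]]
        by simp_all
    qed
    have da: "td r (vert a) = real N + 1 - t" "td r (vert b) = real N + t"
      using rr[rule_format, OF ab(1)] rr[rule_format, OF ab(2)] g
        len[OF g(2), of "Suc N"] len[OF g(2), of N] len[of "linv z" N] len[of "linv z" "Suc N"]
      unfolding i iz by (simp_all del: nat_pow_Suc)
    have "inv a \<otimes> b = lv (linv z) [^] (Suc N + N)"
    proof -
      have "inv (g \<otimes> lv z [^] n) = lv (linv z) [^] n \<otimes> inv g" for n :: nat
        using g by (simp add: inv_mult_group lv_linv nat_pow_inv)
      then have "inv a \<otimes> b = lv (linv z) [^] Suc N \<otimes> (inv g \<otimes> b)"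
        unfolding a_def using g ab by (simp only: m_assoc nat_pow_closed lv_closed linv_letters inv_closed)
      then show ?thesis unfolding i using g by (simp only: nat_pow_mult lv_closed linv_letters)
    qed
    then have dab: "td (vert a) (vert b) = 2 * real N + 1"
      using len[of "linv z" "Suc N + N"] g ab by (simp add: td_vert_vert)
    have xs: "tact a x \<in> S" "tact b x \<in> S" using S x ab by auto
    have near: "td (vert f) (tact f x) < real N" if "f \<in> carrier F" for f
      using tact_isometry[OF that vert(1) xM, of \<one>] tact_vert[OF that, of \<one>] that N tree.commute by simp
    have P: "vert a \<in> pts" "vert b \<in> pts" "tact a x \<in> pts" "tact b x \<in> pts"
      using vert(1) ab tact xM by auto
    have "td (tact a x) r + td r (vert b) = td (tact a x) (vert b)"
      by (rule tree.between_shift[OF td_four_point P(1) P(2) P(3) r])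
        (use da dab near[OF ab(1)] g tree.commute in auto)
    then have "td (tact b x) r + td r (tact a x) = td (tact b x) (tact a x)"
      by (intro tree.between_shift[OF td_four_point P(2) P(3) P(4) r])
        (use da near[OF ab(2)] g tree.commute in auto)
    then show "r \<in> S"
      using tree.between_in_connected[OF td_four_point S(2) xs(2,1) r] by simp
  qed
  then show "S = pts" using SM by blast
qed

lemma cayley_outer_space_tree: "outer_space_tree F pts td tact"
  unfolding outer_space_tree_def
proof (intro conjI)
  show "isometric_action F pts td tact"
    unfolding isometric_action_def using tact_group_action tact_isometry by blast
  show "free_action F pts tact"
    unfolding free_action_def stabilizer_def using tact_displacement tact_one by force
  show "discrete_action F pts td tact"
    unfolding discrete_action_def
  proof (intro ballI)
    fix x assume x: "x \<in> pts"
    let ?O = "orbit F tact x"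
    have O: "?O \<subseteq> pts" using tact x by (auto simp: orbit_def)
    have "openin (subtopology tree.mtopology ?O) {y}" if y: "y \<in> ?O" for y
    proof -
      have "z = y" if z: "z \<in> ?O" "td y z < 1" for z
      proof -
        obtain f g where fg: "f \<in> carrier F" "g \<in> carrier F" "y = tact f x" "z = tact g x"
          using y z unfolding orbit_def by auto
        then have "z = tact (g \<otimes> inv f) y"
          using tact_mult[of "g \<otimes> inv f" f x] x by (simp add: m_assoc)
        then show ?thesis
          using tact_displacement[of "g \<otimes> inv f" y] z fg O y tact_one by (cases "g \<otimes> inv f = \<one>") force+
      qed
      then have "{y} = tree.mball y 1 \<inter> ?O" using y O by auto
      then show ?thesis unfolding openin_subtopology using tree.openin_mball by blast
    qed
    then show "subtopology tree.mtopology ?O = discrete_topology ?O"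
      using O discrete_topology_unique[of ?O "subtopology tree.mtopology ?O"] by (simp add: inf.absorb2)
  qed
qed (use pts_real_tree tact_minimal in auto)

text \<open>The vertex of the identity gives the translation length as a difference; its positive
  part is the difference itself because passing to the square never shortens a word.\<close>

lemma cv_twisted_length:
  assumes \<phi>: "\<phi> \<in> auto F"
  shows "(\<lambda>g\<in>carrier F. real (len (\<phi> (g \<otimes> g))) - real (len (\<phi> g))) \<in> cv F"
proof -
  have hom: "\<phi> \<in> hom F F" using \<phi> by (simp add: auto_def)
  have "length_function F pts td (\<lambda>g. tact (\<phi> g)) g = real (len (\<phi> (g \<otimes> g))) - real (len (\<phi> g))"
    if g: "g \<in> carrier F" for g
  proof -
    have f: "\<phi> g \<in> carrier F" "\<phi> (g \<otimes> g) = \<phi> g \<otimes> \<phi> g" using hom g by (auto simp: hom_def)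
    have 1: "tact (\<phi> g) (vert \<one>) = vert (\<phi> g)" "tact (\<phi> g) (vert (\<phi> g)) = vert (\<phi> g \<otimes> \<phi> g)" using tact_vert f by auto
    have 2: "td (vert \<one>) (vert (\<phi> g)) = len (\<phi> g)" "td (vert \<one>) (vert (\<phi> g \<otimes> \<phi> g)) = len (\<phi> g \<otimes> \<phi> g)"
      using td_vert_vert[of \<one>] f by auto
    obtain \<gamma> where \<gamma>: "geodesic pts td \<gamma> (vert \<one>) (tact (\<phi> g) (vert \<one>))"
      using td_geodesic[of "vert \<one>" "vert (\<phi> g)"] vert(1) f 1 by auto
    have "(INF x\<in>pts. td x (tact (\<phi> g) x)) = max 0 (real (len (\<phi> g \<otimes> \<phi> g)) - len (\<phi> g))"
      using tree.translation_length[OF td_four_point tact(1) tact_isometry vert(1)[OF one_closed] \<gamma>] f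
      unfolding 1 2 by simp
    also have "\<dots> = real (len (\<phi> g \<otimes> \<phi> g)) - len (\<phi> g)"
      using len_square[OF f(1)] by (cases "\<phi> g = \<one>") auto
    finally show ?thesis using g f by (simp add: length_function_def)
  qed
  then have "(\<lambda>g\<in>carrier F. real (len (\<phi> (g \<otimes> g))) - real (len (\<phi> g))) =
      length_function F pts td (\<lambda>g. tact (\<phi> g))"
    by (auto simp: length_function_def fun_eq_iff)
  then show ?thesis
    unfolding cv_def using outer_space_tree_twist[OF cayley_outer_space_tree \<phi>] by blast
qed

end

section \<open>The boundary of a free group\<close>

context free_gp_fin
begin

abbreviation seqs :: "(nat \<Rightarrow> 'a) set" where "seqs \<equiv> gromov_sequences F X"
abbreviation bdry :: "'a bpoint set" where "bdry \<equiv> boundary F X"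

lemma gromov_equiv_iff:
  assumes "range u \<subseteq> carrier F" "range v \<subseteq> carrier F"
  shows "gromov_equiv F X u v \<longleftrightarrow> (\<forall>N. \<exists>K. \<forall>i\<ge>K. \<forall>j\<ge>K. N \<le> gp (u i) (v j))"
proof -
  have g: "gromov_product F X (u i) (v j) = real (gp (u i) (v j))" for i j
    using assms by (intro gromov_product_eq) auto
  have "gromov_equiv F X u v \<longleftrightarrow> (\<forall>Z. \<exists>K. \<forall>j\<ge>K. \<forall>i\<ge>K. Z \<le> real (gp (u i) (v j)))"
    unfolding gromov_equiv_def filterlim_at_top eventually_prod_sequentially by (simp add: g)
  also have "\<dots> \<longleftrightarrow> (\<forall>N. \<exists>K. \<forall>i\<ge>K. \<forall>j\<ge>K. N \<le> gp (u i) (v j))"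
  proof (intro iffI allI)
    fix N :: nat assume "\<forall>Z. \<exists>K. \<forall>j\<ge>K. \<forall>i\<ge>K. Z \<le> real (gp (u i) (v j))"
    then obtain K where "\<forall>j\<ge>K. \<forall>i\<ge>K. real N \<le> real (gp (u i) (v j))" by blast
    then show "\<exists>K. \<forall>i\<ge>K. \<forall>j\<ge>K. N \<le> gp (u i) (v j)" by (intro exI[of _ K]) auto
  next
    fix Z :: real assume *: "\<forall>N. \<exists>K. \<forall>i\<ge>K. \<forall>j\<ge>K. N \<le> gp (u i) (v j)"
    obtain N :: nat where N: "Z \<le> real N" using real_arch_simple by blast
    obtain K where "\<forall>i\<ge>K. \<forall>j\<ge>K. N \<le> gp (u i) (v j)" using * by blast
    then show "\<exists>K. \<forall>j\<ge>K. \<forall>i\<ge>K. Z \<le> real (gp (u i) (v j))"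
      using N by (intro exI[of _ K]) (meson of_nat_le_iff order_trans)
  qed
  finally show ?thesis .
qed

lemma seqs_carrier: "u \<in> seqs \<Longrightarrow> u i \<in> carrier F"
  unfolding gromov_sequences_def by auto

lemma seqs_iff: "u \<in> seqs \<longleftrightarrow> range u \<subseteq> carrier F \<and> (\<forall>N. \<exists>K. \<forall>i\<ge>K. \<forall>j\<ge>K. N \<le> gp (u i) (u j))"
  using gromov_equiv_iff[of u u] unfolding gromov_sequences_def by auto

text \<open>Prefixes \<open>w\<close> of the infinite reduced word to which a Gromov sequence
  converges.\<close>

definition evp :: "('a \<times> bool) list \<Rightarrow> (nat \<Rightarrow> 'a) \<Rightarrow> bool" where
  "evp w u \<longleftrightarrow> (\<forall>\<^sub>F i in sequentially. take (length w) (rw (u i)) = w)"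

lemma evp_ex:
  assumes "u \<in> seqs" shows "\<exists>w. length w = n \<and> evp w u"
proof -
  obtain K where K: "\<And>i j. i \<ge> K \<Longrightarrow> j \<ge> K \<Longrightarrow> n \<le> gp (u i) (u j)"
    using assms seqs_iff by metis
  let ?w = "take n (rw (u K))"
  have len: "length ?w = n" using K[of K K] by (simp add: len_def)
  have pre: "take n (rw (u i)) = ?w" if "i \<ge> K" for i
    using K[OF order_refl that] unfolding gp_def le_common_prefix_iff by simp
  have "evp ?w u"
    unfolding evp_def len eventually_sequentially by (rule exI[of _ K], intro allI impI, rule pre)
  then show ?thesis using len by blast
qed

lemma evp_unique: "evp w u \<Longrightarrow> evp w' u \<Longrightarrow> length w = length w' \<Longrightarrow> w = w'"
  unfolding evp_def using eventually_happens'[OF sequentially_bot eventually_conj] by force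

lemma evp_take: "evp w u \<Longrightarrow> evp (take n w) u"
  unfolding evp_def
proof (elim eventually_mono)
  fix i assume w: "take (length w) (rw (u i)) = w"
  have "take (length (take n w)) (rw (u i)) = take n (take (length w) (rw (u i)))"
    by (simp add: min.commute)
  then show "take (length (take n w)) (rw (u i)) = take n w" unfolding w .
qed

text \<open>Since Gromov products are common prefix lengths, equivalence means having the same
  infinite limit word, and boundary points can be handled through finite prefixes. An implication in
  one direction suffices, as each sequence has exactly one prefix of every length.\<close>

lemma gromov_equiv_evp:
  assumes u: "u \<in> seqs" and v: "v \<in> seqs"
  shows "gromov_equiv F X u v \<longleftrightarrow> (\<forall>w. evp w u \<longrightarrow> evp w v)"
proof -
  have r: "range u \<subseteq> carrier F" "range v \<subseteq> carrier F" using u v seqs_iff by auto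
  show ?thesis
    unfolding gromov_equiv_iff[OF r]
  proof (intro iffI allI impI)
    fix w assume *: "\<forall>N. \<exists>K. \<forall>i\<ge>K. \<forall>j\<ge>K. N \<le> gp (u i) (v j)" and "evp w u"
    obtain K where K: "\<forall>i\<ge>K. \<forall>j\<ge>K. length w \<le> gp (u i) (v j)" using * by blast
    obtain L where L: "\<forall>i\<ge>L. take (length w) (rw (u i)) = w"
      using \<open>evp w u\<close> unfolding evp_def eventually_sequentially by blast
    have "take (length w) (rw (v j)) = w" if "j \<ge> K" for j
    proof -
      have "length w \<le> common_prefix (rw (u (max K L))) (rw (v j))" using K that unfolding gp_def by simp
      then show ?thesis using L le_common_prefix_iff[of "length w"] by (metis max.cobounded2)
    qed
    then show "evp w v" unfolding evp_def eventually_sequentially by blast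
  next
    fix N assume *: "\<forall>w. evp w u \<longrightarrow> evp w v"
    obtain w where w: "length w = N" "evp w u" using evp_ex[OF u] by blast
    then have "evp w v" using * by blast
    then obtain K L where K: "\<forall>i\<ge>K. take N (rw (u i)) = w" "\<forall>i\<ge>L. take N (rw (v i)) = w"
      using w unfolding evp_def eventually_sequentially by blast
    have "N \<le> gp (u i) (v j)" if "i \<ge> max K L" "j \<ge> max K L" for i j
    proof -
      have "take N (rw (u i)) = w" "take N (rw (v j)) = w" using K that by auto
      then show ?thesis using w(1) unfolding gp_def le_common_prefix_iff by (metis length_take min.absorb_iff2 nat_le_linear min_def)
    qed
    then show "\<exists>K. \<forall>i\<ge>K. \<forall>j\<ge>K. N \<le> gp (u i) (v j)" by blast
  qed
qed

lemma gromov_equiv_evp_iff: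
  assumes u: "u \<in> seqs" and v: "v \<in> seqs"
  shows "gromov_equiv F X u v \<longleftrightarrow> (\<forall>w. evp w u \<longleftrightarrow> evp w v)"
proof
  assume *: "gromov_equiv F X u v"
  have "evp w u" if "evp w v" for w
  proof -
    obtain w' where w': "length w' = length w" "evp w' u" using evp_ex[OF u] by blast
    then have "evp w' v" using * gromov_equiv_evp[OF u v] by blast
    then show ?thesis using evp_unique[OF that] w' by metis
  qed
  then show "\<forall>w. evp w u \<longleftrightarrow> evp w v" using * gromov_equiv_evp[OF u v] by blast
qed (use gromov_equiv_evp[OF u v] in blast)

definition cls :: "(nat \<Rightarrow> 'a) \<Rightarrow> 'a bpoint" where
  "cls u = {v \<in> seqs. \<forall>w. evp w u \<longleftrightarrow> evp w v}"

lemma bdry_eq: "bdry = cls ` seqs"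
proof -
  have "{(u, v). u \<in> seqs \<and> v \<in> seqs \<and> gromov_equiv F X u v} `` {u} = cls u" if "u \<in> seqs" for u
    using that gromov_equiv_evp_iff[OF that] unfolding cls_def by auto
  then show ?thesis unfolding boundary_def quotient_def by (auto simp: image_def)
qed

lemma cls_self: "u \<in> seqs \<Longrightarrow> u \<in> cls u"
  by (simp add: cls_def)

lemma cls_eqI: "(\<And>w. evp w u \<longleftrightarrow> evp w v) \<Longrightarrow> cls u = cls v"
  by (simp add: cls_def)

lemma bdry_mem: "p \<in> bdry \<Longrightarrow> u \<in> p \<Longrightarrow> u \<in> seqs \<and> p = cls u"
  unfolding bdry_eq cls_def by fastforce

lemma bdry_ex: "p \<in> bdry \<Longrightarrow> \<exists>u. u \<in> p \<and> u \<in> seqs \<and> p = cls u"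
  unfolding bdry_eq using cls_self by blast

text \<open>A basic clopen set of ends. It is empty when \<open>w\<close> is not reduced.\<close>

definition cyl :: "('a \<times> bool) list \<Rightarrow> 'a bpoint set" where
  "cyl w = {p \<in> bdry. \<forall>u\<in>p. evp w u}"

lemma cls_cyl: "u \<in> seqs \<Longrightarrow> cls u \<in> cyl w \<longleftrightarrow> evp w u"
  unfolding cyl_def bdry_eq cls_def by auto

lemma cyl_bdry: "p \<in> cyl w \<Longrightarrow> p \<in> bdry"
  by (simp add: cyl_def)

lemma cyl_evp: "p \<in> cyl w \<Longrightarrow> u \<in> p \<Longrightarrow> evp w u"
  by (simp add: cyl_def)

lemma cylI: "p \<in> bdry \<Longrightarrow> u \<in> p \<Longrightarrow> evp w u \<Longrightarrow> p \<in> cyl w"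
  using bdry_mem[of p u] cls_cyl by auto

lemma cyl_Nil [simp]: "cyl [] = bdry"
  by (auto simp: cyl_def evp_def)

lemma cyl_ex: "p \<in> bdry \<Longrightarrow> \<exists>w. length w = n \<and> p \<in> cyl w"
  using bdry_ex[of p] evp_ex[of _ n] cls_cyl by metis

lemma cyl_unique: "p \<in> cyl w \<Longrightarrow> p \<in> cyl w' \<Longrightarrow> length w = length w' \<Longrightarrow> w = w'"
  using bdry_ex[of p] cyl_evp[of p] evp_unique cyl_bdry by metis

lemma bdry_eqI:
  assumes "p \<in> bdry" "q \<in> bdry" "\<And>w. p \<in> cyl w \<Longrightarrow> q \<in> cyl w"
  shows "p = q"
proof -
  have "q \<in> cyl w \<Longrightarrow> p \<in> cyl w" for w
  proof -
    assume q: "q \<in> cyl w"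
    obtain w' where w': "length w' = length w" "p \<in> cyl w'" using cyl_ex[OF assms(1), of "length w"] by blast
    then have "w' = w" using cyl_unique[OF assms(3)[OF w'(2)] q] by simp
    then show "p \<in> cyl w" using w' by simp
  qed
  then have "p \<in> cyl w \<longleftrightarrow> q \<in> cyl w" for w using assms(3) by blast
  moreover obtain u v where uv: "u \<in> seqs" "p = cls u" "v \<in> seqs" "q = cls v"
    using bdry_ex[OF assms(1)] bdry_ex[OF assms(2)] by blast
  ultimately show ?thesis unfolding uv using cls_cyl[OF uv(1)] cls_cyl[OF uv(3)] cls_eqI[of u v] by blast
qed

lemma cyl_take: "p \<in> cyl w \<Longrightarrow> p \<in> cyl (take n w)"
  unfolding cyl_def using evp_take by auto

lemma cyl_append: "p \<in> cyl (w @ v) \<Longrightarrow> p \<in> cyl w"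
  using cyl_take[of p "w @ v" "length w"] by simp

lemma rwords_append: "u @ v \<in> rwords \<Longrightarrow> u \<in> rwords \<and> v \<in> rwords"
  by (auto simp: rwords_def successively_append_iff)

lemma cyl_rwords: "p \<in> cyl w \<Longrightarrow> w \<in> rwords"
proof -
  assume p: "p \<in> cyl w"
  then obtain u where u: "u \<in> p" "u \<in> seqs" using bdry_ex cyl_bdry by blast
  then have "evp w u" using p cyl_evp by blast
  then obtain i where "take (length w) (rw (u i)) = w"
    unfolding evp_def using eventually_happens'[OF sequentially_bot] by blast
  then have "w @ drop (length w) (rw (u i)) \<in> rwords"
    using rw_rwords[OF seqs_carrier[OF u(2), of i]] by (metis append_take_drop_id)
  then show ?thesis using rwords_append by blast
qed

lemma cyl_extend: "p \<in> cyl w \<Longrightarrow> \<exists>l\<in>letters. p \<in> cyl (w @ [l])"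
proof -
  assume p: "p \<in> cyl w"
  obtain v where v: "length v = Suc (length w)" "p \<in> cyl v" using cyl_ex[OF cyl_bdry[OF p]] by blast
  then have "take (length w) v = w" using cyl_unique[OF cyl_take[OF v(2)] p] by simp
  then have "v = w @ [last v]" using v(1) by (metis append_butlast_last_id butlast_conv_take diff_Suc_1 length_0_conv nat.distinct(1))
  then have w: "p \<in> cyl (w @ [last v])" using v(2) by simp
  then show ?thesis using cyl_rwords[OF w] unfolding rwords_def by auto
qed

section \<open>Topology and compactness of the boundary\<close>

lemma boundary_nbhd_eq:
  assumes p: "p \<in> cyl w"
  shows "boundary_nbhd F X p (real (length w)) = cyl w"
proof (intro Set.set_eqI iffI)
  fix q assume "q \<in> boundary_nbhd F X p (real (length w))"
  then obtain u v K where q: "q \<in> bdry" "u \<in> p" "v \<in> q"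
    and K: "\<forall>m\<ge>K. \<forall>n\<ge>K. real (length w) \<le> gromov_product F X (u n) (v m)"
    unfolding boundary_nbhd_def eventually_prod_sequentially by auto
  have s: "u \<in> seqs" "v \<in> seqs" using q p bdry_mem cyl_bdry by blast+
  obtain L where L: "\<forall>i\<ge>L. take (length w) (rw (u i)) = w"
    using cyl_evp[OF p q(2)] unfolding evp_def eventually_sequentially by blast
  have "take (length w) (rw (v j)) = w" if "j \<ge> K" for j
  proof -
    have "real (length w) \<le> gromov_product F X (u (max K L)) (v j)" using K that by simp
    then have "length w \<le> common_prefix (rw (u (max K L))) (rw (v j))"
      using gromov_product_eq[OF seqs_carrier[OF s(1)] seqs_carrier[OF s(2)]] by (simp add: gp_def)
    then show ?thesis using L le_common_prefix_iff[of "length w"] by (metis max.cobounded2)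
  qed
  then have "evp w v" unfolding evp_def eventually_sequentially by blast
  then show "q \<in> cyl w" using cylI q by blast
next
  fix q assume q: "q \<in> cyl w"
  obtain u v where u: "u \<in> p" "u \<in> seqs" and v: "v \<in> q" "v \<in> seqs"
    using bdry_ex p q cyl_bdry by meson
  obtain K L where K: "\<forall>i\<ge>K. take (length w) (rw (u i)) = w" "\<forall>i\<ge>L. take (length w) (rw (v i)) = w"
    using cyl_evp[OF p u(1)] cyl_evp[OF q v(1)] unfolding evp_def eventually_sequentially by blast
  have "real (length w) \<le> gromov_product F X (u i) (v j)" if "i \<ge> max K L" "j \<ge> max K L" for i j
  proof -
    have "take (length w) (rw (u i)) = w" "take (length w) (rw (v j)) = w" using K that by auto
    moreover from this have "length w \<le> length (rw (u i))" "length w \<le> length (rw (v j))"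
      by (metis length_take min.cobounded1)+
    ultimately have "length w \<le> gp (u i) (v j)" unfolding gp_def le_common_prefix_iff by simp
    then show ?thesis using gromov_product_eq[OF seqs_carrier[OF u(2)] seqs_carrier[OF v(2)]] by simp
  qed
  then have "\<forall>\<^sub>F (i, j) in sequentially \<times>\<^sub>F sequentially. real (length w) \<le> gromov_product F X (u i) (v j)"
    unfolding eventually_prod_sequentially by (intro exI[of _ "max K L"]) auto
  then show "q \<in> boundary_nbhd F X p (real (length w))"
    using u(1) v(1) cyl_bdry[OF q] unfolding boundary_nbhd_def by blast
qed

lemma openin_bdry: "openin (boundary_topology F X) U \<longleftrightarrow> U \<subseteq> bdry \<and> (\<forall>p\<in>U. \<exists>w. p \<in> cyl w \<and> cyl w \<subseteq> U)"
proof -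
  have "(\<exists>r. boundary_nbhd F X p r \<subseteq> U) \<longleftrightarrow> (\<exists>w. p \<in> cyl w \<and> cyl w \<subseteq> U)" if pB: "p \<in> bdry" for p
  proof
    assume "\<exists>r. boundary_nbhd F X p r \<subseteq> U"
    then obtain r where r: "boundary_nbhd F X p r \<subseteq> U" by blast
    obtain n :: nat where n: "r \<le> real n" using real_arch_simple by blast
    obtain w where "length w = n" "p \<in> cyl w" using cyl_ex[OF pB] by blast
    then show "\<exists>w. p \<in> cyl w \<and> cyl w \<subseteq> U"
      using r boundary_nbhd_antimono[OF n] boundary_nbhd_eq[of p w] by blast
  qed (use boundary_nbhd_eq in metis)
  then show ?thesis unfolding openin_boundary_topology by blast
qed

lemma cyl_open: "openin (boundary_topology F X) (cyl w)"
  unfolding openin_bdry using cyl_bdry by blast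

lemma cyl_closed: "closedin (boundary_topology F X) (cyl w)"
proof -
  have "openin (boundary_topology F X) (bdry - cyl w)"
    unfolding openin_bdry
  proof (intro conjI ballI)
    fix p assume p: "p \<in> bdry - cyl w"
    then obtain v where v: "length v = length w" "p \<in> cyl v" using cyl_ex by blast
    then have "cyl v \<subseteq> bdry - cyl w" using p cyl_bdry cyl_unique by blast
    then show "\<exists>w'. p \<in> cyl w' \<and> cyl w' \<subseteq> bdry - cyl w" using v by blast
  qed auto
  then show ?thesis unfolding closedin_def using cyl_bdry by auto
qed

text \<open>Koenig's lemma: a cylinder without finite subcover has a one-letter extension without
  one, since there are finitely many letters. The resulting infinite word is an end, and an open set
  of the cover around it contains one of these cylinders.\<close>

lemma compact_boundary: "compactin (boundary_topology F X) bdry"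
proof (rule ccontr)
  assume "\<not> compactin (boundary_topology F X) bdry"
  then have "\<not> (\<forall>\<U>. (\<forall>U\<in>\<U>. openin (boundary_topology F X) U) \<and> bdry \<subseteq> \<Union>\<U> \<longrightarrow>
      (\<exists>\<F>. finite \<F> \<and> \<F> \<subseteq> \<U> \<and> bdry \<subseteq> \<Union>\<F>))"
    unfolding compactin_def by simp
  then obtain \<U> where \<U>0: "\<forall>U\<in>\<U>. openin (boundary_topology F X) U" "bdry \<subseteq> \<Union>\<U>"
    "\<not> (\<exists>\<F>. finite \<F> \<and> \<F> \<subseteq> \<U> \<and> bdry \<subseteq> \<Union>\<F>)"
    by meson
  then have \<U>: "\<And>U. U \<in> \<U> \<Longrightarrow> openin (boundary_topology F X) U" by blast
  have \<U>3: "\<not> bdry \<subseteq> \<Union>\<F>" if "finite \<F>" "\<F> \<subseteq> \<U>" for \<F>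
    using \<U>0(3) that by meson
  define bad where "bad w \<longleftrightarrow> (\<forall>\<F>. finite \<F> \<longrightarrow> \<F> \<subseteq> \<U> \<longrightarrow> \<not> cyl w \<subseteq> \<Union>\<F>)" for w
  have step: "\<exists>l. bad (w @ [l])" if "bad w" for w
  proof (rule ccontr)
    assume "\<not> (\<exists>l. bad (w @ [l]))"
    then have "\<exists>\<F>. finite \<F> \<and> \<F> \<subseteq> \<U> \<and> cyl (w @ [l]) \<subseteq> \<Union>\<F>" for l
      unfolding bad_def by meson
    then have "\<forall>l. \<exists>\<F>. finite \<F> \<and> \<F> \<subseteq> \<U> \<and> cyl (w @ [l]) \<subseteq> \<Union>\<F>" by (rule allI)
    from choice[OF this] obtain \<G> where
      \<G>: "\<And>l. finite (\<G> l)" "\<And>l. \<G> l \<subseteq> \<U>" "\<And>l. cyl (w @ [l]) \<subseteq> \<Union>(\<G> l)"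
      by blast
    have "finite letters" using fin by (simp add: letters_def)
    then have "finite (\<Union>(\<G> ` letters))" using \<G> by blast
    moreover have "\<Union>(\<G> ` letters) \<subseteq> \<U>" using \<G> by blast
    moreover have "cyl w \<subseteq> \<Union>(\<Union>(\<G> ` letters))" using cyl_extend \<G>(3) by blast
    ultimately show False using that unfolding bad_def by blast
  qed
  have bad0: "bad []" unfolding bad_def cyl_Nil using \<U>3 by meson
  have "\<exists>f. \<forall>n. (bad (f n) \<and> length (f n) = n) \<and> (\<exists>l. f (Suc n) = f n @ [l])"
  proof (rule dependent_nat_choice)
    show "\<exists>x. bad x \<and> length x = 0" using bad0 by auto
    show "\<exists>y. (bad y \<and> length y = Suc n) \<and> (\<exists>l. y = x @ [l])" if "bad x \<and> length x = n" for x n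
      using step[of x] that by auto
  qed
  then obtain f where f: "\<And>n. bad (f n)" "\<And>n. length (f n) = n" "\<And>n. \<exists>l. f (Suc n) = f n @ [l]" by blast
  have pre: "take n (f m) = f n" if "n \<le> m" for n m
    using that
  proof (induction m rule: dec_induct)
    case (step m)
    obtain l where "f (Suc m) = f m @ [l]" using f(3) by blast
    then show ?case using step f(2) by simp
  qed (use f(2) in simp)
  have fr: "f n \<in> rwords" for n
  proof -
    have "cyl (f n) \<noteq> {}" using f(1)[of n] unfolding bad_def by (metis empty_subsetI finite.emptyI Union_empty)
    then show ?thesis using cyl_rwords by blast
  qed
  define u where "u n = val (f n)" for n
  have ru: "rw (u n) = f n" for n unfolding u_def using fr rw_val by blast
  have ev: "evp (f n) u" for n
    unfolding evp_def eventually_sequentially ru f(2) using pre by blast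
  have "u \<in> seqs"
    unfolding seqs_iff
  proof (intro conjI allI)
    show "range u \<subseteq> carrier F" using fr by (auto simp: u_def rwords_def)
    fix N
    have "N \<le> gp (u i) (u j)" if "i \<ge> N" "j \<ge> N" for i j
      unfolding gp_def ru le_common_prefix_iff using that f(2) pre[OF that(1)] pre[OF that(2)] by simp
    then show "\<exists>K. \<forall>i\<ge>K. \<forall>j\<ge>K. N \<le> gp (u i) (u j)" by blast
  qed
  then have p: "cls u \<in> bdry" "\<And>n. cls u \<in> cyl (f n)" using bdry_eq cls_cyl ev by auto
  then obtain U where U: "U \<in> \<U>" "cls u \<in> U" using \<U>0(2) by blast
  then obtain w where w: "cls u \<in> cyl w" "cyl w \<subseteq> U" using \<U> openin_bdry by metis
  have "w = f (length w)" using cyl_unique[OF w(1) p(2)] f(2) by simp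
  then have "bad w" using f(1) by metis
  then have "\<not> cyl w \<subseteq> \<Union>{U}" using U(1) unfolding bad_def by (metis finite.emptyI finite.insertI empty_subsetI insert_subset)
  then show False using w(2) by simp
qed

lemma cyl_compact: "compactin (boundary_topology F X) (cyl w)"
  "compactin (boundary_topology F X) (bdry - cyl w)"
  using closed_compactin[OF compact_boundary _ cyl_closed[of w]]
    closed_compactin[OF compact_boundary _ closedin_diff[OF closedin_topspace cyl_open[of w]]] cyl_bdry
  by auto

subsection \<open>Maps induced on the boundary\<close>

text \<open>Maps that preserve large Gromov products; the two-sided version \<open>coarse\<close> holds for left
  translations and automorphisms.\<close>

definition proper_map :: "('a \<Rightarrow> 'a) \<Rightarrow> bool" where
  "proper_map f \<longleftrightarrow> f \<in> carrier F \<rightarrow> carrier F \<and>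
     (\<forall>N. \<exists>M. \<forall>g\<in>carrier F. \<forall>h\<in>carrier F. M \<le> gp g h \<longrightarrow> N \<le> gp (f g) (f h))"

definition coarse :: "('a \<Rightarrow> 'a) \<Rightarrow> ('a \<Rightarrow> 'a) \<Rightarrow> bool" where
  "coarse f f' \<longleftrightarrow> proper_map f \<and> proper_map f' \<and> (\<forall>g\<in>carrier F. f' (f g) = g \<and> f (f' g) = g)"

lemma coarse_sym: "coarse f f' \<Longrightarrow> coarse f' f"
  by (auto simp: coarse_def)

lemma proper_map_seqs:
  assumes f: "proper_map f" and u: "u \<in> seqs"
  shows "f \<circ> u \<in> seqs"
  unfolding seqs_iff
proof (intro conjI allI)
  show "range (f \<circ> u) \<subseteq> carrier F" using f seqs_carrier[OF u] unfolding proper_map_def by auto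
  fix N
  obtain M where M: "\<forall>g\<in>carrier F. \<forall>h\<in>carrier F. M \<le> gp g h \<longrightarrow> N \<le> gp (f g) (f h)"
    using f unfolding proper_map_def by blast
  obtain K where "\<forall>i\<ge>K. \<forall>j\<ge>K. M \<le> gp (u i) (u j)" using u seqs_iff by blast
  then show "\<exists>K. \<forall>i\<ge>K. \<forall>j\<ge>K. N \<le> gp ((f \<circ> u) i) ((f \<circ> u) j)"
    using M seqs_carrier[OF u] by (intro exI[of _ K]) auto
qed

lemma proper_map_evp:
  assumes f: "proper_map f" and uv: "u \<in> seqs" "v \<in> seqs" "\<And>w. evp w u \<longleftrightarrow> evp w v"
  shows "evp w (f \<circ> u) \<longleftrightarrow> evp w (f \<circ> v)"
proof -
  have "gromov_equiv F X u v" using gromov_equiv_evp_iff[OF uv(1,2)] uv(3) by blast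
  then have *: "\<forall>N. \<exists>K. \<forall>i\<ge>K. \<forall>j\<ge>K. N \<le> gp (u i) (v j)"
    using gromov_equiv_iff[of u v] seqs_carrier[OF uv(1)] seqs_carrier[OF uv(2)] by blast
  have "\<exists>K. \<forall>i\<ge>K. \<forall>j\<ge>K. N \<le> gp ((f \<circ> u) i) ((f \<circ> v) j)" for N
  proof -
    obtain M where M: "\<forall>g\<in>carrier F. \<forall>h\<in>carrier F. M \<le> gp g h \<longrightarrow> N \<le> gp (f g) (f h)"
      using f unfolding proper_map_def by blast
    obtain K where "\<forall>i\<ge>K. \<forall>j\<ge>K. M \<le> gp (u i) (v j)" using * by blast
    then show ?thesis
      using M seqs_carrier[OF uv(1)] seqs_carrier[OF uv(2)] by (intro exI[of _ K]) auto
  qed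
  then have "gromov_equiv F X (f \<circ> u) (f \<circ> v)"
    using gromov_equiv_iff[of "f \<circ> u" "f \<circ> v"] proper_map_seqs[OF f] seqs_carrier uv by blast
  then show ?thesis
    using gromov_equiv_evp_iff[OF proper_map_seqs[OF f uv(1)] proper_map_seqs[OF f uv(2)]] by blast
qed

lemma proper_map_cls:
  assumes f: "proper_map f" and uv: "u \<in> seqs" "v \<in> cls u"
  shows "f \<circ> v \<in> cls (f \<circ> u)"
proof -
  have "v \<in> seqs" "\<And>w. evp w u \<longleftrightarrow> evp w v" using uv by (auto simp: cls_def)
  then show ?thesis
    using proper_map_evp[OF f uv(1)] proper_map_seqs[OF f] by (simp add: cls_def)
qed

text \<open>\<open>boundary_map\<close> takes images of sequences one by one, so it has to be
  checked that the result is a whole class: every sequence in the class of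
  \<open>f \<circ> u\<close> is pulled back by the proper inverse \<open>f'\<close>.\<close>

lemma boundary_map_cls:
  assumes c: "coarse f f'" and u: "u \<in> seqs"
  shows "boundary_map f (cls u) = cls (f \<circ> u)"
proof
  have f: "proper_map f" "proper_map f'" "\<And>g. g \<in> carrier F \<Longrightarrow> f' (f g) = g" "\<And>g. g \<in> carrier F \<Longrightarrow> f (f' g) = g"
    using c by (auto simp: coarse_def)
  show "boundary_map f (cls u) \<subseteq> cls (f \<circ> u)"
    using proper_map_cls[OF f(1) u] by (auto simp: boundary_map_def)
  show "cls (f \<circ> u) \<subseteq> boundary_map f (cls u)"
  proof
    fix v assume v: "v \<in> cls (f \<circ> u)"
    then have vs: "v \<in> seqs" by (simp add: cls_def)
    have "f' \<circ> (f \<circ> u) = u" using f(3) seqs_carrier[OF u] by auto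
    then have "f' \<circ> v \<in> cls u" using proper_map_cls[OF f(2) proper_map_seqs[OF f(1) u] v] by simp
    moreover have "f \<circ> (f' \<circ> v) = v" using f(4) seqs_carrier[OF vs] by auto
    ultimately show "v \<in> boundary_map f (cls u)" unfolding boundary_map_def by (metis image_eqI)
  qed
qed

lemma boundary_map_bdry: "coarse f f' \<Longrightarrow> p \<in> bdry \<Longrightarrow> boundary_map f p \<in> bdry"
  using bdry_ex[of p] boundary_map_cls proper_map_seqs unfolding bdry_eq coarse_def by fastforce

lemma boundary_map_cong:
  assumes "\<And>g. g \<in> carrier F \<Longrightarrow> f g = h g" "p \<in> bdry"
  shows "boundary_map f p = boundary_map h p"
proof -
  have "f \<circ> u = h \<circ> u" if "u \<in> p" for u
    using that assms bdry_mem[of p u] seqs_carrier by auto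
  then show ?thesis by (auto simp: boundary_map_def)
qed

lemma boundary_map_comp: "boundary_map f (boundary_map h p) = boundary_map (\<lambda>g. f (h g)) p"
  by (simp add: boundary_map_def image_image comp_def)

lemma boundary_map_id: "(\<And>g. g \<in> carrier F \<Longrightarrow> f g = g) \<Longrightarrow> p \<in> bdry \<Longrightarrow> boundary_map f p = p"
proof -
  assume "\<And>g. g \<in> carrier F \<Longrightarrow> f g = g" "p \<in> bdry"
  then have "boundary_map f p = boundary_map id p" by (intro boundary_map_cong) auto
  then show ?thesis by (simp add: boundary_map_def)
qed

lemma boundary_map_inverse:
  assumes c: "coarse f f'" and p: "p \<in> bdry" shows "boundary_map f' (boundary_map f p) = p"
  unfolding boundary_map_comp
proof (rule boundary_map_id[OF _ p])
  show "f' (f g) = g" if "g \<in> carrier F" for g using c that unfolding coarse_def by blast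
qed

text \<open>The infinite word of an end continues beyond \<open>w\<close>, so it is enough to know
  \<open>f\<close> on group elements whose reduced word properly extends \<open>w\<close>.\<close>

lemma boundary_map_cyl:
  assumes c: "coarse f f'" and p: "p \<in> cyl w"
    and step: "\<And>g t. g \<in> carrier F \<Longrightarrow> rw g = w @ t \<Longrightarrow> t \<noteq> [] \<Longrightarrow> take (length v) (rw (f g)) = v"
  shows "boundary_map f p \<in> cyl v"
proof -
  obtain l where "p \<in> cyl (w @ [l])" using cyl_extend[OF p] by blast
  moreover obtain u where u: "u \<in> p" "u \<in> seqs" "p = cls u" using bdry_ex cyl_bdry[OF p] by blast
  ultimately have "evp (w @ [l]) u" using cyl_evp by blast
  then have "evp v (f \<circ> u)"
    unfolding evp_def
  proof (elim eventually_mono)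
    fix i assume *: "take (length (w @ [l])) (rw (u i)) = w @ [l]"
    then have "rw (u i) = w @ l # drop (length (w @ [l])) (rw (u i))"
      by (metis append.assoc append_Cons append_Nil append_take_drop_id)
    then show "take (length v) (rw ((f \<circ> u) i)) = v" using step[OF seqs_carrier[OF u(2)]] by auto
  qed
  then show ?thesis
    using boundary_map_cls[OF c u(2)] cls_cyl[of "f \<circ> u" v] proper_map_seqs u c unfolding coarse_def by auto
qed

lemma boundary_map_continuous:
  assumes c: "coarse f f'"
  shows "continuous_map (boundary_topology F X) (boundary_topology F X) (boundary_map f)"
  unfolding continuous_map_def
proof (intro conjI allI impI)
  show "boundary_map f \<in> topspace (boundary_topology F X) \<rightarrow> topspace (boundary_topology F X)"
    using boundary_map_bdry[OF c] by simp
  fix U assume U: "openin (boundary_topology F X) U"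
  show "openin (boundary_topology F X) {p \<in> topspace (boundary_topology F X). boundary_map f p \<in> U}"
    unfolding openin_bdry
  proof (intro conjI ballI)
    fix p assume "p \<in> {p \<in> topspace (boundary_topology F X). boundary_map f p \<in> U}"
    then have p: "p \<in> bdry" "boundary_map f p \<in> U" by auto
    then obtain w where w: "boundary_map f p \<in> cyl w" "cyl w \<subseteq> U" using U openin_bdry by metis
    obtain M where M: "\<forall>g\<in>carrier F. \<forall>h\<in>carrier F. M \<le> gp g h \<longrightarrow> length w \<le> gp (f g) (f h)"
      using c unfolding coarse_def proper_map_def by blast
    obtain x where x: "length x = M" "p \<in> cyl x" using cyl_ex[OF p(1)] by blast
    obtain u where u: "u \<in> p" "u \<in> seqs" "p = cls u" using bdry_ex p by blast
    have fu: "evp w (f \<circ> u)" using cyl_evp[OF w(1)] u(1) unfolding boundary_map_def by blast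
    have "boundary_map f q \<in> cyl w" if q: "q \<in> cyl x" for q
    proof -
      obtain v where v: "v \<in> q" "v \<in> seqs" "q = cls v" using bdry_ex cyl_bdry[OF q] by blast
      have "\<forall>\<^sub>F i in sequentially. take M (rw (u i)) = x \<and> take M (rw (v i)) = x \<and> take (length w) (rw (f (u i))) = w"
        using cyl_evp[OF x(2) u(1)] cyl_evp[OF q v(1)] fu x(1) unfolding evp_def by (simp add: eventually_conj)
      then have "evp w (f \<circ> v)"
        unfolding evp_def
      proof (elim eventually_mono, elim conjE)
        fix i assume *: "take M (rw (u i)) = x" "take M (rw (v i)) = x" "take (length w) (rw (f (u i))) = w"
        then have "M \<le> length (rw (u i))" "M \<le> length (rw (v i))" using x(1) by (metis length_take min.cobounded1 min.commute)+
        then have "M \<le> gp (u i) (v i)" unfolding gp_def le_common_prefix_iff using * by simp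
        then have "length w \<le> gp (f (u i)) (f (v i))" using M seqs_carrier[OF u(2)] seqs_carrier[OF v(2)] by blast
        then show "take (length w) (rw ((f \<circ> v) i)) = w"
          unfolding gp_def le_common_prefix_iff using * by simp
      qed
      then show ?thesis
        using boundary_map_cls[OF c v(2)] cls_cyl[of "f \<circ> v" w] proper_map_seqs v c unfolding coarse_def by auto
    qed
    then have "cyl x \<subseteq> {p \<in> topspace (boundary_topology F X). boundary_map f p \<in> U}"
      using w cyl_bdry by auto
    then show "\<exists>w. p \<in> cyl w \<and> cyl w \<subseteq> {p \<in> topspace (boundary_topology F X). boundary_map f p \<in> U}"
      using x by blast
  qed auto
qed

text \<open>Left translation preserves distances and changes lengths by at most
  \<open>len k\<close>, so Gromov products drop by at most \<open>len k\<close>.\<close>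

lemma coarse_left_mult:
  assumes k: "k \<in> carrier F"
  shows "coarse (\<lambda>h. k \<otimes> h) (\<lambda>h. inv k \<otimes> h)"
proof -
  have "proper_map (\<lambda>h. k \<otimes> h)" if k: "k \<in> carrier F" for k
    unfolding proper_map_def
  proof (intro conjI allI)
    fix N
    have "N \<le> gp (k \<otimes> g) (k \<otimes> h)" if gh: "g \<in> carrier F" "h \<in> carrier F" "N + len k \<le> gp g h" for g h
    proof -
      have "inv (k \<otimes> g) \<otimes> (k \<otimes> h) = inv g \<otimes> h" using k gh by (simp add: inv_mult_group m_assoc inv_cancel)
      moreover have "len g \<le> len k + len (k \<otimes> g)" "len h \<le> len k + len (k \<otimes> h)"
        using len_mult[of "inv k" "k \<otimes> g"] len_mult[of "inv k" "k \<otimes> h"] k gh by (simp_all add: inv_cancel)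
      ultimately show ?thesis
        using len_inv_mult[of g h] len_inv_mult[of "k \<otimes> g" "k \<otimes> h"] k gh by simp
    qed
    then show "\<exists>M. \<forall>g\<in>carrier F. \<forall>h\<in>carrier F. M \<le> gp g h \<longrightarrow> N \<le> gp (k \<otimes> g) (k \<otimes> h)" by blast
  qed (use k in auto)
  then show ?thesis using k by (auto simp: coarse_def inv_cancel)
qed

lemma hom_lipschitz:
  assumes h: "h \<in> hom F F"
  shows "\<exists>C>0. \<forall>g\<in>carrier F. len (h g) \<le> C * len g"
proof -
  interpret h: group_hom F F h using h by unfold_locales
  have fl: "finite letters" using fin by (simp add: letters_def)
  define C where "C = Suc (\<Sum>l\<in>letters. len (h (lv l)))"
  have C: "len (h (lv l)) \<le> C" if "l \<in> letters" for l
    using member_le_sum[OF that, of "\<lambda>l. len (h (lv l))"] fl by (simp add: C_def)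
  have "len (h g) \<le> C * len g" if "g \<in> carrier F" for g
    using that
  proof (induction rule: carrier_induct)
    case (mult l g)
    have "len (h (lv l \<otimes> g)) \<le> len (h (lv l)) + len (h g)" using mult by (simp add: len_mult)
    also have "\<dots> \<le> C + C * len g" using C mult by (intro add_mono) auto
    finally show ?case using mult(3) by (simp add: len_def)
  qed simp
  then show ?thesis by (intro exI[of _ C]) (simp add: C_def)
qed

lemma gp_near: "g \<in> carrier F \<Longrightarrow> h \<in> carrier F \<Longrightarrow> len g \<le> gp g h + len (inv g \<otimes> h)"
  using len_inv_mult[of g h] gp_le(2)[of g h] by linarith

text \<open>Bounded cancellation, via a discrete path from \<open>h P\<close> to \<open>h u\<close> staying far from the identity.\<close>

lemma aut_proper:
  assumes h: "h \<in> hom F F" "h' \<in> hom F F" "\<And>g. g \<in> carrier F \<Longrightarrow> h' (h g) = g"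
  shows "proper_map h"
proof -
  interpret h: group_hom F F h using h(1) by unfold_locales
  obtain C where C: "\<And>g. g \<in> carrier F \<Longrightarrow> len (h g) \<le> C * len g" "C > 0"
    using hom_lipschitz[OF h(1)] by blast
  obtain D where D: "\<And>g. g \<in> carrier F \<Longrightarrow> len (h' g) \<le> D * len g" "D > 0"
    using hom_lipschitz[OF h(2)] by blast
  have low: "len g \<le> D * len (h g)" if "g \<in> carrier F" for g
    using D(1)[of "h g"] h(3)[OF that] that by simp
  \<comment> \<open>Prefixes beyond \<open>P\<close> have images of length at least
    \<open>N + C\<close>, and images of neighbouring prefixes are at most \<open>C\<close> apart, so
    their Gromov product is at least \<open>N\<close>; the ultrametric inequality chains the
    steps.\<close>
  have key: "N \<le> gp (h (val P)) (h (val (P @ R)))"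
    if "P @ R \<in> rwords" "D * (N + C) \<le> length P" for N P R
    using that(1)
  proof (induction R rule: rev_induct)
    case Nil
    have P: "val P \<in> carrier F" "len (val P) = length P" using Nil rw_val[of P] by (auto simp: rwords_def len_def)
    then have "D * (N + C) \<le> D * len (h (val P))" using low[OF P(1)] P(2) that(2) by linarith
    then show ?case using D(2) by simp
  next
    case (snoc l R)
    have r: "P @ R \<in> rwords" "l \<in> letters" using snoc.prems rwords_append[of "P @ R" "[l]"] by (auto simp: rwords_def)
    then have c: "val (P @ R) \<in> carrier F" "len (val (P @ R)) = length (P @ R)"
      using rw_val[of "P @ R"] by (auto simp: rwords_def len_def)
    have e: "val (P @ R @ [l]) = val (P @ R) \<otimes> lv l"
      using val_append[of "P @ R" "[l]"] r by (simp add: rwords_def)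
    have "length P \<le> len (val (P @ R))" using c(2) by simp
    then have "D * (N + C) \<le> D * len (h (val (P @ R)))" using low[OF c(1)] that(2) by linarith
    then have "N + C \<le> len (h (val (P @ R)))" using D(2) by simp
    moreover have "len (h (lv l)) \<le> C"
    proof -
      have "len (lv l) \<le> 1" using len_val_le[of "[l]"] r by simp
      then show ?thesis using C(1)[of "lv l"] r by (metis lv_closed le_trans mult.right_neutral mult_le_mono2)
    qed
    moreover have "inv (h (val (P @ R))) \<otimes> h (val (P @ R @ [l])) = h (lv l)"
      using c r by (simp add: e inv_cancel)
    moreover have "h (val (P @ R)) \<in> carrier F" "h (val (P @ R @ [l])) \<in> carrier F" using c r by (auto simp: e)
    ultimately have "N \<le> gp (h (val (P @ R))) (h (val (P @ R @ [l])))"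
      using gp_near[of "h (val (P @ R))" "h (val (P @ R @ [l]))"] by simp
    moreover have "N \<le> gp (h (val P)) (h (val (P @ R)))" using snoc.IH[OF r(1)] .
    ultimately show ?case using gp_ultra[of "h (val P)" "h (val (P @ R))" "h (val (P @ R @ [l]))"] by simp
  qed
  show ?thesis
    unfolding proper_map_def
  proof (intro conjI allI)
    fix N
    have "N \<le> gp (h g) (h k)" if gk: "g \<in> carrier F" "k \<in> carrier F" "D * (N + C) \<le> gp g k" for g k
    proof -
      let ?n = "D * (N + C)"
      define P where "P = take ?n (rw g)"
      have P: "P = take ?n (rw k)" "length P = ?n"
        using gk(3) unfolding gp_def le_common_prefix_iff P_def by auto
      have 1: "g = val (P @ drop ?n (rw g))" "k = val (P @ drop ?n (rw k))"
        "P @ drop ?n (rw g) \<in> rwords" "P @ drop ?n (rw k) \<in> rwords"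
        using gk P_def P(1) by (metis append_take_drop_id val_rw rw_rwords)+
      have "N \<le> gp (h (val P)) (h g)" "N \<le> gp (h (val P)) (h k)"
        using key[OF 1(3), of N] key[OF 1(4), of N] P(2) unfolding 1(1,2)[symmetric] by simp_all
      then show ?thesis using gp_ultra[of "h g" "h (val P)" "h k"] gp_commute[of "h g"] by simp
    qed
    then show "\<exists>M. \<forall>g\<in>carrier F. \<forall>k\<in>carrier F. M \<le> gp g k \<longrightarrow> N \<le> gp (h g) (h k)" by blast
  qed auto
qed

lemma coarse_aut:
  assumes "h \<in> hom F F" "h' \<in> hom F F"
    "\<And>g. g \<in> carrier F \<Longrightarrow> h' (h g) = g" "\<And>g. g \<in> carrier F \<Longrightarrow> h (h' g) = g"
  shows "coarse h h'"
  unfolding coarse_def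
proof (intro conjI ballI)
  show "proper_map h" by (rule aut_proper[OF assms(1-3)])
  show "proper_map h'" by (rule aut_proper[OF assms(2,1,4)])
  show "h' (h g) = g" "h (h' g) = g" if "g \<in> carrier F" for g using assms(3,4)[OF that] .
qed

text \<open>Right multiplication by a fixed element moves every point by a bounded amount and so
  does nothing at infinity. Hence an inner automorphism acts on ends as a left translation.\<close>

lemma left_mult_conj:
  assumes k: "k \<in> carrier F" and p: "p \<in> bdry"
  shows "boundary_map (\<lambda>h. k \<otimes> h \<otimes> inv k) p = boundary_map (\<lambda>h. k \<otimes> h) p"
proof -
  have hom: "(\<lambda>h. k \<otimes> h \<otimes> inv k) \<in> hom F F" if "k \<in> carrier F" for k
    using that by (auto simp: hom_def m_assoc inv_cancel)
  have c: "coarse (\<lambda>h. k \<otimes> h \<otimes> inv k) (\<lambda>h. inv k \<otimes> h \<otimes> inv (inv k))"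
    using k by (intro coarse_aut hom) (auto simp: m_assoc inv_cancel)
  note cm = coarse_left_mult[OF k]
  obtain u where u: "u \<in> seqs" "p = cls u" using bdry_ex[OF p] by blast
  let ?v = "(\<lambda>h. k \<otimes> h) \<circ> u" and ?w = "(\<lambda>h. k \<otimes> h \<otimes> inv k) \<circ> u"
  have s: "?v \<in> seqs" "?w \<in> seqs" using proper_map_seqs u(1) c cm unfolding coarse_def by blast+
  have "gromov_equiv F X ?v ?w"
  proof -
    have "\<exists>K. \<forall>i\<ge>K. \<forall>j\<ge>K. N \<le> gp (?v i) (?w j)" for N
    proof -
      obtain K where K: "\<And>i j. i \<ge> K \<Longrightarrow> j \<ge> K \<Longrightarrow> N + len k \<le> gp (?v i) (?v j)" using s(1) seqs_iff by metis
      have "N \<le> gp (?v i) (?w j)" if ij: "i \<ge> K" "j \<ge> K" for i j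
      proof -
        have uF: "u j \<in> carrier F" using seqs_carrier[OF u(1)] .
        have "inv (k \<otimes> u j) \<otimes> (k \<otimes> u j \<otimes> inv k) = inv k" using k uF by (simp add: inv_mult_group m_assoc inv_cancel)
        then have "len (?v j) \<le> gp (?v j) (?w j) + len k"
          using gp_near[of "?v j" "?w j"] k uF by simp
        moreover have "N + len k \<le> len (?v j)" using K[OF ij] gp_le(2) by (meson le_trans)
        ultimately have "N \<le> gp (?v j) (?w j)" by simp
        then show ?thesis using gp_ultra[of "?v i" "?v j" "?w j"] K[OF ij] by simp
      qed
      then show ?thesis by blast
    qed
    then show ?thesis using gromov_equiv_iff[of ?v ?w] seqs_carrier[OF s(1)] seqs_carrier[OF s(2)] by blast
  qed
  then have "cls ?v = cls ?w" using gromov_equiv_evp_iff[OF s] cls_eqI by blast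
  then show ?thesis unfolding u(2) boundary_map_cls[OF c u(1)] boundary_map_cls[OF cm u(1)] by simp
qed

section \<open>Cylinders under translations and transvections\<close>

lemma cyl_strip:
  assumes p: "p \<in> cyl (w @ v)"
  shows "boundary_map (\<lambda>h. inv (val w) \<otimes> h) p \<in> cyl v"
proof (rule boundary_map_cyl[OF coarse_left_mult p])
  have wv: "w \<in> rwords" using cyl_rwords[OF p] rwords_append by blast
  then show wF: "inv (val w) \<in> carrier F" by (simp add: rwords_def)
  fix g t assume g: "g \<in> carrier F" "rw g = (w @ v) @ t"
  have r: "v @ t \<in> rwords" "set w \<subseteq> letters" using rw_rwords[OF g(1)] g(2) rwords_append[of w "v @ t"] by (auto simp: rwords_def)
  have "g = val w \<otimes> val (v @ t)"
    using val_append[of w "v @ t"] val_rw[OF g(1)] g(2) r by (simp add: rwords_def)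
  then have "inv (val w) \<otimes> g = val (v @ t)" using r by (simp add: inv_cancel rwords_def)
  then show "take (length v) (rw (inv (val w) \<otimes> g)) = v" using rw_val[OF r(1)] by simp
qed

lemma cyl_cons:
  assumes p: "p \<in> cyl (y # w)" and l: "l \<in> letters" "y \<noteq> linv l"
  shows "boundary_map (\<lambda>h. lv l \<otimes> h) p \<in> cyl (l # y # w)"
proof (rule boundary_map_cyl[OF coarse_left_mult p])
  fix g t assume g: "g \<in> carrier F" "rw g = (y # w) @ t"
  then show "take (length (l # y # w)) (rw (lv l \<otimes> g)) = l # y # w"
    using l by (simp add: rw_mult rcons_def)
qed (use l in simp)

context
  fixes z :: "'a \<times> bool" and a :: 'a
  assumes z: "z \<in> letters" and a: "a \<in> X" "fst z \<noteq> a"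
begin

lemma coarse_transvection: "coarse (transvection z a n) (transvection z a (- n))"
  by (rule coarse_aut[OF transvection_hom[OF z a] transvection_hom[OF z a]])
    (simp_all add: transvection_cancel[OF z a])

lemma transvection_cyl_first:
  assumes "p \<in> cyl [z]"
  shows "boundary_map (transvection z a n) p \<in> cyl [z]"
proof (rule boundary_map_cyl[OF coarse_transvection assms])
  fix g t assume g: "g \<in> carrier F" "rw g = [z] @ t"
  have "z # t \<in> rwords" using rw_rwords[OF g(1)] g(2) by simp
  from transvection_normal_form[OF z a this a(2), of n] obtain t' where t': "z # t' \<in> rwords"
    "transvection z a n (val (z # t)) = \<one> \<otimes> val (z # t')" by auto
  have "set (z # t') \<subseteq> letters" using t'(1) by (simp add: rwords_def)
  then have "transvection z a n g = val (z # t')" using val_rw[OF g(1)] g(2) t'(2) val_closed[of "z # t'"] by (simp del: ev_Cons)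
  then show "take (length [z]) (rw (transvection z a n g)) = [z]" using rw_val[OF t'(1)] by simp
qed

text \<open>The letter \<open>z\<close> adds \<open>n\<close> to the following block of
  \<open>a\<close>, and \<open>y\<close>, not being the inverse of \<open>z\<close>, takes nothing
  away. This shift by \<open>n\<close> is what makes sets of lines wander.\<close>

lemma transvection_cyl_pow:
  assumes p: "p \<in> cyl (z # apow a m @ [y])" and y: "fst y \<noteq> a" "y \<noteq> linv z"
  shows "boundary_map (transvection z a n) p \<in> cyl (z # apow a (n + m) @ [y])"
proof (rule boundary_map_cyl[OF coarse_transvection p])
  fix g t assume g: "g \<in> carrier F" "rw g = (z # apow a m @ [y]) @ t"
  have r: "z # apow a m @ y # t \<in> rwords" using rw_rwords[OF g(1)] g(2) by simp
  then have "y # t \<in> rwords" using rwords_append[of "z # apow a m" "y # t"] by simp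
  from transvection_normal_form[OF z a this y(1), of n] obtain t' where t': "y # t' \<in> rwords"
    "transvection z a n (val (y # t)) = a [^] (if y = linv z then - n else 0) \<otimes> val (y # t')" by blast
  note s = transvection_normal_form_step[OF z a r a(2) y(1) t'(1) t'(2)]
  have R: "z # apow a (n + m) @ y # t' \<in> rwords" using s(1) y(2) by simp
  then have "val (z # apow a (n + m) @ y # t') \<in> carrier F"
    unfolding rwords_def using val_closed by blast
  then have V: "transvection z a n g = val (z # apow a (n + m) @ y # t')"
    using s(2) y(2) val_rw[OF g(1)] g(2) by (simp del: ev_Cons)
  show "take (length (z # apow a (n + m) @ [y])) (rw (transvection z a n g)) = z # apow a (n + m) @ [y]"
    unfolding V rw_val[OF R] by simp
qed

end

end

section \<open>Length functions of cyclic HNN splittings\<close>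

context group
begin

text \<open>The bijection \<open>\<alpha> g\<close> carries the displacement function of
  \<open>w\<close> to that of its conjugate.\<close>

lemma length_function_conj:
  assumes act: "isometric_action G M d \<alpha>" and g: "g \<in> carrier G" "w \<in> carrier G"
  shows "length_function G M d \<alpha> (g \<otimes> w \<otimes> inv g) = length_function G M d \<alpha> w"
proof -
  interpret act: group_action G M \<alpha> using act unfolding isometric_action_def by simp
  have "d (\<alpha> g y) (\<alpha> (g \<otimes> w \<otimes> inv g) (\<alpha> g y)) = d y (\<alpha> w y)" if y: "y \<in> M" for y
  proof -
    have "\<alpha> (g \<otimes> w \<otimes> inv g) (\<alpha> g y) = \<alpha> (g \<otimes> w \<otimes> inv g \<otimes> g) y"
      using act.composition_rule[OF y, of "g \<otimes> w \<otimes> inv g" g] g by simp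
    also have "g \<otimes> w \<otimes> inv g \<otimes> g = g \<otimes> w" using g by (simp add: m_assoc)
    also have "\<alpha> (g \<otimes> w) y = \<alpha> g (\<alpha> w y)" using act.composition_rule[OF y, of g w] g by simp
    finally show ?thesis
      using act g y act.element_image[OF g(2) y refl] unfolding isometric_action_def by simp
  qed
  then have "(\<lambda>y. d (\<alpha> g y) (\<alpha> (g \<otimes> w \<otimes> inv g) (\<alpha> g y))) ` M = (\<lambda>y. d y (\<alpha> w y)) ` M"
    by (rule image_cong[OF refl])
  then have "(\<lambda>x. d x (\<alpha> (g \<otimes> w \<otimes> inv g) x)) ` (\<alpha> g ` M) = (\<lambda>y. d y (\<alpha> w y)) ` M"
    unfolding image_image .
  then have "(\<lambda>x. d x (\<alpha> (g \<otimes> w \<otimes> inv g) x)) ` M = (\<lambda>y. d y (\<alpha> w y)) ` M"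
    unfolding act.surj_prop[OF g(1)] .
  then show ?thesis using g unfolding length_function_def by simp
qed

lemma cv_conj:
  assumes "l \<in> cv G" "g \<in> carrier G" "w \<in> carrier G"
  shows "l (g \<otimes> w \<otimes> inv g) = l w"
proof -
  obtain M :: "real set" and d \<alpha> where T: "outer_space_tree G M d \<alpha>" and l: "l = length_function G M d \<alpha>"
    using assms(1) unfolding cv_def by auto
  have "isometric_action G M d \<alpha>" using T unfolding outer_space_tree_def by blast
  from length_function_conj[OF this assms(2,3)] show ?thesis unfolding l .
qed

end

context free_gp_fin
begin

definition vgrp :: "'a \<Rightarrow> 'a \<Rightarrow> 'a set" where
  "vgrp a c = generate F (insert (c \<otimes> a \<otimes> inv c) (X - {c}))"

text \<open>Elements that a path of \<open>n\<close> edges in the splitting reaches, backtracking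
  allowed; \<open>clen\<close> then takes the shortest path.\<close>

fun cball :: "'a \<Rightarrow> 'a \<Rightarrow> nat \<Rightarrow> 'a set" where
  "cball a c 0 = vgrp a c"
| "cball a c (Suc n) = {g \<otimes> e \<otimes> v |g e v. g \<in> cball a c n \<and> e \<in> {c, inv c} \<and> v \<in> vgrp a c}"

text \<open>The displacement of the base vertex of the Bass--Serre tree of the HNN extension with
  vertex group \<open>vgrp a c\<close> and stable letter \<open>c\<close>, conjugating \<open>a\<close> to \<open>c a c\<^sup>-\<^sup>1\<close>.\<close>

definition clen :: "'a \<Rightarrow> 'a \<Rightarrow> 'a \<Rightarrow> nat" where
  "clen a c g = (LEAST n. g \<in> cball a c n)"

text \<open>The tree formula for translation lengths, read off at the base vertex. The values are
  limits of rescaled lengths in twisted Cayley trees and hence non-negative.\<close>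

definition hnn_length :: "'a \<Rightarrow> 'a \<Rightarrow> 'a \<Rightarrow> real" where
  "hnn_length a c = (\<lambda>g\<in>carrier F. real (clen a c (g \<otimes> g)) - real (clen a c g))"

context
  fixes a c
  assumes ac: "a \<in> X" "c \<in> X" "a \<noteq> c"
begin

lemma acF [simp]: "a \<in> carrier F" "c \<in> carrier F"
  using ac X_carrier by auto

lemma vgrp_gens: "insert (c \<otimes> a \<otimes> inv c) (X - {c}) \<subseteq> carrier F"
  using X_carrier by auto

lemma vgrp_subgroup: "subgroup (vgrp a c) F"
  unfolding vgrp_def using vgrp_gens by (rule generate_is_subgroup)

lemma vgrp_closed [simp]: "v \<in> vgrp a c \<Longrightarrow> v \<in> carrier F"
  using subgroup.mem_carrier[OF vgrp_subgroup] .

lemma vgrp_mult [simp]: "v \<in> vgrp a c \<Longrightarrow> w \<in> vgrp a c \<Longrightarrow> v \<otimes> w \<in> vgrp a c"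
  by (rule subgroup.m_closed[OF vgrp_subgroup])

lemma vgrp_inv [simp]: "v \<in> vgrp a c \<Longrightarrow> inv v \<in> vgrp a c"
  by (rule subgroup.m_inv_closed[OF vgrp_subgroup])

lemma vgrp_one [simp]: "\<one> \<in> vgrp a c"
  by (rule subgroup.one_closed[OF vgrp_subgroup])

lemma vgrp_X: "x \<in> X \<Longrightarrow> x \<noteq> c \<Longrightarrow> x \<in> vgrp a c"
  unfolding vgrp_def by (rule generate.incl) simp

lemma vgrp_conj: "c \<otimes> a \<otimes> inv c \<in> vgrp a c"
  unfolding vgrp_def by (rule generate.incl) simp

lemma vgrp_pow: "v \<in> vgrp a c \<Longrightarrow> v [^] (n::int) \<in> vgrp a c"
proof -
  assume v: "v \<in> vgrp a c"
  have *: "v [^] (k::nat) \<in> vgrp a c" for k using v by (induction k) auto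
  show ?thesis
  proof (cases "n < 0")
    case True
    then have "v [^] n = inv (v [^] nat (- n))" by (simp only: int_pow_def2 if_True)
    then show ?thesis using vgrp_inv[OF *[of "nat (- n)"]] by (simp only:)
  next
    case False
    then have "v [^] n = v [^] nat n" by (simp only: int_pow_def2 if_False)
    then show ?thesis using *[of "nat n"] by (simp only:)
  qed
qed

lemma vgrp_conj_pow: "c \<otimes> a [^] (n::int) \<otimes> inv c \<in> vgrp a c"
proof -
  have *: "c \<otimes> a [^] (k::nat) \<otimes> inv c = (c \<otimes> a \<otimes> inv c) [^] k" for k
  proof (induction k)
    case (Suc k)
    have "c \<otimes> a [^] Suc k \<otimes> inv c = (c \<otimes> a [^] k \<otimes> inv c) \<otimes> (c \<otimes> a \<otimes> inv c)"
      by (simp add: m_assoc inv_cancel)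
    then show ?case using Suc by simp
  qed simp
  have "inv (c \<otimes> a [^] (k::nat) \<otimes> inv c) = c \<otimes> inv (a [^] k) \<otimes> inv c" for k
    by (simp add: inv_mult_group m_assoc)
  then have "c \<otimes> inv (a [^] (k::nat)) \<otimes> inv c = inv ((c \<otimes> a \<otimes> inv c) [^] k)" for k
    by (simp only: *[symmetric])
  then have "c \<otimes> a [^] n \<otimes> inv c = (c \<otimes> a \<otimes> inv c) [^] n"
  proof (cases "n < 0")
    case True
    then have "x [^] n = inv (x [^] nat (- n))" for x by (simp only: int_pow_def2 if_True)
    then show ?thesis using \<open>\<And>k. c \<otimes> inv (a [^] k) \<otimes> inv c = inv ((c \<otimes> a \<otimes> inv c) [^] k)\<close> by (simp only:)
  next
    case False
    then have "x [^] n = x [^] nat n" for x by (simp only: int_pow_def2 if_False)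
    then show ?thesis using * by (simp only:)
  qed
  then show ?thesis using vgrp_pow[OF vgrp_conj] by simp
qed

lemma cball_closed: "g \<in> cball a c n \<Longrightarrow> g \<in> carrier F"
  by (induction n arbitrary: g) auto

lemma cball_SucI:
  "g \<in> cball a c n \<Longrightarrow> e \<in> {c, inv c} \<Longrightarrow> v \<in> vgrp a c \<Longrightarrow> g \<otimes> e \<otimes> v \<in> cball a c (Suc n)"
  by auto

lemma cball_SucE:
  assumes "g \<in> cball a c (Suc n)"
  obtains h e v where "g = h \<otimes> e \<otimes> v" "h \<in> cball a c n" "e \<in> {c, inv c}" "v \<in> vgrp a c"
    "h \<in> carrier F" "e \<in> carrier F" "v \<in> carrier F"
proof -
  obtain h e v where *: "g = h \<otimes> e \<otimes> v" "h \<in> cball a c n" "e \<in> {c, inv c}" "v \<in> vgrp a c"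
    using assms unfolding cball.simps by blast
  moreover have "e \<in> carrier F" using *(3) by auto
  ultimately show thesis using that[OF * cball_closed[OF *(2)]] by simp
qed

declare cball.simps [simp del]

lemma cball_0 [simp]: "cball a c 0 = vgrp a c"
  by (simp add: cball.simps)

lemma cball_right:
  assumes g: "g \<in> cball a c n" and v: "v \<in> vgrp a c"
  shows "g \<otimes> v \<in> cball a c n"
proof (cases n)
  case (Suc m)
  obtain h e w where h: "g = h \<otimes> e \<otimes> w" "h \<in> cball a c m" "e \<in> {c, inv c}" "w \<in> vgrp a c"
    "h \<in> carrier F" "e \<in> carrier F" "w \<in> carrier F"
    using g unfolding Suc by (rule cball_SucE)
  then have "g \<otimes> v = h \<otimes> e \<otimes> (w \<otimes> v)" using v by (simp add: m_assoc)
  then show ?thesis using cball_SucI[OF h(2,3) vgrp_mult[OF h(4) v]] Suc by simp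
qed (use assms in simp)

lemma cball_left:
  "g \<in> cball a c n \<Longrightarrow> v \<in> vgrp a c \<Longrightarrow> v \<otimes> g \<in> cball a c n"
proof (induction n arbitrary: g)
  case (Suc n)
  from Suc.prems(1) obtain h e w where h: "g = h \<otimes> e \<otimes> w" "h \<in> cball a c n" "e \<in> {c, inv c}" "w \<in> vgrp a c"
    "h \<in> carrier F" "e \<in> carrier F" "w \<in> carrier F"
    by (rule cball_SucE)
  then have "v \<otimes> g = (v \<otimes> h) \<otimes> e \<otimes> w" using Suc.prems by (simp add: m_assoc)
  then show ?case using cball_SucI[OF Suc.IH[OF h(2) Suc.prems(2)] h(3,4)] by simp
qed simp

lemma cball_letter_right: "g \<in> cball a c n \<Longrightarrow> e \<in> {c, inv c} \<Longrightarrow> g \<otimes> e \<in> cball a c (Suc n)"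
  using cball_SucI[of g n e \<one>] cball_closed[of g n] by auto

lemma cball_letter_left: "g \<in> cball a c n \<Longrightarrow> e \<in> {c, inv c} \<Longrightarrow> e \<otimes> g \<in> cball a c (Suc n)"
proof (induction n arbitrary: g)
  case 0
  then show ?case using cball_SucI[of \<one> 0 e g] by auto
next
  case (Suc n)
  from Suc.prems(1) obtain h f w where h: "g = h \<otimes> f \<otimes> w" "h \<in> cball a c n" "f \<in> {c, inv c}" "w \<in> vgrp a c"
    "h \<in> carrier F" "f \<in> carrier F" "w \<in> carrier F"
    by (rule cball_SucE)
  moreover have "e \<in> carrier F" using Suc.prems(2) by auto
  ultimately have "e \<otimes> g = (e \<otimes> h) \<otimes> f \<otimes> w" by (simp add: m_assoc)
  then show ?case using cball_SucI[OF Suc.IH[OF h(2) Suc.prems(2)] h(3,4)] by simp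
qed

lemma cball_ex: "g \<in> carrier F \<Longrightarrow> \<exists>n. g \<in> cball a c n"
proof (induction rule: carrier_induct)
  case one
  then show ?case using vgrp_one cball_0 by blast
next
  case (mult l g)
  then obtain n where n: "g \<in> cball a c n" by auto
  show ?case
  proof (cases "fst l = c")
    case True
    then have "lv l \<in> {c, inv c}" by (auto simp: lv_def)
    then show ?thesis using cball_letter_left[OF n] by blast
  next
    case False
    then have "lv l \<in> vgrp a c" using mult(1) vgrp_X by (auto simp: lv_def letters_def)
    then show ?thesis using cball_left[OF n] by blast
  qed
qed

lemma clen_mem: "g \<in> carrier F \<Longrightarrow> g \<in> cball a c (clen a c g)"
  unfolding clen_def by (rule LeastI_ex) (rule cball_ex)

lemma clen_le: "g \<in> cball a c n \<Longrightarrow> clen a c g \<le> n"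
  unfolding clen_def by (rule Least_le)

text \<open>Endomorphisms that respect the splitting do not increase the displacement.\<close>

definition preserves :: "('a \<Rightarrow> 'a) \<Rightarrow> bool" where
  "preserves h \<longleftrightarrow> h \<in> hom F F \<and> (\<forall>x\<in>X - {c}. h x \<in> vgrp a c) \<and> h (c \<otimes> a \<otimes> inv c) \<in> vgrp a c \<and>
     (\<exists>v\<in>vgrp a c. \<exists>w\<in>vgrp a c. h c = v \<otimes> c \<otimes> w)"

lemma preserves_vgrp:
  assumes "preserves h" "v \<in> vgrp a c"
  shows "h v \<in> vgrp a c"
proof -
  interpret h: group_hom F F h using assms(1) by unfold_locales (simp add: preserves_def)
  show ?thesis
    using assms(2) unfolding vgrp_def
  proof (induction rule: generate.induct)
    case (incl y)
    then show ?case using assms(1) unfolding preserves_def vgrp_def by auto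
  next
    case (inv y)
    have "y \<in> carrier F" using inv vgrp_gens by blast
    then have "h (inv y) = inv (h y)" by simp
    moreover have "h y \<in> vgrp a c" using inv assms(1) unfolding preserves_def by auto
    ultimately show ?case using vgrp_inv unfolding vgrp_def by metis
  next
    case (eng y z)
    then have "y \<in> carrier F" "z \<in> carrier F" using generate_in_carrier[OF vgrp_gens] by blast+
    then have "h (y \<otimes> z) = h y \<otimes> h z" by simp
    then show ?case using eng vgrp_mult unfolding vgrp_def by metis
  qed (auto intro: generate.one)
qed

lemma preserves_cball:
  assumes "preserves h" "g \<in> cball a c n"
  shows "h g \<in> cball a c n"
  using assms(2)
proof (induction n arbitrary: g)
  case 0
  then show ?case using preserves_vgrp[OF assms(1)] by simp
next
  case (Suc n)
  interpret h: group_hom F F h using assms(1) by unfold_locales (simp add: preserves_def)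
  from Suc.prems obtain k e w where k: "g = k \<otimes> e \<otimes> w" "k \<in> cball a c n" "e \<in> {c, inv c}" "w \<in> vgrp a c"
    "k \<in> carrier F" "e \<in> carrier F" "w \<in> carrier F"
    by (rule cball_SucE)
  obtain v1 w1 where vw: "v1 \<in> vgrp a c" "w1 \<in> vgrp a c" "h c = v1 \<otimes> c \<otimes> w1"
    using assms(1) unfolding preserves_def by blast
  have "h (inv c) = inv w1 \<otimes> inv c \<otimes> inv v1"
    using vw by (simp add: inv_mult_group m_assoc)
  then obtain v2 w2 where e: "v2 \<in> vgrp a c" "w2 \<in> vgrp a c" "h e = v2 \<otimes> e \<otimes> w2"
  proof (cases "e = c")
    case True
    then show ?thesis using that vw by blast
  next
    case False
    then show ?thesis using that[of "inv w1" "inv v1"] k(3) vw \<open>h (inv c) = inv w1 \<otimes> inv c \<otimes> inv v1\<close> by simp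
  qed
  have c: "k \<in> carrier F" "e \<in> carrier F" "w \<in> carrier F" "h k \<in> carrier F" "h w \<in> carrier F"
    "v2 \<in> carrier F" "w2 \<in> carrier F"
    using k e by auto
  then have "h g = (h k \<otimes> v2) \<otimes> e \<otimes> (w2 \<otimes> h w)"
    unfolding k(1) by (simp add: e m_assoc)
  moreover have "h k \<otimes> v2 \<in> cball a c n" using cball_right[OF Suc.IH[OF k(2)] e(1)] .
  moreover have "w2 \<otimes> h w \<in> vgrp a c" using preserves_vgrp[OF assms(1) k(4)] e by simp
  ultimately show ?case using cball_SucI[OF _ k(3)] by simp
qed

text \<open>Neither the map nor its inverse increases displacements of the base vertex, so both keep
  them.\<close>

lemma hnn_length_preserves:
  assumes "preserves h" "preserves h'" "\<And>g. g \<in> carrier F \<Longrightarrow> h' (h g) = g" and g: "g \<in> carrier F"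
  shows "hnn_length a c (h g) = hnn_length a c g"
proof -
  interpret h: group_hom F F h using assms(1) by unfold_locales (simp add: preserves_def)
  have "clen a c (h g) = clen a c g" if g: "g \<in> carrier F" for g
  proof (rule antisym)
    show "clen a c (h g) \<le> clen a c g" using clen_le preserves_cball[OF assms(1) clen_mem[OF g]] .
    have "h' (h g) \<in> cball a c (clen a c (h g))"
      using preserves_cball[OF assms(2) clen_mem[of "h g"]] g by simp
    then show "clen a c g \<le> clen a c (h g)" using clen_le assms(3) g by simp
  qed
  from this[of g] this[of "g \<otimes> g"] show ?thesis using g by (simp add: hnn_length_def)
qed

text \<open>The Dehn twist of the splitting: it fixes the vertex group and multiplies the stable
  letter by a power of \<open>a\<close>, the generator of the edge group.\<close>

abbreviation twist :: "int \<Rightarrow> 'a \<Rightarrow> 'a" where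
  "twist \<equiv> transvection (c, True) a"

lemma cl: "(c, True) \<in> letters" "fst (c, True) \<noteq> a" "(c, False) \<in> letters" "fst (c, False) \<noteq> a"
  using ac by (auto simp: letters_def)

lemma twist_c: "twist n c = c \<otimes> a [^] n" "twist n (inv c) = a [^] (- n) \<otimes> inv c"
  using transvection_lv[OF cl(1) ac(1) cl(2) cl(1), of n] transvection_lv[OF cl(1) ac(1) cl(2) cl(3), of n]
  by (auto simp: lv_def trans_map_def)

text \<open>In the image of c a c^-1 the inserted powers commute with \<open>a\<close> and cancel;
  the other generators do not involve \<open>c\<close>.\<close>

lemma twist_vgrp: "v \<in> vgrp a c \<Longrightarrow> twist n v = v"
proof -
  interpret t: group_hom F F "twist n"
    using transvection_hom[OF cl(1) ac(1) cl(2)] by unfold_locales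
  have gens: "twist n y = y" if "y \<in> insert (c \<otimes> a \<otimes> inv c) (X - {c})" for y
    using that
  proof (elim insertE)
    assume "y = c \<otimes> a \<otimes> inv c"
    have "a \<otimes> inv (a [^] n) = inv (a [^] n) \<otimes> a"
      using int_pow_mult[of a 1 "- n"] int_pow_mult[of a "- n" 1] by (simp add: int_pow_neg)
    then have "a [^] n \<otimes> (a \<otimes> (inv (a [^] n) \<otimes> inv c)) = a \<otimes> inv c"
      by (simp add: m_assoc[symmetric])
    then show ?thesis
      using transvection_fixes[OF cl(1) ac(1) cl(2) ac(1), of n] ac \<open>y = c \<otimes> a \<otimes> inv c\<close> twist_c(2)[of n]
      by (simp add: twist_c m_assoc int_pow_neg)
  next
    assume "y \<in> X - {c}"
    then show ?thesis using transvection_fixes[OF cl(1) ac(1) cl(2)] by simp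
  qed
  assume "v \<in> vgrp a c"
  then show ?thesis
    unfolding vgrp_def
  proof (induction rule: generate.induct)
    case (inv y)
    then have "y \<in> carrier F" using vgrp_gens by blast
    then show ?case using gens[OF inv] by simp
  next
    case (eng y z)
    then have "y \<in> carrier F" "z \<in> carrier F" using generate_in_carrier[OF vgrp_gens] by blast+
    then show ?case using eng by simp
  qed (use gens in auto)
qed

section \<open>Linear growth of word length under the Dehn twist\<close>

lemma len_apow_le: "len (a [^] (n::int)) \<le> nat \<bar>n\<bar>"
  using len_val_le[of "apow a n"] apow_letters[OF ac(1)] by (simp add: val_apow[OF ac(1)])

lemma len_X: "x \<in> X \<Longrightarrow> len x \<le> 1" "x \<in> X \<Longrightarrow> len (inv x) \<le> 1"
proof -
  assume x: "x \<in> X"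
  show "len x \<le> 1" using len_val_le[of "[(x, True)]"] x X_carrier by (simp add: lv_def letters_def)
  then show "len (inv x) \<le> 1" using x X_carrier by simp
qed

text \<open>In a path of \<open>N\<close> edges each stable letter gains at most \<open>n\<close>
  letters, and the pieces in the vertex group are fixed by the twist, so they contribute
  constants.\<close>

lemma twist_upper:
  "g \<in> cball a c N \<Longrightarrow> \<exists>C. \<forall>n. len (twist (int n) g) \<le> N * n + C"
proof (induction N arbitrary: g)
  case 0
  then have "len (twist (int n) g) \<le> 0 * n + len g" for n by (simp add: twist_vgrp)
  then show ?case by blast
next
  case (Suc N)
  interpret t: group_hom F F "twist (int n)" for n
    using transvection_hom[OF cl(1) ac(1) cl(2)] by unfold_locales
  from Suc.prems obtain h e w where h: "g = h \<otimes> e \<otimes> w" "h \<in> cball a c N" "e \<in> {c, inv c}" "w \<in> vgrp a c"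
    "h \<in> carrier F" "e \<in> carrier F" "w \<in> carrier F"
    by (rule cball_SucE)
  obtain C where C: "\<And>n. len (twist (int n) h) \<le> N * n + C" using Suc.IH[OF h(2)] by blast
  have "len (twist (int n) g) \<le> Suc N * n + (C + 1 + len w)" for n
  proof -
    note cF = h(5-7)
    have "len (twist (int n) e) \<le> 1 + n"
      using h(3) len_mult[of c "a [^] int n"] len_mult[of "a [^] (- int n)" "inv c"] len_X[OF ac(2)]
        len_apow_le[of "int n"] len_apow_le[of "- int n"]
      by (auto simp: twist_c)
    moreover have "len (twist (int n) g) \<le> len (twist (int n) h) + len (twist (int n) e) + len w"
      using len_mult[of "twist (int n) h" "twist (int n) e"]
        len_mult[of "twist (int n) h \<otimes> twist (int n) e" w] cF h(4)
      unfolding h(1) by (simp add: twist_vgrp)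
    ultimately show ?thesis using C[of n] by simp
  qed
  then show ?case by blast
qed

lemma nat_abs_diff_bounds:
  "n \<le> nat \<bar>int n + p\<bar> + nat \<bar>p\<bar>" "n \<le> nat \<bar>p - int n\<bar> + nat \<bar>p\<bar>"
  by linarith+

text \<open>The word is cut at its letters other than \<open>a\<close>. A block between
  \<open>s\<close> and \<open>s1\<close> grows linearly in \<open>n\<close> exactly when one of s =
  c and s1 = c^-1 holds. If both hold the powers cancel, but then the block with its neighbours is c
  a^p c^-1 and lies in the vertex group. So \<open>M\<close> both counts the growing blocks and is
  the length of a path in the splitting. An initial c^-1 is removed from the element because its
  edge is charged to the block in front of it.\<close>

lemma twist_lower_tail:
  assumes "s # t \<in> rwords" "fst s \<noteq> a"
  shows "\<exists>M C. (if s = (c, False) then c \<otimes> val (s # t) else val (s # t)) \<in> cball a c M \<and>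
    (\<forall>n. \<exists>t'. s # t' \<in> rwords \<and>
      twist (int n) (val (s # t)) = a [^] (if s = (c, False) then - int n else 0) \<otimes> val (s # t') \<and>
      M * n \<le> length t' + C)"
  using assms
proof (induction t arbitrary: s rule: length_induct)
  case (1 t)
  have lc: "linv (c, True) = (c, False)" by simp
  note nf = transvection_normal_form_end[OF cl(1) ac(1) cl(2), unfolded lc]
    transvection_normal_form_step[OF cl(1) ac(1) cl(2), unfolded lc]
  have s: "s \<in> letters" "t \<in> rwords" using 1 by (auto simp: rwords_Cons)
  obtain p r where p: "t = apow a p @ r" "r \<in> rwords" "r = [] \<or> fst (hd r) \<noteq> a"
    using decompose_apow[OF s(2) ac(1)] .
  \<comment> \<open>The contribution of \<open>s\<close> to the path; an initial c^-1 is cancelled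
    by the extra \<open>c\<close>.\<close>
  define e where "e = (if s = (c, False) then \<one> else lv s)"
  have e: "e = c \<and> s = (c, True) \<or> e \<in> vgrp a c \<and> s \<noteq> (c, True)"
    using s vgrp_X unfolding e_def letters_def lv_def by (cases s) auto
  have eF: "e \<in> carrier F" using e by auto
  have pre: "(if s = (c, False) then c \<otimes> val (s # u) else val (s # u)) = e \<otimes> val u" if "set u \<subseteq> letters" for u
    using that s unfolding e_def by (auto simp: lv_def inv_cancel)
  have ap: "a [^] p \<in> vgrp a c" using vgrp_pow[OF vgrp_X] ac by simp
  show ?case
  proof (cases r)
    case Nil
    define M where "M = (if s = (c, True) then 1 else 0 :: nat)"
    have mem: "e \<otimes> a [^] p \<in> cball a c M"
      using e ap cball_letter_left[of "a [^] p" 0 c] unfolding M_def by auto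
    have "M * n \<le> length (apow a ((if s = (c, True) then int n else 0) + p)) + nat \<bar>p\<bar>" for n
      using nat_abs_diff_bounds(1)[of n p] by (simp add: M_def)
    note bound = this
    have v: "val (apow a m) = a [^] m" for m by (rule val_apow[OF ac(1)])
    show ?thesis
    proof (rule exI[of _ M], rule exI[of _ "nat \<bar>p\<bar>"], intro conjI allI)
      show "(if s = (c, False) then c \<otimes> val (s # t) else val (s # t)) \<in> cball a c M"
        using mem pre[OF apow_letters[OF ac(1)], of p] p(1) Nil v[of p] by (simp only: append_Nil2)
      fix n
      show "\<exists>t'. s # t' \<in> rwords \<and>
        twist (int n) (val (s # t)) = a [^] (if s = (c, False) then - int n else 0) \<otimes> val (s # t') \<and>
        M * n \<le> length t' + nat \<bar>p\<bar>"
        using nf(1,2)[OF s(1) 1(3)] bound[of n] p(1) Nil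
        by (intro exI[of _ "apow a ((if s = (c, True) then int n else 0) + p)"]) (simp only: append_Nil2 simp_thms)
    qed
  next
    case (Cons s1 t1)
    have s1: "s1 # t1 \<in> rwords" "fst s1 \<noteq> a" using p Cons by auto
    have "length t1 < length t" using p Cons by simp
    then obtain M C where M: "(if s1 = (c, False) then c \<otimes> val (s1 # t1) else val (s1 # t1)) \<in> cball a c M"
      and C: "\<And>n. \<exists>t'. s1 # t' \<in> rwords \<and>
        twist (int n) (val (s1 # t1)) = a [^] (if s1 = (c, False) then - int n else 0) \<otimes> val (s1 # t') \<and>
        M * n \<le> length t' + C"
      using 1(1) s1 by metis
    \<comment> \<open>One more edge exactly when the block between \<open>s\<close> and
      \<open>s1\<close> grows.\<close>
    define k where "k = (if (s = (c, True)) \<noteq> (s1 = (c, False)) then 1 else 0 :: nat)"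
    define A where "A = val (s1 # t1)"
    have AF: "A \<in> carrier F" using s1 by (auto simp: A_def rwords_def simp del: ev_Cons)
    have vt: "val (apow a p @ s1 # t1) = a [^] p \<otimes> A"
      using s1 apow_letters[OF ac(1)] unfolding A_def by (subst val_append) (auto simp: rwords_def val_apow[OF ac(1)])
    have mem: "e \<otimes> (a [^] p \<otimes> A) \<in> cball a c (M + k)"
    proof (cases "s1 = (c, False)")
      case True
      define G where "G = c \<otimes> A"
      have G: "G \<in> cball a c M" "A = inv c \<otimes> G" "G \<in> carrier F"
        using M True AF by (auto simp: G_def A_def inv_cancel)
      show ?thesis
      proof (cases "s = (c, True)")
        case True
        \<comment> \<open>The stable letter and its inverse around a power of \<open>a\<close> form
          an element of the vertex group, so no edge is added.\<close>
        then have "e \<otimes> (a [^] p \<otimes> A) = (c \<otimes> a [^] p \<otimes> inv c) \<otimes> G"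
          using e G by (auto simp: m_assoc)
        then show ?thesis
          using cball_left[OF G(1) vgrp_conj_pow[of p]] True \<open>s1 = (c, False)\<close> unfolding k_def by simp
      next
        case False
        then have "e \<otimes> (a [^] p \<otimes> A) \<in> cball a c (Suc M)"
          using cball_left[OF cball_left[OF cball_letter_left[OF G(1), of "inv c"] ap]] e G(2) by auto
        then show ?thesis using False \<open>s1 = (c, False)\<close> unfolding k_def by simp
      qed
    next
      case False
      then have A: "A \<in> cball a c M" using M by (simp add: A_def)
      show ?thesis
        using e cball_letter_left[OF cball_left[OF A ap], of c] cball_left[OF cball_left[OF A ap]] False
        unfolding k_def by auto
    qed
    moreover have "\<exists>t'. s # t' \<in> rwords \<and>
      twist (int n) (val (s # t)) = a [^] (if s = (c, False) then - int n else 0) \<otimes> val (s # t') \<and>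
      (M + k) * n \<le> length t' + (C + nat \<bar>p\<bar>)" for n
    proof -
      obtain t1' where t1': "s1 # t1' \<in> rwords" "M * n \<le> length t1' + C"
        "twist (int n) (val (s1 # t1)) = a [^] (if s1 = (c, False) then - int n else 0) \<otimes> val (s1 # t1')"
        using C by blast
      define q where "q = (if s = (c, True) then int n else 0) + p + (if s1 = (c, False) then - int n else 0)"
      have "k * n \<le> nat \<bar>q\<bar> + nat \<bar>p\<bar>"
        using nat_abs_diff_bounds[of n p] by (simp add: k_def q_def add.commute)
      then have "(M + k) * n \<le> length (apow a q @ s1 # t1') + (C + nat \<bar>p\<bar>)"
        using t1'(2) by (simp add: add_mult_distrib)
      then show ?thesis
        using nf(3,4)[OF _ 1(3) s1(2) t1'(1,3), of p] 1(2) p(1) Cons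
        by (intro exI[of _ "apow a q @ s1 # t1'"]) (simp only: q_def simp_thms)
    qed
    moreover have "set t \<subseteq> letters" using s by (simp add: rwords_def)
    ultimately show ?thesis
      using pre[of t] vt p(1) Cons by (rule_tac exI[of _ "M + k"], rule_tac exI[of _ "C + nat \<bar>p\<bar>"]) (simp only: simp_thms)
  qed
qed

text \<open>Only the power of \<open>a\<close> in front of the first other letter remains to be
  counted; it grows exactly when that letter is c^-1. The path length obtained is at least
  \<open>clen a c g\<close> by minimality.\<close>

lemma twist_lower:
  assumes g: "g \<in> carrier F"
  shows "\<exists>C. \<forall>n. clen a c g * n \<le> len (twist (int n) g) + C"
proof -
  have "\<exists>N C. g \<in> cball a c N \<and> (\<forall>n. N * n \<le> len (twist (int n) g) + C)"
  proof -
    obtain p r where p: "rw g = apow a p @ r" "r \<in> rwords" "r = [] \<or> fst (hd r) \<noteq> a"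
      using decompose_apow[OF rw_rwords[OF g] ac(1)] .
    have vg: "g = a [^] p \<otimes> val r"
      using val_append[OF apow_letters[OF ac(1), of p], of r] val_rw[OF g] p
      by (simp add: val_apow[OF ac(1)] rwords_def)
    have ap: "a [^] p \<in> vgrp a c" using vgrp_pow[OF vgrp_X] ac by simp
    show ?thesis
    proof (cases r)
      case Nil
      then show ?thesis using vg ap by (intro exI[of _ 0]) auto
    next
      case (Cons s t)
      then have st: "s # t \<in> rwords" "fst s \<noteq> a" using p by auto
      obtain M C where M: "(if s = (c, False) then c \<otimes> val (s # t) else val (s # t)) \<in> cball a c M"
        and C: "\<And>n. \<exists>t'. s # t' \<in> rwords \<and>
          twist (int n) (val (s # t)) = a [^] (if s = (c, False) then - int n else 0) \<otimes> val (s # t') \<and>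
          M * n \<le> length t' + C"
        using twist_lower_tail[OF st] by metis
      define k where "k = (if s = (c, False) then 1 else 0 :: nat)"
      have vF: "val (s # t) \<in> carrier F" using st by (auto simp: rwords_def simp del: ev_Cons)
      have "val (s # t) \<in> cball a c (M + k)"
        using M cball_letter_left[OF M, of "inv c"] vF unfolding k_def
        by (auto simp: inv_cancel simp del: ev_Cons split: if_splits)
      then have "g \<in> cball a c (M + k)" using cball_left ap vg Cons by metis
      moreover have "(M + k) * n \<le> len (twist (int n) g) + (C + nat \<bar>p\<bar>)" for n
      proof -
        obtain t' where t': "s # t' \<in> rwords" "M * n \<le> length t' + C"
          "twist (int n) (val (s # t)) = a [^] (if s = (c, False) then - int n else 0) \<otimes> val (s # t')"
          using C by blast
        define q where "q = p + (if s = (c, False) then - int n else 0)"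
        have cF: "val (s # t') \<in> carrier F" using t' by (auto simp: rwords_def simp del: ev_Cons)
        have "twist (int n) g = a [^] q \<otimes> val (s # t')"
          using vg vF cF t'(3) Cons unfolding q_def
          by (simp add: transvection_mult[OF cl(1) ac(1) cl(2)] transvection_apow[OF cl(1) ac(1) cl(2)]
              int_pow_mult m_assoc del: ev_Cons)
        also have "\<dots> = val (apow a q @ s # t')"
          using t' apow_letters[OF ac(1)] by (subst val_append) (auto simp: rwords_def val_apow[OF ac(1)])
        finally have "rw (twist (int n) g) = apow a q @ s # t'"
          using rw_val[OF apow_append_rwords[OF ac(1) t'(1) st(2)]] by simp
        moreover have "k * n \<le> nat \<bar>q\<bar> + nat \<bar>p\<bar>"
          using nat_abs_diff_bounds[of n p] by (simp add: k_def q_def)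
        ultimately show ?thesis using t'(2) by (simp add: len_def add_mult_distrib)
      qed
      ultimately show ?thesis by blast
    qed
  qed
  then obtain N C where "g \<in> cball a c N" "\<And>n. N * n \<le> len (twist (int n) g) + C" by blast
  moreover from this have "clen a c g * n \<le> N * n" for n using clen_le by simp
  ultimately show ?thesis using le_trans by blast
qed

text \<open>A shortest path bounds the growth from above, and the path found in
  \<open>twist_lower\<close> is at least as long, so the two slopes agree.\<close>

lemma twist_growth:
  assumes g: "g \<in> carrier F"
  shows "(\<lambda>n. real (len (twist (int n) g)) / real n) \<longlonglongrightarrow> real (clen a c g)"
proof -
  obtain C where C: "\<And>n. len (twist (int n) g) \<le> clen a c g * n + C"
    using twist_upper[OF clen_mem[OF g]] by blast
  obtain D where D: "\<And>n. clen a c g * n \<le> len (twist (int n) g) + D"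
    using twist_lower[OF g] by blast
  have "(\<lambda>n. real (len (twist (int n) g)) / real n - real (clen a c g)) \<longlonglongrightarrow> 0"
  proof (rule Lim_null_comparison)
    show "\<forall>\<^sub>F n in sequentially. norm (real (len (twist (int n) g)) / real n - real (clen a c g)) \<le> real (C + D) / real n"
      using eventually_gt_at_top[of 0]
    proof eventually_elim
      case (elim n)
      have "real (len (twist (int n) g)) \<le> real (clen a c g) * real n + real C"
        "real (clen a c g) * real n \<le> real (len (twist (int n) g)) + real D"
        using C[of n] D[of n] by (metis of_nat_add of_nat_le_iff of_nat_mult)+
      then have "\<bar>real (len (twist (int n) g)) - real (clen a c g) * real n\<bar> \<le> real (C + D)" by simp
      moreover have "real (len (twist (int n) g)) / real n - real (clen a c g) =
          (real (len (twist (int n) g)) - real (clen a c g) * real n) / real n"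
        using elim by (simp add: field_simps)
      ultimately show ?case using elim by (simp add: divide_right_mono abs_divide)
    qed
    show "(\<lambda>n. real (C + D) / real n) \<longlonglongrightarrow> 0" by (rule lim_const_over_n)
  qed
  then show ?thesis by (simp add: LIM_zero_iff)
qed

section \<open>The limit tree as a boundary point of outer space\<close>

definition approx :: "nat \<Rightarrow> 'a \<Rightarrow> real" where
  "approx n = (\<lambda>g\<in>carrier F. real (len (twist (int n) (g \<otimes> g))) - real (len (twist (int n) g)))"

lemma approx_cv: "approx n \<in> cv F"
  unfolding approx_def
  by (rule cv_twisted_length[OF transvection_auto[OF cl(1) ac(1) cl(2)]])

lemma approx_lim: "g \<in> carrier F \<Longrightarrow> (\<lambda>n. approx n g / real n) \<longlonglongrightarrow> hnn_length a c g"
  using tendsto_diff[OF twist_growth[of "g \<otimes> g"] twist_growth[of g]]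
  by (simp add: approx_def hnn_length_def diff_divide_distrib)

lemma hnn_length_conj:
  assumes "g \<in> carrier F" "w \<in> carrier F"
  shows "hnn_length a c (g \<otimes> w \<otimes> inv g) = hnn_length a c w"
  using approx_lim[of "g \<otimes> w \<otimes> inv g"] approx_lim[of w] cv_conj[OF approx_cv assms] assms
  by (simp add: LIMSEQ_unique)

lemma hnn_length_vgrp: "v \<in> vgrp a c \<Longrightarrow> hnn_length a c v = 0"
proof -
  assume v: "v \<in> vgrp a c"
  then have "clen a c v = 0" "clen a c (v \<otimes> v) = 0"
    using clen_le[of v 0] clen_le[of "v \<otimes> v" 0] by auto
  then show ?thesis using v by (simp add: hnn_length_def)
qed

text \<open>The endomorphism that keeps \<open>c\<close> and kills the other basis elements is
  trivial on the vertex group. As \<open>c\<close> has infinite order, it moves the base vertex by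
  1, and its square moves it by neither 0 nor 1.\<close>

lemma hnn_length_c: "hnn_length a c c \<noteq> 0"
proof -
  define f where "f l = (if fst l = c then lv l else \<one>)" for l :: "'a \<times> bool"
  have lm: "lmap f" unfolding lmap_def f_def by (auto simp: lv_linv)
  interpret f: group_hom F F "ext f" using ext_hom[OF lm] by unfold_locales
  have fX: "ext f x = (if x = c then c else \<one>)" if "x \<in> X" for x
    using ext_lv[OF lm, of "(x, True)"] that X_carrier by (auto simp: letters_def lv_def f_def)
  have vg: "ext f v = \<one>" if "v \<in> vgrp a c" for v
    using that unfolding vgrp_def
  proof (induction rule: generate.induct)
    case (incl y)
    then show ?case using fX ac by auto
  next
    case (inv y)
    then have "y \<in> carrier F" using vgrp_gens by blast
    moreover have "ext f y = \<one>" using inv fX ac by auto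
    ultimately show ?case by simp
  next
    case (eng y z)
    then show ?case using generate_in_carrier[OF vgrp_gens] by (metis f.hom_mult l_one one_closed)
  qed simp
  have cn: "c [^] n = \<one> \<Longrightarrow> n = 0" for n :: nat
  proof -
    assume "c [^] n = \<one>"
    moreover have "val (replicate n (c, True)) = c [^] n"
      by (induction n) (auto simp: lv_def nat_pow_Suc2[symmetric] simp del: nat_pow_Suc)
    moreover have "replicate n (c, True) \<in> rwords" using ac by (auto simp: rwords_def letters_def successively_conv_nth)
    ultimately show "n = 0" using rw_val[of "replicate n (c, True)"] by simp
  qed
  have c1: "c \<in> cball a c 1" using cball_letter_right[of \<one> 0 c] by simp
  have fc: "ext f c = c" using fX[OF ac(2)] by simp
  have "c \<notin> vgrp a c"
    using vg[of c] fc cn[of 1] by auto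
  then have "clen a c c \<noteq> 0" using clen_mem[OF acF(2)] cball_0 by metis
  then have "clen a c c = 1" using clen_le[OF c1] by simp
  moreover have "clen a c (c \<otimes> c) \<noteq> 0"
  proof
    assume "clen a c (c \<otimes> c) = 0"
    then have "c \<otimes> c \<in> vgrp a c" using clen_mem[of "c \<otimes> c"] cball_0 by simp
    then have "c [^] (2::nat) = \<one>" using vg[of "c \<otimes> c"] fc by (simp add: numeral_2_eq_2)
    then show False using cn[of 2] by simp
  qed
  moreover have "clen a c (c \<otimes> c) \<noteq> 1"
  proof
    assume "clen a c (c \<otimes> c) = 1"
    then have "c \<otimes> c \<in> cball a c (Suc 0)" using clen_mem[of "c \<otimes> c"] by simp
    then obtain v e w where v: "c \<otimes> c = v \<otimes> e \<otimes> w" "v \<in> cball a c 0" "e \<in> {c, inv c}" "w \<in> vgrp a c"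
      "v \<in> carrier F" "e \<in> carrier F" "w \<in> carrier F"
      by (rule cball_SucE)
    have "ext f (c \<otimes> c) = ext f v \<otimes> ext f e \<otimes> ext f w" unfolding v(1) using v(5-7) by simp
    then have "ext f (c \<otimes> c) = ext f e" using vg[of v] vg[of w] v(2,4,6) by simp
    moreover have "ext f (c \<otimes> c) = c \<otimes> c" "ext f e = e" using fc v(3) by auto
    ultimately have "c \<otimes> c = c \<or> c \<otimes> c = inv c" using v(3) by auto
    moreover have "c [^] (1::nat) = \<one>" if "c \<otimes> c = c"
      using that inv_cancel(1)[of c c] by simp
    moreover have "c [^] (3::nat) = \<one>" if "c \<otimes> c = inv c"
      using that by (simp add: numeral_3_eq_3)
    ultimately have "c [^] (1::nat) = \<one> \<or> c [^] (3::nat) = \<one>" by blast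
    then show False using cn[of 1] cn[of 3] by auto
  qed
  ultimately show ?thesis by (auto simp: hnn_length_def)
qed

lemma proj_class_scale: "k \<noteq> 0 \<Longrightarrow> proj_class F (\<lambda>g\<in>carrier F. k * l g) = proj_class F l"
proof -
  assume k: "k \<noteq> 0"
  have "\<exists>r. (\<lambda>g\<in>carrier F. s * l g) = (\<lambda>g\<in>carrier F. r * (\<lambda>g\<in>carrier F. k * l g) g) \<and> r \<noteq> 0" if "s \<noteq> 0" for s
    using k that by (intro exI[of _ "s / k"]) (auto simp: fun_eq_iff)
  moreover have "\<exists>r. (\<lambda>g\<in>carrier F. s * (\<lambda>g\<in>carrier F. k * l g) g) = (\<lambda>g\<in>carrier F. r * l g) \<and> r \<noteq> 0" if "s \<noteq> 0" for s
    using k that by (intro exI[of _ "s * k"]) (auto simp: fun_eq_iff)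
  ultimately show ?thesis unfolding proj_class_def by blast
qed

text \<open>Rescaling by \<open>1 / n\<close> does not change projective classes, so classes of
  twisted Cayley trees converge to this one. It is outside \<open>CV F\<close> because
  \<open>a\<close> has length zero.\<close>

lemma hnn_boundary: "proj_class F (hnn_length a c) \<in> boundary_CV F"
proof -
  let ?P = "subtopology (product_topology (\<lambda>_. euclideanreal) (carrier F)) (- {\<lambda>g\<in>carrier F. 0})"
  have hext: "hnn_length a c \<in> extensional (carrier F)" by (simp add: hnn_length_def)
  have htop: "hnn_length a c \<in> topspace ?P"
    using hext hnn_length_c by (auto simp: PiE_def fun_eq_iff)
  define f where "f n = (\<lambda>g\<in>carrier F. (1 / real n) * approx n g)" for n
  have lim: "limitin ?P f (hnn_length a c) sequentially"
  proof -
    \<comment> \<open>Nonvanishing at \<open>c\<close> keeps the rescaled functions in the space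
      that is projectivised. That \<open>c\<close> is not the identity is seen from the limit
      length.\<close>
    have c0: "approx n c \<noteq> 0" for n
      using cv_nonzero[OF approx_cv, of c n] hnn_length_c hnn_length_vgrp[OF vgrp_one] by auto
    have "\<forall>\<^sub>F n in sequentially. f n \<in> - {\<lambda>g\<in>carrier F. 0}"
      using eventually_gt_at_top[of 0]
    proof eventually_elim
      case (elim n)
      then have "f n c \<noteq> 0" using c0 by (simp add: f_def)
      then show ?case by auto
    qed
    moreover have "limitin (product_topology (\<lambda>_. euclideanreal) (carrier F)) f (hnn_length a c) sequentially"
      unfolding limitin_componentwise using hext approx_lim by (auto simp: f_def)
    ultimately show ?thesis using htop unfolding limitin_subtopology by auto
  qed
  have "proj_class F (hnn_length a c) \<in> PR_topology F closure_of CV F"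
    unfolding in_closure_of
  proof (intro conjI allI impI)
    show "proj_class F (hnn_length a c) \<in> topspace (PR_topology F)"
      unfolding PR_topology_def using htop by auto
    fix U assume "proj_class F (hnn_length a c) \<in> U \<and> openin (PR_topology F) U"
    then have U: "proj_class F (hnn_length a c) \<in> U" "openin (PR_topology F) U" by auto
    define V where "V = {x \<in> topspace ?P. proj_class F x \<in> U}"
    have "openin ?P V" using U(2) unfolding PR_topology_def openin_quotient_topology V_def by simp
    moreover have "hnn_length a c \<in> V" using U htop by (simp add: V_def)
    ultimately have "\<forall>\<^sub>F n in sequentially. f n \<in> V" using lim unfolding limitin_def by blast
    then have "\<forall>\<^sub>F n in sequentially. f n \<in> V \<and> n > 0" using eventually_gt_at_top eventually_conj by blast
    then obtain n where n: "f n \<in> V" "n > 0" by (auto simp: eventually_sequentially)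
    have "proj_class F (f n) = proj_class F (approx n)"
      using proj_class_scale[of "1 / real n" "approx n"] n by (simp add: f_def)
    moreover have "proj_class F (approx n) \<in> CV F" unfolding CV_def using approx_cv by blast
    ultimately show "\<exists>y. y \<in> CV F \<and> y \<in> U" using n unfolding V_def by auto
  qed
  moreover have "proj_class F (hnn_length a c) \<notin> CV F"
  proof
    assume "proj_class F (hnn_length a c) \<in> CV F"
    then obtain l where l: "l \<in> cv F" "proj_class F (hnn_length a c) = proj_class F l"
      unfolding CV_def by auto
    have "l = (\<lambda>g\<in>carrier F. 1 * l g)"
      using l(1) unfolding cv_def length_function_def by auto
    then have "l \<in> proj_class F l" unfolding proj_class_def by (intro CollectI exI[of _ "1::real"] conjI one_neq_zero)
    then obtain k where "l = (\<lambda>g\<in>carrier F. k * hnn_length a c g)"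
      using l(2) unfolding proj_class_def by auto
    then have "l a = 0" using hnn_length_vgrp[OF vgrp_X[OF ac(1)]] ac by simp
    moreover have "a \<noteq> \<one>"
    proof
      assume "a = \<one>"
      then have "val [(a, True)] = val []" by (simp add: lv_def)
      moreover have "[(a, True)] \<in> rwords" using ac by (simp add: rwords_def letters_def)
      ultimately show False using rw_val[of "[(a, True)]"] by simp
    qed
    ultimately show False using cv_nonzero[OF l(1)] by simp
  qed
  ultimately show ?thesis by (simp add: boundary_CV_def)
qed

end

end

section \<open>Lines in the Cayley tree\<close>

text \<open>The sets are disjoint inside a set of finite measure, and \<open>c\<close> is the ratio
  of consecutive masses. In the direction where masses do not decrease, arbitrarily many of them
  have at least the mass of \<open>K 0\<close>, which must be zero.\<close>

lemma wandering_null: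
  fixes K :: "int \<Rightarrow> 'b set"
  assumes f: "f \<in> measurable M M" "distr M M f = scale_measure (ennreal c) M" "c > 0"
    and K: "\<And>n. K n \<in> sets M" "\<And>n. f -` K (n + 1) \<inter> space M = K n" "disjoint_family K" "\<And>n. K n \<subseteq> L"
    and L: "L \<in> sets M" "emeasure M L < \<infinity>"
  shows "K 0 \<in> null_sets M"
proof -
  define k where "k n = measure M (K n)" for n
  have fin: "emeasure M (K n) \<noteq> \<infinity>" for n
    using emeasure_mono[OF K(4) L(1), of n] L(2) by (auto simp: top_unique)
  have step: "k n = c * k (n + 1)" for n
  proof -
    have "k n = measure (distr M M f) (K (n + 1))"
      using measure_distr[OF f(1) K(1)[of "n + 1"]] K(2)[of n] by (simp add: k_def)
    then show ?thesis using f(2,3) by (simp add: k_def)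
  qed
  have nonneg: "k n \<ge> 0" for n by (simp add: k_def)
  \<comment> \<open>The sign \<open>s\<close> picks that direction: upwards for
    \<open>c \<le> 1\<close>, downwards otherwise.\<close>
  have "\<exists>s::int. s \<noteq> 0 \<and> (\<forall>n::nat. k 0 \<le> k (s * int n))"
  proof (cases "c \<le> 1")
    case True
    have "k 0 \<le> k (1 * int n)" for n
    proof (induction n)
      case (Suc n)
      have "k (int n) \<le> k (int n + 1)"
        using step[of "int n"] True nonneg[of "int n + 1"] by (metis mult_left_le_one_le f(3) less_imp_le)
      then show ?case using Suc by (simp add: add.commute)
    qed simp
    then show ?thesis by (intro exI[of _ 1]) auto
  next
    case False
    have "k 0 \<le> k (- 1 * int n)" for n
    proof (induction n)
      case (Suc n)
      have "k (- int n) \<le> k (- int n - 1)"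
        using step[of "- int n - 1"] False nonneg[of "- int n"] by (simp add: mult_le_cancel_right1)
      moreover have "- 1 * int (Suc n) = - int n - 1" by simp
      ultimately show ?case using Suc by (metis mult_minus1 order_trans)
    qed simp
    then show ?thesis by (intro exI[of _ "- 1"]) auto
  qed
  then obtain s :: int where s: "s \<noteq> 0" "\<And>n::nat. k 0 \<le> k (s * int n)" by blast
  have "real N * k 0 \<le> measure M L" for N
  proof -
    have "real N * k 0 = (\<Sum>i<N. k 0)" by simp
    also have "\<dots> \<le> (\<Sum>i<N. k (s * int i))" by (intro sum_mono s)
    also have "\<dots> = measure M (\<Union>i<N. K (s * int i))"
    proof -
      have "disjoint_family_on (\<lambda>i. K (s * int i)) {..<N}"
        using K(3) s(1) by (auto simp: disjoint_family_on_def)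
      then have "measure M (\<Union>i<N. K (s * int i)) = (\<Sum>i<N. measure M (K (s * int i)))"
        using K(1) fin by (intro measure_finite_Union) auto
      then show ?thesis by (simp add: k_def)
    qed
    also have "\<dots> \<le> measure M L"
    proof (rule measure_mono_fmeasurable)
      show "(\<Union>i<N. K (s * int i)) \<subseteq> L" using K(4) by blast
    qed (use K L in \<open>auto intro: fmeasurableI\<close>)
    finally show ?thesis .
  qed
  then have "k 0 \<le> 0" by (metis ex_less_of_nat_mult linorder_not_le)
  then have "measure M (K 0) = 0" using nonneg[of 0] unfolding k_def by (rule order_antisym)
  then have "emeasure M (K 0) = 0" using fin[of 0] by (simp add: measure_def enn2real_eq_0_iff)
  then show ?thesis using K(1) by auto
qed

context free_gp_fin
begin

abbreviation T2 :: "('a bpoint \<times> 'a bpoint) topology" where "T2 \<equiv> boundary2_topology F X"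

definition pairs :: "('a bpoint \<times> 'a bpoint) set" where
  "pairs = {(p, q). p \<in> bdry \<and> q \<in> bdry \<and> p \<noteq> q}"

lemma topspace_T2: "topspace T2 = pairs"
  unfolding boundary2_topology_def pairs_def by auto

text \<open>The lines in the Cayley tree that pass through the identity and continue along the path \<open>z # w\<close>.\<close>

definition rect :: "'a \<times> bool \<Rightarrow> ('a \<times> bool) list \<Rightarrow> ('a bpoint \<times> 'a bpoint) set" where
  "rect z w = (bdry - cyl [z]) \<times> cyl (z # w)"

lemma rect_pairs: "rect z w \<subseteq> pairs"
  using cyl_append[of _ "[z]" w] cyl_bdry unfolding rect_def pairs_def by auto

lemma rect_open: "openin T2 (rect z w)"
proof -
  have "openin (prod_topology (boundary_topology F X) (boundary_topology F X)) (rect z w)"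
    unfolding rect_def openin_prod_Times_iff
    using cyl_open[of "z # w"] openin_diff[OF openin_topspace cyl_closed[of "[z]"]] by simp
  then show ?thesis
    unfolding boundary2_topology_def openin_subtopology
    using rect_pairs[of z w] unfolding pairs_def by (intro exI[of _ "rect z w"]) auto
qed

lemma rect_compact: "compactin T2 (rect z w)"
proof -
  have "compactin (prod_topology (boundary_topology F X) (boundary_topology F X)) (rect z w)"
    unfolding rect_def compactin_Times using cyl_compact by blast
  then show ?thesis
    unfolding boundary2_topology_def compactin_subtopology
    using rect_pairs[of z w] unfolding pairs_def by auto
qed

lemma boundary2_map_pairs:
  assumes c: "coarse f f'" and x: "x \<in> pairs"
  shows "boundary2_map f x \<in> pairs"
proof -
  obtain p q where pq: "x = (p, q)" "p \<in> bdry" "q \<in> bdry" "p \<noteq> q" using x unfolding pairs_def by auto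
  then have "boundary_map f p \<noteq> boundary_map f q" using boundary_map_inverse[OF c] by metis
  then show ?thesis using pq boundary_map_bdry[OF c] unfolding pairs_def boundary2_map_def by simp
qed

lemma boundary2_map_inverse:
  "coarse f f' \<Longrightarrow> x \<in> pairs \<Longrightarrow> boundary2_map f' (boundary2_map f x) = x"
  using boundary_map_inverse[of f f'] unfolding pairs_def boundary2_map_def by auto

lemma boundary2_map_comp: "boundary2_map f (boundary2_map h x) = boundary2_map (\<lambda>g. f (h g)) x"
  by (cases x) (simp add: boundary2_map_def boundary_map_comp)

lemma boundary2_map_cong:
  "(\<And>g. g \<in> carrier F \<Longrightarrow> f g = h g) \<Longrightarrow> x \<in> pairs \<Longrightarrow> boundary2_map f x = boundary2_map h x"
  using boundary_map_cong[of f h] unfolding boundary2_map_def pairs_def by auto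

lemma boundary2_map_swap: "boundary2_map f (prod.swap x) = prod.swap (boundary2_map f x)"
  by (cases x) (simp add: boundary2_map_def)

lemma boundary2_map_continuous:
  assumes c: "coarse f f'"
  shows "continuous_map T2 T2 (boundary2_map f)"
proof -
  have "boundary2_map f = (\<lambda>(p, q). (boundary_map f p, boundary_map f q))"
    by (auto simp: boundary2_map_def fun_eq_iff)
  then have "continuous_map (prod_topology (boundary_topology F X) (boundary_topology F X))
      (prod_topology (boundary_topology F X) (boundary_topology F X)) (boundary2_map f)"
    using boundary_map_continuous[OF c] by (simp add: continuous_map_prod_top)
  then have "continuous_map T2 (prod_topology (boundary_topology F X) (boundary_topology F X)) (boundary2_map f)"
    unfolding boundary2_topology_def by (rule continuous_map_from_subtopology)
  moreover have "boundary2_map f \<in> topspace T2 \<rightarrow> {(p, q). p \<noteq> q}"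
  proof
    fix x assume "x \<in> topspace T2"
    then have "boundary2_map f x \<in> pairs" unfolding topspace_T2 by (rule boundary2_map_pairs[OF c])
    then show "boundary2_map f x \<in> {(p, q). p \<noteq> q}" by (cases "boundary2_map f x") (simp add: pairs_def)
  qed
  ultimately show ?thesis
    unfolding boundary2_topology_def[of F X] by (metis boundary2_topology_def continuous_map_into_subtopology)
qed

lemma swap_continuous: "continuous_map T2 T2 prod.swap"
proof -
  have "continuous_map (prod_topology (boundary_topology F X) (boundary_topology F X))
      (prod_topology (boundary_topology F X) (boundary_topology F X)) (\<lambda>x. (snd x, fst x))"
    by (intro continuous_map_pairedI continuous_map_fst continuous_map_snd)
  then have "continuous_map T2 (prod_topology (boundary_topology F X) (boundary_topology F X)) prod.swap"
    unfolding boundary2_topology_def prod.swap_def by (rule continuous_map_from_subtopology)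
  moreover have "prod.swap \<in> topspace T2 \<rightarrow> {(p, q). p \<noteq> q}"
    unfolding topspace_T2 pairs_def by auto
  ultimately show ?thesis
    by (metis boundary2_topology_def continuous_map_into_subtopology)
qed

lemma coarse_id: "coarse (\<lambda>g. g) (\<lambda>g. g)"
  unfolding coarse_def proper_map_def by auto

lemma boundary2_map_ident: "boundary2_map (\<lambda>g. g) x = x"
  by (cases x) (simp add: boundary2_map_def boundary_map_def comp_def)

section \<open>Reading off exponents and recognising the axis\<close>

lemma cyl_comparable:
  assumes "q \<in> cyl w" "q \<in> cyl v" "length w \<le> length v"
  shows "take (length w) v = w"
  using cyl_unique[OF cyl_take[OF assms(2), of "length w"] assms(1)] assms(3) by simp

text \<open>The letter \<open>y\<close> marks the end of the block of \<open>a\<close>, so the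
  exponent can be read off from the infinite word.\<close>

lemma cyl_apow_disjoint:
  assumes "q \<in> cyl (z # apow a m @ [y])" "q \<in> cyl (z # apow a n @ [y])" "fst y \<noteq> a"
  shows "m = n"
proof -
  have *: "m = n" if q: "q \<in> cyl (z # apow a m @ [y])" "q \<in> cyl (z # apow a n @ [y])" and le: "nat \<bar>m\<bar> \<le> nat \<bar>n\<bar>" for m n
  proof -
    have e: "take (Suc (nat \<bar>m\<bar>)) (apow a n @ [y]) = apow a m @ [y]"
      using cyl_comparable[OF q] le by simp
    have "nat \<bar>m\<bar> = nat \<bar>n\<bar>"
    proof (rule ccontr)
      assume "nat \<bar>m\<bar> \<noteq> nat \<bar>n\<bar>"
      then have "take (Suc (nat \<bar>m\<bar>)) (apow a n @ [y]) = take (Suc (nat \<bar>m\<bar>)) (apow a n)" using le by simp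
      then have "y \<in> set (apow a n)" using e by (metis in_set_conv_decomp in_set_takeD)
      then show False using set_apow[of a n] assms(3) by auto
    qed
    then have "apow a m = apow a n" using e by simp
    then show "m = n"
      using \<open>nat \<bar>m\<bar> = nat \<bar>n\<bar>\<close> hd_apow(1)[of m a] hd_apow(1)[of n a] by (cases "m = 0") (auto split: if_splits)
  qed
  show ?thesis
    using *[OF assms(1,2)] *[OF assms(2,1)] by linarith
qed

text \<open>The attracting end of \<open>a\<close> for \<open>e = True\<close>, the repelling end
  otherwise.\<close>

definition ax :: "'a \<Rightarrow> bool \<Rightarrow> 'a bpoint" where
  "ax a e = cls (\<lambda>n. val (replicate n (a, e)))"

lemma ax:
  assumes a: "a \<in> X"
  shows "ax a e \<in> bdry" "ax a e \<in> cyl (replicate n (a, e))"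
proof -
  let ?u = "\<lambda>n. val (replicate n (a, e))"
  have r: "rw (?u n) = replicate n (a, e)" for n
    using a by (intro rw_val) (auto simp: rwords_def letters_def successively_conv_nth)
  have "?u \<in> seqs"
    unfolding seqs_iff
  proof (intro conjI allI)
    show "range ?u \<subseteq> carrier F" using a by (auto intro!: val_closed simp: letters_def)
    fix N
    have "N \<le> gp (?u i) (?u j)" if "i \<ge> N" "j \<ge> N" for i j
      unfolding gp_def r le_common_prefix_iff using that by (simp add: min_def)
    then show "\<exists>K. \<forall>i\<ge>K. \<forall>j\<ge>K. N \<le> gp (?u i) (?u j)" by blast
  qed
  moreover have "evp (replicate n (a, e)) ?u"
    unfolding evp_def eventually_sequentially r by (intro exI[of _ n]) (simp add: min_def)
  ultimately show "ax a e \<in> bdry" "ax a e \<in> cyl (replicate n (a, e))"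
    unfolding ax_def bdry_eq using cls_cyl by auto
qed

lemma ax_pairs: "a \<in> X \<Longrightarrow> (ax a (\<not> e), ax a e) \<in> rect (a, e) []"
  using ax(1)[of a "\<not> e"] ax(2)[of a "\<not> e" 1] ax(2)[of a e 1] cyl_unique[of "ax a (\<not> e)" "[(a, e)]" "[(a, \<not> e)]"]
  unfolding rect_def by auto

text \<open>By reducedness the sign cannot change as long as the word stays in the letter
  \<open>a\<close>, so all prefixes are determined.\<close>

lemma ax_eqI:
  assumes a: "a \<in> X" and q: "q \<in> cyl [(a, e)]"
    and ext: "\<And>n y. q \<in> cyl (replicate (Suc n) (a, e) @ [y]) \<Longrightarrow> fst y = a"
  shows "q = ax a e"
proof -
  have n: "q \<in> cyl (replicate (Suc n) (a, e))" for n
  proof (induction n)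
    case (Suc n)
    obtain y where y: "q \<in> cyl (replicate (Suc n) (a, e) @ [y])" using cyl_extend[OF Suc] by blast
    then have "replicate n (a, e) @ [(a, e), y] \<in> rwords"
      using cyl_rwords[OF y] by (simp add: replicate_append_same[symmetric] del: replicate_append_same)
    then have "[(a, e), y] \<in> rwords" using rwords_append by blast
    then have "y = (a, e)" using same_fst[of "(a, e)" y] ext[OF y] by (auto simp: rwords_Cons)
    then show ?case using y by (simp add: replicate_append_same)
  qed (use q in simp)
  show ?thesis
  proof (rule bdry_eqI[OF cyl_bdry[OF q] ax(1)[OF a]])
    fix w assume w: "q \<in> cyl w"
    have "take (length w) (replicate (Suc (length w)) (a, e)) = w"
      by (rule cyl_comparable[OF w n]) simp
    then have "w = replicate (length w) (a, e)" by (simp add: min_def del: replicate_Suc)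
    then show "ax a e \<in> cyl w" using ax(2)[OF a] by metis
  qed
qed

abbreviation lt :: "'a \<Rightarrow> 'a bpoint \<times> 'a bpoint \<Rightarrow> 'a bpoint \<times> 'a bpoint" where
  "lt g \<equiv> boundary2_map (\<lambda>h. g \<otimes> h)"

lemma lt_comp: "g \<in> carrier F \<Longrightarrow> k \<in> carrier F \<Longrightarrow> x \<in> pairs \<Longrightarrow> lt g (lt k x) = lt (g \<otimes> k) x"
  unfolding boundary2_map_comp by (intro boundary2_map_cong) (auto simp: m_assoc)

lemma lt_inv: "g \<in> carrier F \<Longrightarrow> x \<in> pairs \<Longrightarrow> lt (inv g) (lt g x) = x"
  by (rule boundary2_map_inverse[OF coarse_left_mult])

lemma lt_pairs: "g \<in> carrier F \<Longrightarrow> x \<in> pairs \<Longrightarrow> lt g x \<in> pairs"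
  by (rule boundary2_map_pairs[OF coarse_left_mult])

text \<open>Translating by z^-1 moves the other end of the edge to the identity; seen from there the
  same line crosses the edge in the opposite direction.\<close>

lemma cross_edge:
  assumes z: "z \<in> letters" and p: "p \<in> bdry - cyl [z]" and q: "q \<in> cyl [z]"
  shows "boundary_map (\<lambda>h. lv (linv z) \<otimes> h) p \<in> cyl [linv z]"
    and "boundary_map (\<lambda>h. lv (linv z) \<otimes> h) q \<in> bdry - cyl [linv z]"
proof -
  have z': "linv z \<in> letters" "inv (val [z]) = lv (linv z)" using z by (auto simp: lv_linv)
  obtain y where y: "p \<in> cyl [y]" using cyl_extend[of p "[]"] p by auto
  then have "y \<noteq> z" using p by auto
  then have "boundary_map (\<lambda>h. lv (linv z) \<otimes> h) p \<in> cyl [linv z, y]"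
    using cyl_cons[OF y z'(1)] by simp
  then show "boundary_map (\<lambda>h. lv (linv z) \<otimes> h) p \<in> cyl [linv z]"
    using cyl_append[of _ "[linv z]" "[y]"] by simp
  obtain l where l: "q \<in> cyl ([z] @ [l])" using cyl_extend[OF q] by blast
  then have "l \<noteq> linv z" using cyl_rwords[OF l] by (simp add: rwords_Cons)
  moreover have "boundary_map (\<lambda>h. lv (linv z) \<otimes> h) q \<in> cyl [l]"
    using cyl_strip[OF l] unfolding z'(2) .
  ultimately show "boundary_map (\<lambda>h. lv (linv z) \<otimes> h) q \<in> bdry - cyl [linv z]"
    using cyl_unique[of _ "[l]" "[linv z]"] cyl_bdry by auto
qed

lemma rect_cross:
  assumes z: "z \<in> letters" and x: "x \<in> rect z []"
  shows "lt (lv (linv z)) (prod.swap x) \<in> rect (linv z) []"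
  using x cross_edge[OF z, of "fst x" "snd x"] unfolding rect_def boundary2_map_def by (cases x) auto

text \<open>After a translation the line passes through the identity and its two ends start with
  different letters. An edge not labelled \<open>a\<close>, at any place on the line, could be
  translated to the identity, so both ends are infinite powers of \<open>a\<close>; as the first
  letters differ, the signs are opposite.\<close>

lemma line_in_axis_orbit:
  assumes a: "a \<in> X" and x: "x \<in> pairs"
    and no: "\<And>g z. g \<in> carrier F \<Longrightarrow> z \<in> letters \<Longrightarrow> fst z \<noteq> a \<Longrightarrow> lt g x \<notin> rect z []"
  shows "\<exists>g\<in>carrier F. \<exists>e. lt g x = (ax a (\<not> e), ax a e)"
proof -
  have no': "lt g (prod.swap x) \<notin> rect z []" if gz: "g \<in> carrier F" "z \<in> letters" "fst z \<noteq> a" for g z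
  proof
    assume "lt g (prod.swap x) \<in> rect z []"
    from rect_cross[OF gz(2) this] have "lt (lv (linv z)) (lt g x) \<in> rect (linv z) []"
      by (simp add: boundary2_map_swap)
    then have "lt (lv (linv z) \<otimes> g) x \<in> rect (linv z) []" using lt_comp gz x by simp
    then show False using no[of "lv (linv z) \<otimes> g" "linv z"] gz by simp
  qed
  have main1: "fst y = a" if gF: "g \<in> carrier F" and l: "fst (lt g x) \<in> cyl [y]" "snd (lt g x) \<in> cyl [y']" "y \<noteq> y'" for g y y'
  proof (rule ccontr)
    assume fy: "fst y \<noteq> a"
    have y: "y \<in> letters" using cyl_rwords[OF l(1)] by (simp add: rwords_Cons)
    have "snd (lt g x) \<notin> cyl [y]" using cyl_unique[OF l(2), of "[y]"] l(3) by auto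
    then have "lt g (prod.swap x) \<in> rect y []"
      using l(1) cyl_bdry[OF l(2)] unfolding boundary2_map_swap rect_def by (cases "lt g x") auto
    then show False using no'[OF gF y fy] by blast
  qed
  have main2: "fst y = a" if gF: "g \<in> carrier F" and l: "fst (lt g x) \<in> cyl [y']" "snd (lt g x) \<in> cyl [y]" "y \<noteq> y'" for g y y'
  proof (rule ccontr)
    assume fy: "fst y \<noteq> a"
    have y: "y \<in> letters" using cyl_rwords[OF l(2)] by (simp add: rwords_Cons)
    have "fst (lt g x) \<notin> cyl [y]" using cyl_unique[OF l(1), of "[y]"] l(3) by auto
    then have "lt g x \<in> rect y []"
      using l(2) cyl_bdry[OF l(1)] unfolding rect_def by (cases "lt g x") auto
    then show False using no[OF gF y fy] by blast
  qed
  obtain p q where pq: "x = (p, q)" "p \<in> bdry" "q \<in> bdry" "p \<noteq> q" using x unfolding pairs_def by auto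
  have "\<exists>w v. length w = length v \<and> p \<in> cyl w \<and> q \<in> cyl v \<and> w \<noteq> v"
  proof (rule ccontr)
    assume *: "\<not> ?thesis"
    have "p = q"
    proof (rule bdry_eqI[OF pq(2,3)])
      fix w assume w: "p \<in> cyl w"
      obtain v where v: "length v = length w" "q \<in> cyl v" using cyl_ex[OF pq(3), of "length w"] by blast
      then have "v = w" using * w by metis
      then show "q \<in> cyl w" using v by simp
    qed
    then show False using pq by simp
  qed
  then obtain w v where wv: "length w = length v" "p \<in> cyl w" "q \<in> cyl v" "w \<noteq> v" by (elim exE conjE)
  \<comment> \<open>The branch point of the two ends, which \<open>g\<close> below moves to the
    identity.\<close>
  define n where "n = common_prefix w v"
  have n: "n < length w" "n < length v" "take n w = take n v"
  proof -
    have *: "n \<le> length w" "n \<le> length v" "take n w = take n v" using le_common_prefix_iff[of n w v] by (auto simp: n_def)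
    moreover have "n \<noteq> length w" using * wv by auto
    ultimately show "n < length w" "n < length v" "take n w = take n v" using wv(1) by auto
  qed
  have ne: "w ! n \<noteq> v ! n"
  proof
    assume "w ! n = v ! n"
    then have "take (Suc n) w = take (Suc n) v" using n by (simp add: take_Suc_conv_app_nth)
    then have "Suc n \<le> common_prefix w v" using n unfolding le_common_prefix_iff by simp
    then show False by (simp add: n_def)
  qed
  define g where "g = inv (val (take n w))"
  have pw: "p \<in> cyl (take n w @ [w ! n])" "q \<in> cyl (take n w @ [v ! n])"
    using cyl_take[OF wv(2), of "Suc n"] cyl_take[OF wv(3), of "Suc n"] n by (simp_all add: take_Suc_conv_app_nth)
  have "set (take n w) \<subseteq> letters" using cyl_rwords[OF wv(2)] set_take_subset[of n w] by (auto simp: rwords_def)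
  then have gF: "g \<in> carrier F" by (simp add: g_def)
  define p' q' where "p' = fst (lt g x)" and "q' = snd (lt g x)"
  have p'q': "p' \<in> cyl [w ! n]" "q' \<in> cyl [v ! n]"
    using cyl_strip[OF pw(1)] cyl_strip[OF pw(2)] unfolding p'_def q'_def pq(1) g_def boundary2_map_def by auto
  have fsts: "fst (w ! n) = a" "fst (v ! n) = a"
    using main1[of g "w ! n" "v ! n"] main2[of g "w ! n" "v ! n"] p'q' ne gF unfolding p'_def q'_def by auto
  obtain e where e: "v ! n = (a, e)" using fsts(2) by (cases "v ! n") auto
  then have e': "w ! n = (a, \<not> e)" using fsts(1) ne by (cases "w ! n") auto
  \<comment> \<open>The number \<open>f\<close> selects the end: 0 stands for \<open>q'\<close> with
    sign \<open>e\<close>, 1 for \<open>p'\<close> with the opposite sign.\<close>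
  have step: "fst y = a" if f: "f \<in> {0, 1::nat}" and y: "(if f = 0 then q' else p') \<in> cyl (replicate (Suc m) (a, if f = 0 then e else \<not> e) @ [y])" for f m y
  proof -
    define d where "d = (if f = 0 then e else \<not> e)"
    define r s where "r = (if f = 0 then q' else p')" and "s = (if f = 0 then p' else q')"
    have r: "r \<in> cyl (replicate (Suc m) (a, d) @ [y])" using y by (simp add: r_def d_def)
    have s: "s \<in> cyl [(a, \<not> d)]" using p'q' e e' by (simp add: s_def d_def)
    define k where "k = inv (val (replicate (Suc m) (a, d)))"
    have al: "(a, d) \<in> letters" using a by (simp add: letters_def)
    have kF: "k \<in> carrier F" using al by (auto simp: k_def simp del: ev_Cons replicate_Suc intro!: inv_closed val_closed)
    have r': "boundary_map (\<lambda>h. k \<otimes> h) r \<in> cyl [y]" using cyl_strip[OF r] unfolding k_def .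
    \<comment> \<open>Moving the base point along \<open>r\<close> prepends letters
      \<open>(a, \<not> d)\<close> to the other end \<open>s\<close>, so the first letter of
      \<open>s\<close> remains \<open>(a, \<not> d)\<close>.\<close>
    have s': "boundary_map (\<lambda>h. inv (val (replicate j (a, d))) \<otimes> h) s \<in> cyl [(a, \<not> d)]" for j
    proof (induction j)
      case 0
      then show ?case using s boundary_map_id[of "\<lambda>h. inv \<one> \<otimes> h" s] cyl_bdry[OF s] by simp
    next
      case (Suc j)
      have vF: "val (replicate j (a, d)) \<in> carrier F" using al by (auto intro!: val_closed)
      have "val (replicate (Suc j) (a, d)) = val (replicate j (a, d)) \<otimes> lv (a, d)"
        using val_append[of "replicate j (a, d)" "[(a, d)]"] al
        by (simp add: replicate_append_same set_replicate_conv_if)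
      then have "inv (val (replicate (Suc j) (a, d))) = lv (a, \<not> d) \<otimes> inv (val (replicate j (a, d)))"
        using vF al lv_linv[OF al] by (simp add: inv_mult_group)
      then have "boundary_map (\<lambda>h. inv (val (replicate (Suc j) (a, d))) \<otimes> h) s =
          boundary_map (\<lambda>h. lv (a, \<not> d) \<otimes> h) (boundary_map (\<lambda>h. inv (val (replicate j (a, d))) \<otimes> h) s)"
        unfolding boundary_map_comp using vF al a cyl_bdry[OF s]
        by (intro boundary_map_cong) (auto simp: m_assoc letters_def)
      moreover have "boundary_map (\<lambda>h. lv (a, \<not> d) \<otimes> h) (boundary_map (\<lambda>h. inv (val (replicate j (a, d))) \<otimes> h) s) \<in> cyl [(a, \<not> d), (a, \<not> d)]"
        using cyl_cons[OF Suc, of "(a, \<not> d)"] a by (auto simp: letters_def)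
      ultimately show ?case using cyl_append[of _ "[(a, \<not> d)]" "[(a, \<not> d)]"] by simp
    qed
    have s'': "boundary_map (\<lambda>h. k \<otimes> h) s \<in> cyl [(a, \<not> d)]" using s'[of "Suc m"] unfolding k_def .
    have kx: "lt (k \<otimes> g) x = lt k (lt g x)" using lt_comp[OF kF gF x] by simp
    have kg: "k \<otimes> g \<in> carrier F" using kF gF by simp
    have fs: "fst (lt (k \<otimes> g) x) = boundary_map (\<lambda>h. k \<otimes> h) p'" "snd (lt (k \<otimes> g) x) = boundary_map (\<lambda>h. k \<otimes> h) q'"
      unfolding kx p'_def q'_def by (cases "lt g x"; simp add: boundary2_map_def)+
    show "fst y = a"
    proof (cases "y = (a, \<not> d)")
      case False
      show ?thesis
      proof (cases "f = 0")
        case True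
        show ?thesis
          using main2[of "k \<otimes> g" "(a, \<not> d)" y] False r' s'' kg True unfolding fs r_def s_def by simp
      next
        case f1: False
        show ?thesis
          using main1[of "k \<otimes> g" y "(a, \<not> d)"] False r' s'' kg f1 unfolding fs r_def s_def by simp
      qed
    qed simp
  qed
  have "q' = ax a e" using ax_eqI[OF a, of q' e] p'q'(2) e step[of 0] by simp
  moreover have "p' = ax a (\<not> e)" using ax_eqI[OF a, of p' "\<not> e"] p'q'(1) e' step[of 1] by simp
  ultimately have "lt g x = (ax a (\<not> e), ax a e)" unfolding p'_def q'_def by (metis prod.collapse)
  then show ?thesis using gF by blast
qed

end

section \<open>Currents fixed by transvections\<close>

context free_gp_fin
begin

lemma countable_letters: "countable letters"
proof -
  have "finite (X \<times> (UNIV :: bool set))" using fin by simp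
  moreover have "letters \<subseteq> X \<times> UNIV" by (auto simp: letters_def)
  ultimately show ?thesis using countable_finite finite_subset by metis
qed

lemma rect_mono: "rect z w \<subseteq> rect z []"
  using cyl_append[of _ "[z]" w] unfolding rect_def by auto

lemma rect_split: "rect z [] \<subseteq> (\<Union>y\<in>letters - {linv z}. rect z [y])"
proof
  fix x assume "x \<in> rect z []"
  then obtain p q where x: "x = (p, q)" "p \<in> bdry - cyl [z]" "q \<in> cyl [z]" unfolding rect_def by auto
  obtain y where y: "y \<in> letters" "q \<in> cyl ([z] @ [y])" using cyl_extend[OF x(3)] by blast
  have "y \<noteq> linv z" using cyl_rwords[OF y(2)] by (simp add: rwords_Cons)
  then show "x \<in> (\<Union>y\<in>letters - {linv z}. rect z [y])" using x y unfolding rect_def by auto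
qed

text \<open>The first coordinate stays outside \<open>cyl [z]\<close> because the inverse
  transvection maps \<open>cyl [z]\<close> into itself.\<close>

lemma rect_transvection:
  assumes z: "z \<in> letters" "a \<in> X" "fst z \<noteq> a" and y: "fst y \<noteq> a" "y \<noteq> linv z"
    and u: "u \<in> rect z (apow a m @ [y])"
  shows "boundary2_map (transvection z a n) u \<in> rect z (apow a (n + m) @ [y])"
proof -
  obtain p q where pq: "u = (p, q)" "p \<in> bdry" "p \<notin> cyl [z]" "q \<in> cyl (z # apow a m @ [y])"
    using u unfolding rect_def by auto
  have "boundary_map (transvection z a n) p \<notin> cyl [z]"
  proof
    assume "boundary_map (transvection z a n) p \<in> cyl [z]"
    from transvection_cyl_first[OF z this, of "- n"] show False
      using boundary_map_inverse[OF coarse_transvection[OF z, of n] pq(2)] pq(3) by simp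
  qed
  moreover have "boundary_map (transvection z a n) p \<in> bdry"
    by (rule boundary_map_bdry[OF coarse_transvection[OF z] pq(2)])
  moreover have "boundary_map (transvection z a n) q \<in> cyl (z # apow a (n + m) @ [y])"
    by (rule transvection_cyl_pow[OF z pq(4) y])
  ultimately show ?thesis unfolding pq(1) rect_def boundary2_map_def by simp
qed

text \<open>After the edge \<open>z\<close> the line crosses the edge \<open>y\<close>, which
  translation by z^-1 moves to the identity.\<close>

lemma rect_shift:
  assumes z: "z \<in> letters" and y: "fst y \<noteq> fst z" and x: "x \<in> rect z [y]"
  shows "lt (lv (linv z)) x \<in> rect y []"
proof -
  obtain p q where x: "x = (p, q)" "p \<in> bdry - cyl [z]" "q \<in> cyl [z, y]" using x unfolding rect_def by auto
  have q: "q \<in> cyl [z]" using cyl_append[of q "[z]" "[y]"] x(3) by simp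
  note p = cross_edge(1)[OF z x(2) q]
  have "inv (val [z]) = lv (linv z)" using z by (simp add: lv_linv)
  then have "boundary_map (\<lambda>h. lv (linv z) \<otimes> h) q \<in> cyl [y]"
    using cyl_strip[of q "[z]" "[y]"] x(3) by simp
  moreover have "boundary_map (\<lambda>h. lv (linv z) \<otimes> h) p \<notin> cyl [y]"
  proof
    assume "boundary_map (\<lambda>h. lv (linv z) \<otimes> h) p \<in> cyl [y]"
    from cyl_unique[OF p this] have "linv z = y" by simp
    then show False using y by auto
  qed
  ultimately show ?thesis using cyl_bdry[OF p] unfolding x(1) rect_def boundary2_map_def by simp
qed

text \<open>Both orientations are included, so that the orbit is closed under the flip.\<close>

definition axis_orbit :: "'a \<Rightarrow> ('a bpoint \<times> 'a bpoint) set" where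
  "axis_orbit a = (\<lambda>(g, e). lt g (ax a (\<not> e), ax a e)) ` (carrier F \<times> UNIV)"

lemma countable_axis_orbit: "countable (axis_orbit a)"
  unfolding axis_orbit_def using countable_carrier by (intro countable_image countable_SIGMA) auto

lemma ax_in_pairs: "a \<in> X \<Longrightarrow> (ax a (\<not> e), ax a e) \<in> pairs"
  using ax_pairs rect_pairs by blast

section \<open>Measurability and invariance for a single current\<close>

context
  fixes \<nu> :: "'a current"
  assumes nu: "\<nu> \<in> Curr F X"
begin

lemma sets_current: "sets \<nu> = sigma_sets pairs {U. openin T2 U}"
  using nu unfolding Curr_def radon_measure_def topspace_T2 by blast

lemma open_sub_pairs: "{U. openin T2 U} \<subseteq> Pow pairs"
  using openin_subset[of T2] unfolding topspace_T2 by auto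

lemma space_current: "space \<nu> = pairs"
proof -
  have "sets \<nu> = sets (sigma pairs {U. openin T2 U})"
    unfolding sets_current using open_sub_pairs by (simp add: sets_measure_of)
  from sets_eq_imp_space_eq[OF this] show ?thesis using open_sub_pairs by (simp add: space_measure_of)
qed

lemma open_sets: "openin T2 U \<Longrightarrow> U \<in> sets \<nu>"
  unfolding sets_current by (rule sigma_sets.Basic) simp

lemma rect_sets: "rect z w \<in> sets \<nu>"
  by (rule open_sets[OF rect_open])

lemma continuous_measurable:
  assumes f: "continuous_map T2 T2 f"
  shows "f \<in> measurable \<nu> \<nu>"
proof (rule measurable_sigma_sets[OF sets_current open_sub_pairs])
  show "f \<in> space \<nu> \<rightarrow> pairs"
    using continuous_map_funspace[OF f] unfolding space_current topspace_T2 .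
  fix U assume "U \<in> {U. openin T2 U}"
  then have "openin T2 {x \<in> topspace T2. f x \<in> U}" using openin_continuous_map_preimage[OF f] by simp
  moreover have "{x \<in> topspace T2. f x \<in> U} = f -` U \<inter> space \<nu>" unfolding space_current topspace_T2 by auto
  ultimately show "f -` U \<inter> space \<nu> \<in> sets \<nu>" using open_sets by simp
qed

lemma boundary2_map_measurable: "coarse f f' \<Longrightarrow> boundary2_map f \<in> measurable \<nu> \<nu>"
  by (rule continuous_measurable[OF boundary2_map_continuous])

lemma preimage_sets:
  assumes f: "f \<in> measurable \<nu> \<nu>" and A: "A \<in> sets \<nu>"
  shows "{x \<in> pairs. f x \<in> A} \<in> sets \<nu>"
proof -
  have "{x \<in> pairs. f x \<in> A} = f -` A \<inter> space \<nu>" unfolding space_current by auto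
  then show ?thesis using measurable_sets[OF f A] by simp
qed

text \<open>The preimage is the image of a compact set under the continuous inverse, and Radon
  measures are finite on compact sets.\<close>

lemma rect_preimage_finite:
  assumes c: "coarse f f'"
  shows "emeasure \<nu> {x \<in> pairs. boundary2_map f x \<in> rect z w} < \<infinity>"
proof -
  have "{x \<in> pairs. boundary2_map f x \<in> rect z w} = boundary2_map f' ` rect z w"
  proof (intro equalityI subsetI)
    fix x assume x: "x \<in> {x \<in> pairs. boundary2_map f x \<in> rect z w}"
    then show "x \<in> boundary2_map f' ` rect z w"
      using boundary2_map_inverse[OF c, of x] by (intro image_eqI[of _ _ "boundary2_map f x"]) auto
  next
    fix x assume "x \<in> boundary2_map f' ` rect z w"
    then obtain y where y: "y \<in> rect z w" "x = boundary2_map f' y" by blast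
    then have "y \<in> pairs" using rect_pairs by blast
    then show "x \<in> {x \<in> pairs. boundary2_map f x \<in> rect z w}"
      using y boundary2_map_inverse[OF coarse_sym[OF c]] boundary2_map_pairs[OF coarse_sym[OF c]] by simp
  qed
  moreover have "compactin T2 (boundary2_map f' ` rect z w)"
    by (rule image_compactin[OF rect_compact boundary2_map_continuous[OF coarse_sym[OF c]]])
  ultimately show ?thesis using nu unfolding Curr_def radon_measure_def by auto
qed

lemma lt_measurable: "g \<in> carrier F \<Longrightarrow> lt g \<in> measurable \<nu> \<nu>"
  by (rule boundary2_map_measurable[OF coarse_left_mult])

lemma lt_preimage:
  assumes g: "g \<in> carrier F" and A: "A \<in> sets \<nu>"
  shows "emeasure \<nu> {x \<in> pairs. lt g x \<in> A} = emeasure \<nu> A"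
proof -
  let ?B = "{x \<in> pairs. lt g x \<in> A}"
  have "A \<subseteq> pairs" using sets.sets_into_space[OF A] unfolding space_current .
  have "lt g ` ?B = A"
  proof (intro equalityI subsetI)
    fix x assume x: "x \<in> A"
    then have xp: "x \<in> pairs" using \<open>A \<subseteq> pairs\<close> by blast
    have "lt (inv (inv g)) (lt (inv g) x) = x" by (rule lt_inv) (use g xp in simp_all)
    then show "x \<in> lt g ` ?B"
      using x g xp lt_pairs[of "inv g" x] by (intro image_eqI[of _ _ "lt (inv g) x"]) auto
  qed auto
  moreover have "emeasure \<nu> (lt g ` ?B) = emeasure \<nu> ?B"
    using nu g preimage_sets[OF lt_measurable[OF g] A] unfolding Curr_def by blast
  ultimately show ?thesis by simp
qed

lemma swap_preimage:
  assumes A: "A \<in> sets \<nu>"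
  shows "{x \<in> pairs. prod.swap x \<in> A} \<in> sets \<nu>" "emeasure \<nu> {x \<in> pairs. prod.swap x \<in> A} = emeasure \<nu> A"
proof -
  let ?B = "{x \<in> pairs. prod.swap x \<in> A}"
  show B: "?B \<in> sets \<nu>" by (rule preimage_sets[OF continuous_measurable[OF swap_continuous] A])
  have "A \<subseteq> pairs" using sets.sets_into_space[OF A] unfolding space_current .
  then have "prod.swap ` A = ?B" unfolding pairs_def by (force simp: image_iff)
  moreover have "emeasure \<nu> (prod.swap ` A) = emeasure \<nu> A"
    using nu A unfolding Curr_def by blast
  ultimately show "emeasure \<nu> ?B = emeasure \<nu> A" by simp
qed

lemma lt_null: "g \<in> carrier F \<Longrightarrow> A \<in> null_sets \<nu> \<Longrightarrow> {x \<in> pairs. lt g x \<in> A} \<in> null_sets \<nu>"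
  using lt_preimage preimage_sets[OF lt_measurable] by (simp add: null_sets_def)

lemma swap_null: "A \<in> null_sets \<nu> \<Longrightarrow> {x \<in> pairs. prod.swap x \<in> A} \<in> null_sets \<nu>"
  using swap_preimage by (simp add: null_sets_def)

text \<open>Flipping lines and moving the base point across the edge takes lines through
  \<open>linv z\<close> to lines through \<open>z\<close>.\<close>

lemma rect_null_flip:
  assumes z: "z \<in> letters" and n: "rect z [] \<in> null_sets \<nu>"
  shows "rect (linv z) [] \<in> null_sets \<nu>"
proof (rule null_sets_subset[OF _ rect_sets])
  have zF: "lv z \<in> carrier F" using z by simp
  show "{x \<in> pairs. prod.swap x \<in> {y \<in> pairs. lt (lv z) y \<in> rect z []}} \<in> null_sets \<nu>"
    by (rule swap_null[OF lt_null[OF zF n]])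
  show "rect (linv z) [] \<subseteq> {x \<in> pairs. prod.swap x \<in> {y \<in> pairs. lt (lv z) y \<in> rect z []}}"
  proof
    fix x assume x: "x \<in> rect (linv z) []"
    have xp: "x \<in> pairs" using x rect_pairs by blast
    moreover have "prod.swap x \<in> pairs" using xp unfolding pairs_def by auto
    moreover have "lt (lv z) (prod.swap x) \<in> rect z []" using rect_cross[OF _ x] z by simp
    ultimately show "x \<in> {x \<in> pairs. prod.swap x \<in> {y \<in> pairs. lt (lv z) y \<in> rect z []}}" by simp
  qed
qed

lemma rect_null:
  assumes "\<And>y. y \<in> letters \<Longrightarrow> y \<noteq> linv z \<Longrightarrow> rect z [y] \<in> null_sets \<nu>"
  shows "rect z [] \<in> null_sets \<nu>"
proof (rule null_sets_subset[OF _ rect_sets rect_split])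
  show "(\<Union>y\<in>letters - {linv z}. rect z [y]) \<in> null_sets \<nu>"
    using countable_letters assms by (intro null_sets_UN') auto
qed

text \<open>The sets of lines that contain the edges \<open>z, a\<^sup>n, y\<close> are permuted by the transvection, and they
  all lie in the compact set of lines through the edge \<open>z\<close>.\<close>

lemma transvection_null:
  assumes z: "z \<in> letters" "a \<in> X" "fst z \<noteq> a" and y: "fst y \<noteq> a" "y \<noteq> linv z"
    and k: "coarse \<kappa> \<kappa>'" and f: "coarse f f'"
    and conj: "\<And>g. g \<in> carrier F \<Longrightarrow> \<kappa>' (f g) = transvection z a 1 (\<kappa>' g)"
    and r: "aut_current f \<nu> = scale_measure (ennreal r) \<nu>" "r > 0"
  shows "{x \<in> pairs. boundary2_map \<kappa>' x \<in> rect z [y]} \<in> null_sets \<nu>"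
proof -
  \<comment> \<open>In the coordinates given by \<open>\<kappa>'\<close> the map \<open>f\<close> is
    the transvection, so it shifts the exponent \<open>n\<close> by one. All integers occur, so that
    iteration is possible in both directions.\<close>
  define K where "K n = {x \<in> pairs. boundary2_map \<kappa>' x \<in> rect z (apow a n @ [y])}" for n
  define L where "L = {x \<in> pairs. boundary2_map \<kappa>' x \<in> rect z []}"
  note k' = coarse_sym[OF k]
  have "K 0 \<in> null_sets \<nu>"
  proof (rule wandering_null)
    show "boundary2_map f \<in> measurable \<nu> \<nu>" by (rule boundary2_map_measurable[OF f])
    show "distr \<nu> \<nu> (boundary2_map f) = scale_measure (ennreal r) \<nu>" using r(1) by (simp add: aut_current_def)
    show "r > 0" by fact
    show "K n \<in> sets \<nu>" for n
      unfolding K_def by (rule preimage_sets[OF boundary2_map_measurable[OF k'] rect_sets])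
    show "L \<in> sets \<nu>"
      unfolding L_def by (rule preimage_sets[OF boundary2_map_measurable[OF k'] rect_sets])
    show "emeasure \<nu> L < \<infinity>" unfolding L_def by (rule rect_preimage_finite[OF k'])
    show "K n \<subseteq> L" for n unfolding K_def L_def using rect_mono by blast
    show "disjoint_family K"
      unfolding disjoint_family_on_def
    proof (intro ballI impI, rule ccontr)
      fix m n :: int assume mn: "m \<noteq> n" "K m \<inter> K n \<noteq> {}"
      then obtain x where "boundary2_map \<kappa>' x \<in> rect z (apow a m @ [y])" "boundary2_map \<kappa>' x \<in> rect z (apow a n @ [y])"
        unfolding K_def by auto
      then have "snd (boundary2_map \<kappa>' x) \<in> cyl (z # apow a m @ [y])" "snd (boundary2_map \<kappa>' x) \<in> cyl (z # apow a n @ [y])"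
        unfolding rect_def by auto
      then show False using cyl_apow_disjoint[OF _ _ y(1)] mn(1) by blast
    qed
    show "boundary2_map f -` K (n + 1) \<inter> space \<nu> = K n" for n
    proof -
      have "boundary2_map f x \<in> K (n + 1) \<longleftrightarrow> x \<in> K n" if x: "x \<in> pairs" for x
      proof -
        define u where "u = boundary2_map \<kappa>' x"
        have u: "u \<in> pairs" unfolding u_def by (rule boundary2_map_pairs[OF k' x])
        have "boundary2_map \<kappa>' (boundary2_map f x) = boundary2_map (transvection z a 1) u"
          unfolding u_def boundary2_map_comp using conj x by (intro boundary2_map_cong) auto
        then have "boundary2_map f x \<in> K (n + 1) \<longleftrightarrow> boundary2_map (transvection z a 1) u \<in> rect z (apow a (n + 1) @ [y])"
          using boundary2_map_pairs[OF f x] unfolding K_def by simp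
        also have "\<dots> \<longleftrightarrow> u \<in> rect z (apow a n @ [y])"
        proof
          assume "boundary2_map (transvection z a 1) u \<in> rect z (apow a (n + 1) @ [y])"
          from rect_transvection[OF z y this, of "- 1"] show "u \<in> rect z (apow a n @ [y])"
            using boundary2_map_inverse[OF coarse_transvection[OF z, of 1] u] by simp
        next
          assume "u \<in> rect z (apow a n @ [y])"
          from rect_transvection[OF z y this, of 1]
          show "boundary2_map (transvection z a 1) u \<in> rect z (apow a (n + 1) @ [y])" by (simp add: add.commute)
        qed
        also have "\<dots> \<longleftrightarrow> x \<in> K n" using x unfolding K_def u_def by simp
        finally show ?thesis .
      qed
      moreover have "K n \<subseteq> pairs" unfolding K_def by blast
      ultimately show ?thesis unfolding space_current by blast
    qed
  qed
  then show ?thesis unfolding K_def by simp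
qed

section \<open>Concentration on the orbit of an axis\<close>

lemma singleton_sets:
  assumes x: "x \<in> pairs"
  shows "{x} \<in> sets \<nu>"
proof -
  obtain p q where pq: "x = (p, q)" "p \<in> bdry" "q \<in> bdry" "p \<noteq> q" using x unfolding pairs_def by auto
  obtain w where w: "\<And>n. length (w n) = n" "\<And>n. p \<in> cyl (w n)" using cyl_ex[OF pq(2)] by metis
  obtain v where v: "\<And>n. length (v n) = n" "\<And>n. q \<in> cyl (v n)" using cyl_ex[OF pq(3)] by metis
  define U where "U n = (cyl (w n) \<times> cyl (v n)) \<inter> {(p, q). p \<noteq> q}" for n
  have "openin T2 (U n)" for n
  proof -
    have "openin (prod_topology (boundary_topology F X) (boundary_topology F X)) (cyl (w n) \<times> cyl (v n))"
      unfolding openin_prod_Times_iff using cyl_open by blast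
    then show ?thesis unfolding boundary2_topology_def openin_subtopology U_def by blast
  qed
  then have "range U \<subseteq> sets \<nu>" using open_sets by auto
  then have "(\<Inter>n\<in>UNIV. U n) \<in> sets \<nu>" by (intro sets.countable_INT) auto
  moreover have "(\<Inter>n\<in>UNIV. U n) = {x}"
  proof (intro equalityI subsetI)
    fix y assume y: "y \<in> (\<Inter>n\<in>UNIV. U n)"
    then have yn: "fst y \<in> cyl (w n)" "snd y \<in> cyl (v n)" for n unfolding U_def by auto
    have "fst y = p"
    proof (rule bdry_eqI[OF cyl_bdry[OF yn(1)[of 0]] pq(2)])
      fix u assume "fst y \<in> cyl u"
      from cyl_unique[OF this yn(1)[of "length u"]] show "p \<in> cyl u" using w by metis
    qed
    moreover have "snd y = q"
    proof (rule bdry_eqI[OF cyl_bdry[OF yn(2)[of 0]] pq(3)])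
      fix u assume "snd y \<in> cyl u"
      from cyl_unique[OF this yn(2)[of "length u"]] show "q \<in> cyl u" using v by metis
    qed
    ultimately show "y \<in> {x}" using pq(1) by (cases y) simp
  next
    fix y assume "y \<in> {x}"
    then show "y \<in> (\<Inter>n\<in>UNIV. U n)" unfolding U_def using pq w(2) v(2) by simp
  qed
  ultimately show ?thesis by simp
qed

text \<open>Translation invariance moves a point of the orbit back to the axis of \<open>a\<close>,
  and flip invariance corrects its orientation.\<close>

lemma axis_orbit_mass:
  assumes a: "a \<in> X" and x: "x \<in> axis_orbit a"
  shows "emeasure \<nu> {x} = emeasure \<nu> {(ax a False, ax a True)}"
proof -
  obtain g e where g: "g \<in> carrier F" "x = lt g (ax a (\<not> e), ax a e)" using x unfolding axis_orbit_def by auto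
  let ?y = "(ax a (\<not> e), ax a e)"
  have "emeasure \<nu> {x} = emeasure \<nu> (lt g ` {?y})" by (simp add: g)
  also have "\<dots> = emeasure \<nu> {?y}"
    using nu g(1) singleton_sets[OF ax_in_pairs[OF a]] unfolding Curr_def by blast
  also have "\<dots> = emeasure \<nu> {(ax a False, ax a True)}"
  proof (cases e)
    case False
    have "emeasure \<nu> (prod.swap ` {?y}) = emeasure \<nu> {?y}"
      using nu singleton_sets[OF ax_in_pairs[OF a]] unfolding Curr_def by blast
    then show ?thesis using False by simp
  qed simp
  finally show ?thesis .
qed

text \<open>By \<open>line_in_axis_orbit\<close>, the complement of the axis orbit is covered by
  countably many translates of null sets. The orbit itself is countable and its points have equal
  mass, so the measure is a multiple of counting measure there.\<close>

lemma axis_orbit_concentrated: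
  assumes a: "a \<in> X" and n: "\<And>z. z \<in> letters \<Longrightarrow> fst z \<noteq> a \<Longrightarrow> rect z [] \<in> null_sets \<nu>"
    and A: "A \<in> sets \<nu>"
  shows "emeasure \<nu> A = emeasure \<nu> {(ax a False, ax a True)} *
    emeasure (count_space (A \<inter> axis_orbit a)) (A \<inter> axis_orbit a)"
proof -
  let ?P = "axis_orbit a"
  let ?I = "carrier F \<times> {z \<in> letters. fst z \<noteq> a}"
  let ?N = "\<Union>(g, z)\<in>?I. {x \<in> pairs. lt g x \<in> rect z []}"
  have cI: "countable ?I" using countable_carrier countable_letters by (intro countable_SIGMA) auto
  have N: "?N \<in> null_sets \<nu>"
  proof (rule null_sets_UN'[OF cI])
    fix i assume "i \<in> ?I"
    then show "(case i of (g, z) \<Rightarrow> {x \<in> pairs. lt g x \<in> rect z []}) \<in> null_sets \<nu>"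
      using lt_null[OF _ n] by auto
  qed
  have AP: "A \<subseteq> pairs" using sets.sets_into_space[OF A] unfolding space_current .
  have sing: "{x} \<in> sets \<nu>" if "x \<in> A \<inter> ?P" for x using singleton_sets AP that by blast
  have cP: "countable (A \<inter> ?P)" using countable_axis_orbit by blast
  have PA: "A \<inter> ?P \<in> sets \<nu>" using sets.countable[OF sing cP] by blast
  have "A - ?P \<subseteq> ?N"
  proof
    fix x assume x: "x \<in> A - ?P"
    then have xp: "x \<in> pairs" using AP by blast
    show "x \<in> ?N"
    proof (rule ccontr)
      assume xN: "x \<notin> ?N"
      have "lt g x \<notin> rect z []" if "g \<in> carrier F" "z \<in> letters" "fst z \<noteq> a" for g z
      proof
        assume "lt g x \<in> rect z []"
        then have "x \<in> ?N" using that xp by (intro UN_I[of "(g, z)"]) auto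
        then show False using xN by contradiction
      qed
      then have "\<exists>g\<in>carrier F. \<exists>e. lt g x = (ax a (\<not> e), ax a e)"
        by (rule line_in_axis_orbit[OF a xp])
      then obtain g e where g: "g \<in> carrier F" "lt g x = (ax a (\<not> e), ax a e)"
        by (elim bexE exE)
      then have "x = lt (inv g) (ax a (\<not> e), ax a e)" using lt_inv[OF g(1) xp] by simp
      then have "x \<in> ?P" using g(1) unfolding axis_orbit_def by (intro image_eqI[of _ _ "(inv g, e)"]) auto
      then show False using x by blast
    qed
  qed
  then have sub: "A - A \<inter> ?P \<subseteq> ?N" by blast
  have "A - A \<inter> ?P \<in> null_sets \<nu>" by (rule null_sets_subset[OF N sets.Diff[OF A PA] sub])
  from emeasure_Un_null_set[OF PA this] have "emeasure \<nu> A = emeasure \<nu> (A \<inter> ?P)"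
    by (simp add: Un_absorb1)
  also have "\<dots> = (\<integral>\<^sup>+ x. emeasure \<nu> {x} \<partial>count_space (A \<inter> ?P))"
    by (rule emeasure_countable_singleton[OF sing cP])
  also have "\<dots> = (\<integral>\<^sup>+ x. emeasure \<nu> {(ax a False, ax a True)} \<partial>count_space (A \<inter> ?P))"
    by (rule nn_integral_cong) (use axis_orbit_mass[OF a] in simp)
  finally show ?thesis by simp
qed

lemma axis_mass_finite: "a \<in> X \<Longrightarrow> emeasure \<nu> {(ax a False, ax a True)} < \<infinity>"
proof -
  assume a: "a \<in> X"
  have "{(ax a False, ax a True)} \<subseteq> rect (a, True) []" using ax_pairs[OF a, of True] by simp
  from emeasure_mono[OF this rect_sets] show ?thesis
    using rect_compact nu unfolding Curr_def radon_measure_def by (auto intro: le_less_trans)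
qed

text \<open>For the edge c^-1 the multiplier \<open>a\<close> handles the continuations not labelled
  \<open>a\<close>, and \<open>b\<close> those labelled \<open>a\<close>; the flip then gives the
  edge \<open>c\<close>. For an edge \<open>d\<close>, a continuation labelled \<open>c\<close> is
  translated to an edge already treated. The other continuations are turned by d \<mapsto> d c^-1
  into lines through \<open>d\<close> and then c^-1, where the slide acts as a transvection with
  multiplier \<open>a\<close>.\<close>

lemma current_concentrated:
  assumes abc: "a \<in> X" "b \<in> X" "c \<in> X" "a \<noteq> b" "a \<noteq> c" "b \<noteq> c"
    and twist: "\<And>y. y \<in> X \<Longrightarrow> y \<noteq> c \<Longrightarrow>
      \<exists>r>0. aut_current (transvection (c, False) y 1) \<nu> = scale_measure (ennreal r) \<nu>"
    and slide: "\<And>d. d \<in> X \<Longrightarrow> d \<noteq> a \<Longrightarrow> d \<noteq> c \<Longrightarrow>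
      \<exists>f f'. coarse f f' \<and> (\<exists>r>0. aut_current f \<nu> = scale_measure (ennreal r) \<nu>) \<and>
        (\<forall>g\<in>carrier F. transvection (d, True) c (- 1) (f g) =
           transvection (d, True) a 1 (transvection (d, True) c (- 1) g))"
    and z: "z \<in> letters" "fst z \<noteq> a"
  shows "rect z [] \<in> null_sets \<nu>"
proof -
  have letters: "(x, e) \<in> letters" if "x \<in> X" for x e using that by (simp add: letters_def)
  have tw: "rect (c, False) [y] \<in> null_sets \<nu>"
    if x: "x \<in> X" "x \<noteq> c" and y: "fst y \<noteq> x" "y \<noteq> (c, True)" for x y
  proof -
    obtain r where r: "r > 0" "aut_current (transvection (c, False) x 1) \<nu> = scale_measure (ennreal r) \<nu>"
      using twist[OF x] by blast
    have zc: "(c, False) \<in> letters" "x \<in> X" "fst (c, False) \<noteq> x" using abc x letters by auto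
    have "{u \<in> pairs. boundary2_map (\<lambda>g. g) u \<in> rect (c, False) [y]} \<in> null_sets \<nu>"
      by (rule transvection_null[OF zc y(1) _ coarse_id coarse_transvection[OF zc] _ r(2,1)])
        (use y in simp_all)
    moreover have "{u \<in> pairs. boundary2_map (\<lambda>g. g) u \<in> rect (c, False) [y]} = rect (c, False) [y]"
      using rect_pairs by (auto simp: boundary2_map_ident)
    ultimately show ?thesis by simp
  qed
  have c1: "rect (c, False) [] \<in> null_sets \<nu>"
  proof (rule rect_null)
    fix y assume "y \<in> letters" "y \<noteq> linv (c, False)"
    then show "rect (c, False) [y] \<in> null_sets \<nu>"
      using tw[of a y] tw[of b y] abc by (cases "fst y = a") auto
  qed
  have c2: "rect (c, True) [] \<in> null_sets \<nu>"
    using rect_null_flip[OF letters[OF abc(3)] c1] by simp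
  have cc: "rect (c, e) [] \<in> null_sets \<nu>" for e using c1 c2 by (cases e) auto
  have d1: "rect (d, True) [] \<in> null_sets \<nu>" if d: "d \<in> X" "d \<noteq> a" "d \<noteq> c" for d
  proof (rule rect_null)
    let ?z = "(d, True)"
    fix y assume y: "y \<in> letters" "y \<noteq> linv ?z"
    have za: "?z \<in> letters" "a \<in> X" "fst ?z \<noteq> a" and zc: "?z \<in> letters" "c \<in> X" "fst ?z \<noteq> c"
      using abc d letters by auto
    show "rect ?z [y] \<in> null_sets \<nu>"
    proof (cases "fst y = c")
      case False
      obtain f f' r where f: "coarse f f'" "r > 0" "aut_current f \<nu> = scale_measure (ennreal r) \<nu>"
        "\<And>g. g \<in> carrier F \<Longrightarrow> transvection ?z c (- 1) (f g) = transvection ?z a 1 (transvection ?z c (- 1) g)"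
        using slide[OF d] by metis
      have "{u \<in> pairs. boundary2_map (transvection ?z c (- 1)) u \<in> rect ?z [(c, False)]} \<in> null_sets \<nu>"
        by (rule transvection_null[OF za _ _ coarse_transvection[OF zc] f(1,4,3,2)])
          (use abc d in auto)
      \<comment> \<open>Inserting c^-1 behind \<open>d\<close> causes no cancellation because
        \<open>y\<close> is not labelled \<open>c\<close>.\<close>
      moreover have "rect ?z [y] \<subseteq> {u \<in> pairs. boundary2_map (transvection ?z c (- 1)) u \<in> rect ?z [(c, False)]}"
      proof
        fix u assume u: "u \<in> rect ?z [y]"
        have "boundary2_map (transvection ?z c (- 1)) u \<in> rect ?z (apow c (- 1) @ [y])"
          using rect_transvection[OF zc False y(2), of u 0 "- 1"] u by simp
        then have "boundary2_map (transvection ?z c (- 1)) u \<in> rect ?z [(c, False)]"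
          using cyl_append[of _ "[?z, (c, False)]" "[y]"] unfolding rect_def by (auto simp: apow_def)
        then show "u \<in> {u \<in> pairs. boundary2_map (transvection ?z c (- 1)) u \<in> rect ?z [(c, False)]}"
          using u rect_pairs by blast
      qed
      ultimately show ?thesis using null_sets_subset rect_sets by blast
    next
      case True
      then have rn: "rect y [] \<in> null_sets \<nu>" using cc[of "snd y"] by (metis prod.collapse)
      have "linv ?z \<in> letters" using za(1) by (simp del: linv.simps)
      then have gF: "lv (linv ?z) \<in> carrier F" by simp
      have yz: "fst y \<noteq> fst ?z" using True d by simp
      have "rect ?z [y] \<subseteq> {x \<in> pairs. lt (lv (linv ?z)) x \<in> rect y []}"
        using rect_shift[OF za(1) yz] rect_pairs by blast
      then show ?thesis using null_sets_subset[OF lt_null[OF gF rn] rect_sets] by blast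
    qed
  qed
  show ?thesis
  proof (cases "fst z = c")
    case True
    then show ?thesis using cc[of "snd z"] by (metis prod.collapse)
  next
    case False
    have zX: "fst z \<in> X" using z(1) by (auto simp: letters_def)
    have T: "rect (fst z, True) [] \<in> null_sets \<nu>" by (rule d1[OF zX z(2) False])
    have "rect (fst z, False) [] \<in> null_sets \<nu>"
      using rect_null_flip[OF letters[OF zX] T] by simp
    then show ?thesis using T by (cases "snd z") (metis prod.collapse)+
  qed
qed

end

lemma current_class_scale:
  assumes r: "r > 0" shows "current_class (scale_measure (ennreal r) \<nu>) = current_class \<nu>"
proof -
  have "\<exists>t. scale_measure (ennreal s) (scale_measure (ennreal r) \<nu>) = scale_measure (ennreal t) \<nu> \<and> 0 < t" if "s > 0" for s
    using that r by (intro exI[of _ "s * r"]) (simp add: ennreal_mult)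
  moreover have "\<exists>t. scale_measure (ennreal s) \<nu> = scale_measure (ennreal t) (scale_measure (ennreal r) \<nu>) \<and> 0 < t" if "s > 0" for s
    using that r by (intro exI[of _ "s / r"]) (simp add: ennreal_mult[symmetric])
  ultimately show ?thesis unfolding current_class_def by blast
qed

text \<open>Both currents are multiples of counting measure on the axis orbit. The factor is
  positive because the current is nonzero, and finite because a single line lies in a compact set of
  lines.\<close>

lemma axis_current_class_unique:
  assumes a: "a \<in> X"
    and nu: "\<nu> \<in> Curr F X" "emeasure \<nu> (space \<nu>) \<noteq> 0" "\<And>z. z \<in> letters \<Longrightarrow> fst z \<noteq> a \<Longrightarrow> rect z [] \<in> null_sets \<nu>"
    and mu: "\<mu> \<in> Curr F X" "emeasure \<mu> (space \<mu>) \<noteq> 0" "\<And>z. z \<in> letters \<Longrightarrow> fst z \<noteq> a \<Longrightarrow> rect z [] \<in> null_sets \<mu>"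
  shows "current_class \<nu> = current_class \<mu>"
proof -
  let ?x = "(ax a False, ax a True)"
  have pos: "\<exists>m>0. emeasure \<nu> {?x} = ennreal m"
    if nu: "\<nu> \<in> Curr F X" "emeasure \<nu> (space \<nu>) \<noteq> 0" "\<And>z. z \<in> letters \<Longrightarrow> fst z \<noteq> a \<Longrightarrow> rect z [] \<in> null_sets \<nu>" for \<nu>
  proof -
    have "emeasure \<nu> {?x} \<noteq> 0"
    proof
      assume "emeasure \<nu> {?x} = 0"
      then show False using axis_orbit_concentrated[OF nu(1) a nu(3), of "space \<nu>"] nu(2) by simp
    qed
    moreover have "emeasure \<nu> {?x} < \<infinity>" by (rule axis_mass_finite[OF nu(1) a])
    ultimately show ?thesis
      by (intro exI[of _ "enn2real (emeasure \<nu> {?x})"]) (auto simp: enn2real_positive_iff less_top zero_less_iff_neq_zero)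
  qed
  obtain m where m: "m > 0" "emeasure \<nu> {?x} = ennreal m" using pos[OF nu] by blast
  obtain n where n: "n > 0" "emeasure \<mu> {?x} = ennreal n" using pos[OF mu] by blast
  have "\<nu> = scale_measure (ennreal (m / n)) \<mu>"
  proof (rule measure_eqI)
    show s: "sets \<nu> = sets (scale_measure (ennreal (m / n)) \<mu>)"
      by (simp add: sets_current[OF nu(1)] sets_current[OF mu(1)])
    fix A assume A: "A \<in> sets \<nu>"
    then have A': "A \<in> sets \<mu>" using s by simp
    let ?C = "emeasure (count_space (A \<inter> axis_orbit a)) (A \<inter> axis_orbit a)"
    have "emeasure \<nu> A = ennreal m * ?C" using axis_orbit_concentrated[OF nu(1) a nu(3) A] m by simp
    also have "ennreal m = ennreal (m / n) * ennreal n" using m n by (simp add: ennreal_mult[symmetric])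
    also have "\<dots> * ?C = ennreal (m / n) * (ennreal n * ?C)" by (rule mult.assoc)
    also have "ennreal n * ?C = emeasure \<mu> A" using axis_orbit_concentrated[OF mu(1) a mu(3) A'] n by simp
    finally show "emeasure \<nu> A = emeasure (scale_measure (ennreal (m / n)) \<mu>) A" by simp
  qed
  then show ?thesis using current_class_scale[of "m / n" \<mu>] m n by simp
qed

end

section \<open>Outer automorphisms\<close>

lemma (in group) AutoGroup_mult:
  "f \<in> auto G \<Longrightarrow> h \<in> auto G \<Longrightarrow> f \<otimes>\<^bsub>AutoGroup G\<^esub> h = compose (carrier G) f h"
  by (simp add: AutoGroup_def BijGroup_def auto_def)

lemma (in group) AutoGroup_carrier: "carrier (AutoGroup G) = auto G"
  by (simp add: AutoGroup_def)

lemma (in group) AutoGroup_one: "\<one>\<^bsub>AutoGroup G\<^esub> = (\<lambda>x\<in>carrier G. x)"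
  by (simp add: AutoGroup_def BijGroup_def)

lemma (in group) auto_bij: "h \<in> auto G \<Longrightarrow> bij_betw h (carrier G) (carrier G)"
  by (simp add: auto_def Bij_def)

text \<open>Conjugation is a homomorphism into the automorphism group with image
  \<open>Inn G\<close>, and an automorphism \<open>h\<close> turns conjugation by \<open>k\<close>
  into conjugation by \<open>h k\<close>.\<close>

lemma (in group) Inn_normal: "Inn G \<lhd> AutoGroup G"
proof -
  interpret A: group "AutoGroup G" by (rule AutoGroup)
  define cj where "cj g = (\<lambda>h\<in>carrier G. g \<otimes> h \<otimes> inv g)" for g
  have canc: "inv x \<otimes> (x \<otimes> y) = y" "x \<otimes> (inv x \<otimes> y) = y" if "x \<in> carrier G" "y \<in> carrier G" for x y
    using that by (simp_all add: m_assoc[symmetric])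
  have cj_hom: "cj g \<in> hom G G" if "g \<in> carrier G" for g
    using that by (auto simp: hom_def cj_def m_assoc canc)
  have cj_auto: "cj g \<in> auto G" if g: "g \<in> carrier G" for g
  proof -
    have "bij_betw (cj g) (carrier G) (carrier G)"
      by (rule bij_betw_byWitness[where f' = "cj (inv g)"]) (use g in \<open>auto simp: cj_def m_assoc canc\<close>)
    then show ?thesis using cj_hom[OF g] by (simp add: auto_def Bij_def cj_def)
  qed
  have cj_mult: "cj (g \<otimes> k) = cj g \<otimes>\<^bsub>AutoGroup G\<^esub> cj k" if "g \<in> carrier G" "k \<in> carrier G" for g k
    unfolding AutoGroup_mult[OF cj_auto[OF that(1)] cj_auto[OF that(2)]]
    using that by (auto simp: cj_def compose_def m_assoc inv_mult_group fun_eq_iff)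
  have Inn: "Inn G = cj ` carrier G" by (simp add: Inn_def cj_def)
  interpret c: group_hom G "AutoGroup G" cj
    by unfold_locales (auto simp: hom_def AutoGroup_carrier cj_auto cj_mult)
  show ?thesis
  proof (rule A.normal_invI)
    show "subgroup (Inn G) (AutoGroup G)" unfolding Inn by (rule c.img_is_subgroup)
    fix h i assume h: "h \<in> carrier (AutoGroup G)" and "i \<in> Inn G"
    then obtain k where k: "k \<in> carrier G" "i = cj k" unfolding Inn by blast
    have h': "h \<in> auto G" using h by (simp add: AutoGroup_carrier)
    interpret h: group_hom G G h by unfold_locales (use h' in \<open>simp add: auto_def\<close>)
    have hk: "cj (h k) \<in> carrier (AutoGroup G)" "cj k \<in> carrier (AutoGroup G)"
      using k cj_auto by (simp_all add: AutoGroup_carrier)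
    have "h \<otimes>\<^bsub>AutoGroup G\<^esub> cj k = cj (h k) \<otimes>\<^bsub>AutoGroup G\<^esub> h"
      unfolding AutoGroup_mult[OF h' cj_auto[OF k(1)]] AutoGroup_mult[OF cj_auto h', OF h.hom_closed[OF k(1)]]
      using k by (auto simp: compose_def cj_def fun_eq_iff)
    then have "h \<otimes>\<^bsub>AutoGroup G\<^esub> i \<otimes>\<^bsub>AutoGroup G\<^esub> inv\<^bsub>AutoGroup G\<^esub> h = cj (h k)"
      using h hk k(2) by (simp add: A.m_assoc)
    then show "h \<otimes>\<^bsub>AutoGroup G\<^esub> i \<otimes>\<^bsub>AutoGroup G\<^esub> inv\<^bsub>AutoGroup G\<^esub> h \<in> Inn G"
      using k unfolding Inn by simp
  qed
qed

lemma (in group) Inn_coset: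
  assumes h: "h \<in> auto G" and \<phi>: "\<phi> \<in> Inn G #>\<^bsub>AutoGroup G\<^esub> h"
  shows "\<phi> \<in> auto G" "\<exists>k\<in>carrier G. \<forall>g\<in>carrier G. \<phi> g = h (k \<otimes> g \<otimes> inv k)"
proof -
  interpret A: group "AutoGroup G" by (rule AutoGroup)
  interpret N: normal "Inn G" "AutoGroup G" by (rule Inn_normal)
  obtain i where i: "i \<in> Inn G" "\<phi> = i \<otimes>\<^bsub>AutoGroup G\<^esub> h" using \<phi> unfolding r_coset_def by blast
  have ia: "i \<in> auto G" using N.subset i(1) by (auto simp: AutoGroup_carrier)
  show "\<phi> \<in> auto G" using A.m_closed[of i h] ia h unfolding i(2) AutoGroup_carrier .
  obtain k where k: "k \<in> carrier G" "i = (\<lambda>h\<in>carrier G. k \<otimes> h \<otimes> inv k)" using i(1) unfolding Inn_def by blast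
  \<comment> \<open>Surjectivity of \<open>h\<close> allows the conjugation applied after
    \<open>h\<close> to be replaced by one applied before it.\<close>
  have "k \<in> h ` carrier G" using auto_bij[OF h] k(1) unfolding bij_betw_def by simp
  then obtain k' where k': "k' \<in> carrier G" "h k' = k" by blast
  interpret h: group_hom G G h by unfold_locales (use h in \<open>simp add: auto_def\<close>)
  have "\<phi> g = h (k' \<otimes> g \<otimes> inv k')" if "g \<in> carrier G" for g
    unfolding i(2) AutoGroup_mult[OF ia h] using k k' that by (simp add: compose_def)
  then show "\<exists>k\<in>carrier G. \<forall>g\<in>carrier G. \<phi> g = h (k \<otimes> g \<otimes> inv k)" using k'(1) by blast
qed

text \<open>\<open>out_action\<close> is a definite description over a coset, so all representatives
  have to give the same result; \<open>h\<close> itself shows that the coset is not empty.\<close>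

lemma (in group) out_action_coset:
  assumes h: "h \<in> auto G"
    and act: "\<And>\<phi> k. \<phi> \<in> auto G \<Longrightarrow> k \<in> carrier G \<Longrightarrow> (\<And>g. g \<in> carrier G \<Longrightarrow> \<phi> g = h (k \<otimes> g \<otimes> inv k)) \<Longrightarrow>
      act \<phi> x = y"
  shows "out_action act (Inn G #>\<^bsub>AutoGroup G\<^esub> h) x = y"
proof -
  interpret A: group "AutoGroup G" by (rule AutoGroup)
  interpret N: normal "Inn G" "AutoGroup G" by (rule Inn_normal)
  have self: "h \<in> Inn G #>\<^bsub>AutoGroup G\<^esub> h"
    by (rule A.rcos_self) (use h N.is_subgroup in \<open>simp_all add: AutoGroup_carrier\<close>)
  have all: "\<forall>\<phi>\<in>Inn G #>\<^bsub>AutoGroup G\<^esub> h. act \<phi> x = y"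
  proof
    fix \<phi> assume p: "\<phi> \<in> Inn G #>\<^bsub>AutoGroup G\<^esub> h"
    obtain k where "k \<in> carrier G" "\<forall>g\<in>carrier G. \<phi> g = h (k \<otimes> g \<otimes> inv k)"
      using Inn_coset(2)[OF h p] by blast
    then show "act \<phi> x = y" using act[OF Inn_coset(1)[OF h p]] by blast
  qed
  show ?thesis
    unfolding out_action_def
  proof (rule the_equality)
    show "\<forall>\<phi>\<in>Inn G #>\<^bsub>AutoGroup G\<^esub> h. act \<phi> x = y" by (rule all)
    fix y' assume "\<forall>\<phi>\<in>Inn G #>\<^bsub>AutoGroup G\<^esub> h. act \<phi> x = y'"
    then show "y' = y" using self all by metis
  qed
qed

lemma (in group) Out_coset_inverse:
  assumes h: "h \<in> auto G" "h' \<in> auto G" and inv: "\<And>g. g \<in> carrier G \<Longrightarrow> h (h' g) = g"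
  shows "Inn G #>\<^bsub>AutoGroup G\<^esub> h \<in> carrier (Out G)"
    and "inv\<^bsub>Out G\<^esub> (Inn G #>\<^bsub>AutoGroup G\<^esub> h') = Inn G #>\<^bsub>AutoGroup G\<^esub> h"
proof -
  interpret A: group "AutoGroup G" by (rule AutoGroup)
  interpret N: normal "Inn G" "AutoGroup G" by (rule Inn_normal)
  interpret O: group "Out G" unfolding Out_def by (rule N.factorgroup_is_group)
  have car: "Inn G #>\<^bsub>AutoGroup G\<^esub> f \<in> carrier (Out G)" if "f \<in> auto G" for f
    using that by (auto simp: Out_def FactGroup_def RCOSETS_def AutoGroup_carrier)
  show "Inn G #>\<^bsub>AutoGroup G\<^esub> h \<in> carrier (Out G)" by (rule car[OF h(1)])
  have "h \<otimes>\<^bsub>AutoGroup G\<^esub> h' = \<one>\<^bsub>AutoGroup G\<^esub>"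
    unfolding AutoGroup_mult[OF h] AutoGroup_one using inv by (auto simp: compose_def fun_eq_iff)
  then have "(Inn G #>\<^bsub>AutoGroup G\<^esub> h) \<otimes>\<^bsub>Out G\<^esub> (Inn G #>\<^bsub>AutoGroup G\<^esub> h') = Inn G"
    using N.rcos_sum[of h h'] h A.coset_mult_one[OF N.subset] by (simp add: Out_def FactGroup_def AutoGroup_carrier)
  then show "inv\<^bsub>Out G\<^esub> (Inn G #>\<^bsub>AutoGroup G\<^esub> h') = Inn G #>\<^bsub>AutoGroup G\<^esub> h"
    by (intro O.inv_equality car h) (simp add: Out_def FactGroup_def)
qed

text \<open>An anti-equivariant map turns the action of \<open>h'\<close> into that of the inverse
  of the class of \<open>h'\<close>, which is the class of \<open>h\<close>. Since both classes fix
  \<open>x\<close>, the two kinds of equivariance give the same conclusion.\<close>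

lemma (in group) equivariant_fixed:
  assumes eq: "equivariant (Out G) S \<alpha> \<beta> \<tau> \<or> anti_equivariant (Out G) S \<alpha> \<beta> \<tau>"
    and h: "h \<in> auto G" "h' \<in> auto G" "\<And>g. g \<in> carrier G \<Longrightarrow> h (h' g) = g" "\<And>g. g \<in> carrier G \<Longrightarrow> h' (h g) = g"
    and x: "x \<in> S" "\<alpha> (Inn G #>\<^bsub>AutoGroup G\<^esub> h) x = x" "\<alpha> (Inn G #>\<^bsub>AutoGroup G\<^esub> h') x = x"
  shows "\<beta> (Inn G #>\<^bsub>AutoGroup G\<^esub> h) (\<tau> x) = \<tau> x"
  using eq
proof
  assume "equivariant (Out G) S \<alpha> \<beta> \<tau>"
  then show ?thesis using Out_coset_inverse(1)[OF h(1-3)] x unfolding equivariant_def by metis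
next
  assume "anti_equivariant (Out G) S \<alpha> \<beta> \<tau>"
  then show ?thesis
    using Out_coset_inverse(1)[OF h(2,1,4)] Out_coset_inverse(2)[OF h(1-3)] x
    unfolding anti_equivariant_def by metis
qed

section \<open>Actions on projective length functions and on currents\<close>

lemma aut_PR_fixed:
  assumes \<phi>: "bij_betw \<phi> (carrier F) (carrier F)" and l: "\<And>g. g \<in> carrier F \<Longrightarrow> l (\<phi> g) = l g"
  shows "aut_PR F \<phi> (proj_class F l) = proj_class F l"
proof -
  have "aut_length F \<phi> (\<lambda>g\<in>carrier F. r * l g) = (\<lambda>g\<in>carrier F. r * l g)" for r
  proof
    fix w
    show "aut_length F \<phi> (\<lambda>g\<in>carrier F. r * l g) w = (\<lambda>g\<in>carrier F. r * l g) w"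
    proof (cases "w \<in> carrier F")
      case True
      define g where "g = inv_into (carrier F) \<phi> w"
      have "g \<in> carrier F" "\<phi> g = w"
        using \<phi> True by (auto simp: g_def bij_betw_inv_into_right bij_betw_def inv_into_into)
      then show ?thesis using True l[of g] by (simp add: aut_length_def g_def)
    qed (simp add: aut_length_def)
  qed
  then show ?thesis unfolding aut_PR_def proj_class_def by (force simp: image_iff)
qed

context free_gp_fin
begin

lemma auto_coarse:
  assumes h: "h \<in> auto F"
  shows "coarse h (\<lambda>g\<in>carrier F. inv_into (carrier F) h g)"
proof (rule coarse_aut)
  note b = auto_bij[OF h]
  show "h \<in> hom F F" using h by (simp add: auto_def)
  show "(\<lambda>g\<in>carrier F. inv_into (carrier F) h g) \<in> hom F F"
    using restrict_inv_into_hom[of h] h unfolding auto_def by blast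
  fix g assume g: "g \<in> carrier F"
  show "(\<lambda>g\<in>carrier F. inv_into (carrier F) h g) (h g) = g"
    using b g bij_betwE[OF b] by (simp add: bij_betw_inv_into_left)
  show "h ((\<lambda>g\<in>carrier F. inv_into (carrier F) h g) g) = g"
    using b g by (simp add: bij_betw_inv_into_right)
qed

text \<open>On the boundary the inner part is a left translation, under which a current is
  invariant.\<close>

lemma aut_current_inner:
  assumes nu: "\<nu> \<in> Curr F X" and h: "h \<in> auto F" and \<phi>: "\<phi> \<in> auto F" and k: "k \<in> carrier F"
    and eq: "\<And>g. g \<in> carrier F \<Longrightarrow> \<phi> g = h (k \<otimes> g \<otimes> inv k)"
  shows "aut_current \<phi> \<nu> = aut_current h \<nu>"
  unfolding aut_current_def
proof (rule measure_eqI)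
  note mh = boundary2_map_measurable[OF nu auto_coarse[OF h]]
  note mp = boundary2_map_measurable[OF nu auto_coarse[OF \<phi>]]
  show "sets (distr \<nu> \<nu> (boundary2_map \<phi>)) = sets (distr \<nu> \<nu> (boundary2_map h))" by simp
  fix A assume "A \<in> sets (distr \<nu> \<nu> (boundary2_map \<phi>))"
  then have A: "A \<in> sets \<nu>" by simp
  have pt: "boundary_map \<phi> p = boundary_map h (boundary_map (\<lambda>g. k \<otimes> g) p)" if p: "p \<in> bdry" for p
    unfolding left_mult_conj[OF k p, symmetric] boundary_map_comp using eq p by (intro boundary_map_cong) auto
  have "boundary2_map \<phi> x = boundary2_map h (lt k x)" if "x \<in> pairs" for x
    using that pt unfolding pairs_def boundary2_map_def by auto
  then have "{x \<in> pairs. boundary2_map \<phi> x \<in> A} = {x \<in> pairs. lt k x \<in> {y \<in> pairs. boundary2_map h y \<in> A}}"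
    using lt_pairs[OF k] by auto
  moreover have "boundary2_map f -` A \<inter> space \<nu> = {x \<in> pairs. boundary2_map f x \<in> A}" for f
    unfolding space_current[OF nu] by auto
  ultimately show "emeasure (distr \<nu> \<nu> (boundary2_map \<phi>)) A = emeasure (distr \<nu> \<nu> (boundary2_map h)) A"
    using lt_preimage[OF nu k preimage_sets[OF nu mh A]] by (simp add: emeasure_distr[OF mh A] emeasure_distr[OF mp A])
qed

lemma aut_PCurr_class:
  assumes nu: "\<nu> \<in> Curr F X" and h: "h \<in> auto F"
  shows "aut_PCurr h (current_class \<nu>) = current_class (aut_current h \<nu>)"
proof -
  note m = boundary2_map_measurable[OF nu auto_coarse[OF h]]
  have "aut_current h (scale_measure r \<nu>) = scale_measure r (aut_current h \<nu>)" for r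
    unfolding aut_current_def
  proof (rule measure_eqI)
    fix A assume "A \<in> sets (distr (scale_measure r \<nu>) (scale_measure r \<nu>) (boundary2_map h))"
    then have A: "A \<in> sets \<nu>" by simp
    have m': "boundary2_map h \<in> measurable (scale_measure r \<nu>) (scale_measure r \<nu>)"
      using m by (simp cong: measurable_cong_sets)
    show "emeasure (distr (scale_measure r \<nu>) (scale_measure r \<nu>) (boundary2_map h)) A =
        emeasure (scale_measure r (distr \<nu> \<nu> (boundary2_map h))) A"
      using A by (simp add: emeasure_distr[OF m A] emeasure_distr[OF m'] space_scale_measure)
  qed simp
  then show ?thesis unfolding aut_PCurr_def current_class_def by (force simp: image_iff)
qed

text \<open>The automorphism preserves \<open>hnn_length a c\<close> exactly and so fixes its class;
  equality of the current classes then determines \<open>aut_current h \<nu>\<close> only up to a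
  positive factor.\<close>

lemma fixed_current:
  assumes eq: "equivariant (Out F) (boundary_CV F) (out_action (aut_PR F)) (out_action aut_PCurr) \<tau> \<or>
      anti_equivariant (Out F) (boundary_CV F) (out_action (aut_PR F)) (out_action aut_PCurr) \<tau>"
    and ac: "a \<in> X" "c \<in> X" "a \<noteq> c"
    and h: "h \<in> auto F" "h' \<in> auto F" "\<And>g. g \<in> carrier F \<Longrightarrow> h (h' g) = g" "\<And>g. g \<in> carrier F \<Longrightarrow> h' (h g) = g"
    and p: "preserves a c h" "preserves a c h'"
    and nu: "\<nu> \<in> Curr F X" "\<tau> (proj_class F (hnn_length a c)) = current_class \<nu>"
  shows "\<exists>r>0. aut_current h \<nu> = scale_measure (ennreal r) \<nu>"
proof -
  let ?l = "hnn_length a c"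
  have fixed: "out_action (aut_PR F) (Inn F #>\<^bsub>AutoGroup F\<^esub> f) (proj_class F ?l) = proj_class F ?l"
    if f: "f \<in> auto F" "preserves a c f" "preserves a c f'" "\<And>g. g \<in> carrier F \<Longrightarrow> f' (f g) = g" for f f'
  proof (rule out_action_coset[OF f(1)])
    fix \<phi> k assume \<phi>: "\<phi> \<in> auto F" "k \<in> carrier F" "\<And>g. g \<in> carrier F \<Longrightarrow> \<phi> g = f (k \<otimes> g \<otimes> inv k)"
    show "aut_PR F \<phi> (proj_class F ?l) = proj_class F ?l"
    proof (rule aut_PR_fixed[OF auto_bij[OF \<phi>(1)]])
      fix g assume g: "g \<in> carrier F"
      have "?l (\<phi> g) = ?l (k \<otimes> g \<otimes> inv k)"
        unfolding \<phi>(3)[OF g] by (rule hnn_length_preserves[OF ac f(2-4)]) (use \<phi>(2) g in simp_all)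
      then show "?l (\<phi> g) = ?l g" using hnn_length_conj[OF ac \<phi>(2) g] by simp
    qed
  qed
  have "out_action aut_PCurr (Inn F #>\<^bsub>AutoGroup F\<^esub> h) (current_class \<nu>) = current_class \<nu>"
    using equivariant_fixed[OF eq h hnn_boundary[OF ac] fixed[OF h(1) p h(4)] fixed[OF h(2) p(2,1) h(3)]]
    unfolding nu(2) .
  moreover have "out_action aut_PCurr (Inn F #>\<^bsub>AutoGroup F\<^esub> h) (current_class \<nu>) = current_class (aut_current h \<nu>)"
    by (rule out_action_coset[OF h(1)])
      (use aut_PCurr_class[OF nu(1)] aut_current_inner[OF nu(1) h(1)] in metis)
  ultimately have "current_class (aut_current h \<nu>) = current_class \<nu>" by simp
  moreover have "scale_measure (ennreal 1) (aut_current h \<nu>) \<in> current_class (aut_current h \<nu>)"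
    unfolding current_class_def using zero_less_one by blast
  ultimately show ?thesis unfolding current_class_def by auto
qed

text \<open>The stable letter is multiplied from the left by an element of the vertex group, so c a
  c^-1 is conjugated inside that group.\<close>

lemma preserves_twist:
  assumes ac: "a \<in> X" "c \<in> X" "a \<noteq> c" and y: "y \<in> X" "y \<noteq> c"
  shows "preserves a c (transvection (c, False) y n)"
proof -
  have z: "(c, False) \<in> letters" "y \<in> X" "fst (c, False) \<noteq> y" using ac y by (auto simp: letters_def)
  interpret t: group_hom F F "transvection (c, False) y n"
    by unfold_locales (rule transvection_hom[OF z])
  have F: "a \<in> carrier F" "c \<in> carrier F" "y \<in> carrier F" using ac y X_carrier by auto
  have v: "y [^] (- n) \<in> vgrp a c" by (rule vgrp_pow[OF ac vgrp_X[OF ac y]])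
  have ta: "transvection (c, False) y n x = x" if "x \<in> X" "x \<noteq> c" for x
    using transvection_fixes[OF z that(1)] that(2) by simp
  have "transvection (c, False) y n (lv (c, True)) = y [^] (- n) \<otimes> lv (c, True)"
    using transvection_lv[OF z, of "(c, True)" n] ac by (simp add: letters_def trans_map_def)
  then have tc: "transvection (c, False) y n c = y [^] (- n) \<otimes> c" by (simp add: lv_def)
  have "transvection (c, False) y n (c \<otimes> a \<otimes> inv c) = y [^] (- n) \<otimes> (c \<otimes> a \<otimes> inv c) \<otimes> inv (y [^] (- n))"
    using F ta[OF ac(1,3)] tc by (simp add: inv_mult_group m_assoc)
  also have "\<dots> \<in> vgrp a c" using v vgrp_conj[OF ac] vgrp_mult[OF ac] vgrp_inv[OF ac] by blast
  finally have "transvection (c, False) y n (c \<otimes> a \<otimes> inv c) \<in> vgrp a c" .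
  moreover have "transvection (c, False) y n c = y [^] (- n) \<otimes> c \<otimes> \<one>" using tc F by simp
  ultimately show ?thesis
    unfolding preserves_def[OF ac] using t.homh ta vgrp_X[OF ac] v vgrp_one[OF ac] by auto
qed

text \<open>For distinct basis elements, the map b \<mapsto> b c a^n c^-1 that fixes the other basis
  elements. It is written as the conjugate of b \<mapsto> b a^n by b \<mapsto> b c because
  \<open>transvection_null\<close> works with transvections in changed coordinates.\<close>

definition slide :: "'a \<Rightarrow> 'a \<Rightarrow> 'a \<Rightarrow> int \<Rightarrow> 'a \<Rightarrow> 'a" where
  "slide b a c n = (\<lambda>g\<in>carrier F. transvection (b, True) c 1
     (transvection (b, True) a n (transvection (b, True) c (- 1) g)))"

context
  fixes a b c :: 'a
  assumes abc: "a \<in> X" "b \<in> X" "c \<in> X" "a \<noteq> b" "a \<noteq> c" "b \<noteq> c"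
begin

lemma slide_za: "(b, True) \<in> letters" "a \<in> X" "fst (b, True) \<noteq> a"
  and slide_zc: "(b, True) \<in> letters" "c \<in> X" "fst (b, True) \<noteq> c"
  using abc by (auto simp: letters_def)

lemma slide_cancel:
  assumes g: "g \<in> carrier F"
  shows "slide b a c (- n) (slide b a c n g) = g"
proof -
  let ?k = "transvection (b, True) c 1" and ?k' = "transvection (b, True) c (- 1)"
  have "?k' (?k h) = h" "?k (?k' h) = h" if "h \<in> carrier F" for h
    using transvection_cancel[OF slide_zc that, of 1] by simp_all
  then show ?thesis
    using g transvection_cancel(1)[OF slide_za, of "?k' g" n] transvection_closed[OF slide_zc] transvection_closed[OF slide_za]
    by (simp add: slide_def)
qed

lemma slide_hom: "slide b a c n \<in> hom F F"
  using transvection_closed[OF slide_zc] transvection_closed[OF slide_za]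
  by (auto simp: hom_def slide_def transvection_mult[OF slide_zc] transvection_mult[OF slide_za])

lemma slide_auto: "slide b a c n \<in> auto F"
proof -
  have closed: "slide b a c n g \<in> carrier F" if "g \<in> carrier F" for g n
    using slide_hom[of n] that by (auto simp: hom_def)
  have "bij_betw (slide b a c n) (carrier F) (carrier F)"
    by (rule bij_betw_byWitness[where f' = "slide b a c (- n)"])
      (use slide_cancel[of _ n] slide_cancel[of _ "- n"] closed in auto)
  then show ?thesis using slide_hom by (simp add: auto_def Bij_def slide_def)
qed

lemma slide_coarse: "coarse (slide b a c n) (slide b a c (- n))"
  by (rule coarse_aut[OF slide_hom slide_hom slide_cancel]) (use slide_cancel[of _ "- n"] in simp_all)

lemma slide_conj:
  "g \<in> carrier F \<Longrightarrow> transvection (b, True) c (- 1) (slide b a c n g) =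
     transvection (b, True) a n (transvection (b, True) c (- 1) g)"
  using transvection_cancel(1)[OF slide_zc, of _ 1] transvection_closed[OF slide_zc] transvection_closed[OF slide_za]
  by (simp add: slide_def)

text \<open>\<open>b\<close> is multiplied by a power of c a c^-1, an element of the vertex group,
  and the other basis elements are fixed.\<close>

lemma preserves_slide: "preserves a c (slide b a c n)"
proof -
  interpret s: group_hom F F "slide b a c n" by unfold_locales (rule slide_hom)
  let ?z = "(b, True)"
  have F: "a \<in> carrier F" "b \<in> carrier F" "c \<in> carrier F" using abc X_carrier by auto
  have fa: "transvection ?z a m x = x" and fc: "transvection ?z c m x = x" if "x \<in> X" "x \<noteq> b" for x m
    using transvection_fixes[OF slide_za that(1)] transvection_fixes[OF slide_zc that(1)] that(2) by auto
  have fix_x: "slide b a c n x = x" if x: "x \<in> X" "x \<noteq> b" for x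
    using fa[OF x] fc[OF x] X_carrier[OF x(1)] by (simp add: slide_def)
  have tb: "transvection ?z a m b = b \<otimes> a [^] m" "transvection ?z c m b = b \<otimes> c [^] m" for m
    using transvection_lv[OF slide_za slide_za(1), of m] transvection_lv[OF slide_zc slide_zc(1), of m]
    by (simp_all add: trans_map_def lv_def)
  have pw: "transvection ?z a m (c [^] i) = c [^] i" "transvection ?z c m (a [^] i) = a [^] i" for m i :: int
    using hom_int_pow[OF transvection_hom[OF slide_za] F(3) is_group is_group]
      hom_int_pow[OF transvection_hom[OF slide_zc] F(1) is_group is_group] fa[of c] fc[of a] abc by simp_all
  have "slide b a c n b = transvection ?z c 1 (transvection ?z a n (b \<otimes> c [^] (- 1 :: int)))"
    using F tb by (simp add: slide_def)
  also have "\<dots> = transvection ?z c 1 (b \<otimes> a [^] n \<otimes> c [^] (- 1 :: int))"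
    using F tb pw by (simp add: transvection_mult[OF slide_za])
  also have "\<dots> = b \<otimes> c \<otimes> a [^] n \<otimes> c [^] (- 1 :: int)"
    using F tb pw transvection_apow[OF slide_zc] by (simp add: transvection_mult[OF slide_zc])
  also have "\<dots> = b \<otimes> (c \<otimes> a [^] n \<otimes> inv c)"
    using F int_pow_neg[of c 1] by (simp add: m_assoc)
  finally have sb: "slide b a c n b = b \<otimes> (c \<otimes> a [^] n \<otimes> inv c)" .
  have ac: "a \<in> X" "c \<in> X" "a \<noteq> c" using abc by auto
  have "slide b a c n b \<in> vgrp a c"
    unfolding sb using vgrp_mult[OF ac vgrp_X[OF ac abc(2)] vgrp_conj_pow[OF ac]] abc by simp
  then have "\<forall>x\<in>X - {c}. slide b a c n x \<in> vgrp a c"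
    using fix_x vgrp_X[OF ac] by (metis DiffE insertI1)
  moreover have "slide b a c n (c \<otimes> a \<otimes> inv c) = c \<otimes> a \<otimes> inv c"
    using fix_x[of a] fix_x[of c] abc F by simp
  moreover have "slide b a c n c = \<one> \<otimes> c \<otimes> \<one>" using fix_x[of c] abc F by simp
  ultimately show ?thesis
    unfolding preserves_def[OF ac] using s.homh vgrp_conj[OF ac] vgrp_one[OF ac] by auto
qed

end

text \<open>Supplies the symmetries that \<open>current_concentrated\<close> asks for: the twists by
  all basis elements other than \<open>c\<close>, and the slides of all \<open>d\<close> other than
  \<open>a\<close> and \<open>c\<close>.\<close>

lemma image_concentrated:
  assumes eq: "equivariant (Out F) (boundary_CV F) (out_action (aut_PR F)) (out_action aut_PCurr) \<tau> \<or>
      anti_equivariant (Out F) (boundary_CV F) (out_action (aut_PR F)) (out_action aut_PCurr) \<tau>"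
    and abc: "a \<in> X" "b \<in> X" "c \<in> X" "a \<noteq> b" "a \<noteq> c" "b \<noteq> c"
    and nu: "\<nu> \<in> Curr F X" "\<tau> (proj_class F (hnn_length a c)) = current_class \<nu>"
    and z: "z \<in> letters" "fst z \<noteq> a"
  shows "rect z [] \<in> null_sets \<nu>"
proof (rule current_concentrated[OF nu(1) abc _ _ z])
  have ac: "a \<in> X" "c \<in> X" "a \<noteq> c" using abc by auto
  fix y assume y: "y \<in> X" "y \<noteq> c"
  have zy: "(c, False) \<in> letters" "y \<in> X" "fst (c, False) \<noteq> y" using abc y by (auto simp: letters_def)
  show "\<exists>r>0. aut_current (transvection (c, False) y 1) \<nu> = scale_measure (ennreal r) \<nu>"
    by (rule fixed_current[OF eq ac transvection_auto[OF zy] transvection_auto[OF zy, of "- 1"] _ _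
          preserves_twist[OF ac y] preserves_twist[OF ac y] nu])
      (use transvection_cancel[OF zy, of _ 1] in simp_all)
next
  have ac: "a \<in> X" "c \<in> X" "a \<noteq> c" using abc by auto
  fix d assume d: "d \<in> X" "d \<noteq> a" "d \<noteq> c"
  have adc: "a \<in> X" "d \<in> X" "c \<in> X" "a \<noteq> d" "a \<noteq> c" "d \<noteq> c" using abc d by auto
  have "\<exists>r>0. aut_current (slide d a c 1) \<nu> = scale_measure (ennreal r) \<nu>"
    by (rule fixed_current[OF eq ac slide_auto[OF adc] slide_auto[OF adc, of "- 1"] _ _
          preserves_slide[OF adc] preserves_slide[OF adc] nu])
      (use slide_cancel[OF adc, of _ 1] slide_cancel[OF adc, of _ "- 1"] in simp_all)
  then show "\<exists>f f'. coarse f f' \<and> (\<exists>r>0. aut_current f \<nu> = scale_measure (ennreal r) \<nu>) \<and>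
        (\<forall>g\<in>carrier F. transvection (d, True) c (- 1) (f g) =
           transvection (d, True) a 1 (transvection (d, True) c (- 1) g))"
    using slide_coarse[OF adc, of 1] slide_conj[OF adc, of _ 1] by blast
qed

end

theorem corollary1p1:
  fixes F :: "('a, 'm) monoid_scheme" and X :: "'a set" and k :: nat
  assumes "free_group_on F X" and "finite X" and "card X = k" and "k \<ge> 3"
  shows "\<not> (\<exists>\<tau>. embedding_map (boundary_CV_topology F) (PCurr_topology F X) \<tau> \<and>
           (equivariant (Out F) (boundary_CV F)
              (out_action (aut_PR F)) (out_action aut_PCurr) \<tau> \<or>
            anti_equivariant (Out F) (boundary_CV F)
              (out_action (aut_PR F)) (out_action aut_PCurr) \<tau>))"
proof
  assume "\<exists>\<tau>. embedding_map (boundary_CV_topology F) (PCurr_topology F X) \<tau> \<and>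
           (equivariant (Out F) (boundary_CV F)
              (out_action (aut_PR F)) (out_action aut_PCurr) \<tau> \<or>
            anti_equivariant (Out F) (boundary_CV F)
              (out_action (aut_PR F)) (out_action aut_PCurr) \<tau>)"
  then obtain \<tau> where emb: "embedding_map (boundary_CV_topology F) (PCurr_topology F X) \<tau>"
    and eq: "equivariant (Out F) (boundary_CV F) (out_action (aut_PR F)) (out_action aut_PCurr) \<tau> \<or>
      anti_equivariant (Out F) (boundary_CV F) (out_action (aut_PR F)) (out_action aut_PCurr) \<tau>"
    by blast
  have "X \<noteq> {}" using assms by auto
  interpret group F using assms(1) by (simp add: free_group_on_def)
  interpret free_gp_fin F X using assms \<open>X \<noteq> {}\<close> by unfold_locales auto
  have "3 \<le> card X" using assms by simp
  from obtain_subset_with_card_n[OF this] obtain T where T: "T \<subseteq> X" "card T = 3" by metis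
  then obtain a b c where T_eq: "T = {a, b, c}" and ne: "a \<noteq> b" "b \<noteq> c" "a \<noteq> c" by (auto simp: card_3_iff)
  have X: "a \<in> X" "b \<in> X" "c \<in> X" using T(1) T_eq by auto
  have top: "topspace (boundary_CV_topology F) = boundary_CV F"
    unfolding boundary_CV_topology_def boundary_CV_def using closure_of_subset_topspace[of "PR_topology F" "CV F"] by auto
  note hom = emb[unfolded embedding_map_def]
  have inj: "inj_on \<tau> (boundary_CV F)" using homeomorphic_imp_injective_map[OF hom] unfolding top .
  have sub: "\<tau> ` boundary_CV F \<subseteq> topspace (PCurr_topology F X)"
    using homeomorphic_imp_surjective_map[OF hom] unfolding top topspace_subtopology by (metis Int_lower1)
  have "topspace (Curr_topology F X) \<subseteq> Curr F X"
    unfolding Curr_topology_def topspace_pullback_topology by (rule Int_lower2)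
  then have "topspace (PCurr_topology F X) \<subseteq> current_class ` {\<nu> \<in> Curr F X. emeasure \<nu> (space \<nu>) \<noteq> 0}"
    unfolding PCurr_topology_def topspace_quotient_topology topspace_subtopology by (intro image_mono) blast
  then have cur: "\<exists>\<nu>\<in>Curr F X. emeasure \<nu> (space \<nu>) \<noteq> 0 \<and> \<tau> x = current_class \<nu>" if "x \<in> boundary_CV F" for x
    using sub that by blast
  let ?x = "proj_class F (hnn_length a c)" and ?y = "proj_class F (hnn_length a b)"
  have x: "?x \<in> boundary_CV F" by (rule hnn_boundary[OF X(1,3) ne(3)])
  have y: "?y \<in> boundary_CV F" by (rule hnn_boundary[OF X(1,2) ne(1)])
  obtain \<nu> where nu: "\<nu> \<in> Curr F X" "emeasure \<nu> (space \<nu>) \<noteq> 0" "\<tau> ?x = current_class \<nu>" using cur[OF x] by blast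
  obtain \<mu> where mu: "\<mu> \<in> Curr F X" "emeasure \<mu> (space \<mu>) \<noteq> 0" "\<tau> ?y = current_class \<mu>" using cur[OF y] by blast
  have "current_class \<nu> = current_class \<mu>"
  proof (rule axis_current_class_unique[OF X(1) nu(1,2) _ mu(1,2)])
    fix z assume z: "z \<in> letters" "fst z \<noteq> a"
    show "rect z [] \<in> null_sets \<nu>" by (rule image_concentrated[OF eq X ne(1,3,2) nu(1,3) z])
    \<comment> \<open>In the tree for \<open>a\<close> and \<open>b\<close> the letter
      \<open>c\<close> takes the part of the third basis element.\<close>
    show "rect z [] \<in> null_sets \<mu>"
      by (rule image_concentrated[OF eq X(1,3,2) ne(3,1) ne(2)[symmetric] mu(1,3) z])
  qed
  then have "?y = ?x" using inj_onD[OF inj, of ?y ?x] x y nu(3) mu(3) by simp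
  \<comment> \<open>The factor 1 exhibits the length function as a member of its own class.\<close>
  moreover have "(\<lambda>g\<in>carrier F. 1 * hnn_length a b g) \<in> ?y"
    unfolding proj_class_def by (rule CollectI, rule exI[of _ 1]) simp
  ultimately obtain r where r: "r \<noteq> 0" "(\<lambda>g\<in>carrier F. 1 * hnn_length a b g) = (\<lambda>g\<in>carrier F. r * hnn_length a c g)"
    unfolding proj_class_def by auto
  have cF: "c \<in> carrier F" by (rule X_carrier[OF X(3)])
  have "hnn_length a b c = r * hnn_length a c c" using fun_cong[OF r(2), of c] cF by simp
  moreover have "hnn_length a b c = 0"
    by (rule hnn_length_vgrp[OF X(1,2) ne(1) vgrp_X[OF X(1,2) ne(1) X(3) ne(2)[symmetric]]])
  ultimately show False using r(1) hnn_length_c[OF X(1,3) ne(3)] by simp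
qed

end
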